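(* A holomorphic function $T:\mathbb{C}^d\to\mathcal{L}(\mathcal{H})$ belongs to $\mathcal{B}(\mathcal{L}(\mathcal{H}))$ if and only if there exist constants $c_1,c_2>0$ such that for all $z\in\mathbb{C}^d$ $$\|RT(z)\|_{\mathcal{L}(\mathcal{H})}\le c_1|z|\sqrt{\Phi'(|z|^2)}\quad\text{and}\quad\|T_{ij}(T)(z)\|_{\mathcal{L}(\mathcal{H})}\le c_2|z|\sqrt{\Psi'(|z|^2)},\quad 1\le i,j\le d,$$ where $RT(z)=\sum_{k=1}^d z_k\frac{\partial T}{\partial z_k}(z)$ is the radial derivative and $T_{ij}(T)(z)=\bar z_i\frac{\partial T}{\partial z_j}(z)-\bar z_j\frac{\partial T}{\partial z_i}(z)$ are the tangential derivatives of $T$.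
   Context: Weight: $d\ge1$; $\Psi:[0,\infty)\to[0,\infty)$ is a $C^3$ function with $\Psi'>0$, $\Psi''\ge0$, $\Psi'''\ge0$. A function $g:[0,\infty)\to[0,\infty)$ belongs to the class $\mathcal{S}$ if there is a real $\eta<\frac12$ with $g''(x)=O\big(x^{-1/2}[g'(x)]^{1+\eta}\big)$ as $x\to+\infty$. Put $\Phi(x):=x\Psi'(x)$. It is assumed that $\Phi\in\mathcal{S}$ and, when $d>1$, that also $\Psi\in\mathcal{S}$. Put $\varphi(z):=\Psi(|z|^2)$ and $d\mu_\varphi(z)=e^{-\varphi(z)}dm_d(z)$, with $dm_d$ Lebesgue measure on $\mathbb{C}^d$. $\mathcal{H}$ is a separable complex Hilbert space, $\mathcal{L}(\mathcal{H})$ the bounded linear operators on $\mathcal{H}$. $\mathcal{F}^2_\varphi(\mathbb{C})$ is the Hilbert space of scalar holomorphic functions on $\mathbb{C}^d$ that are square integrable with respect to $d\mu_\varphi$, and $K(z,w)$ is its reproducing kernel. Bloch space: $B(z)$ is the (positive definite) $d\times d$ Bergman matrix with $(j,k)$ entry $\frac{\partial^2}{\partial\bar z_j\partial z_k}\log K(z,z)$. With $D_iT=\partial T/\partial z_i$, $$Q_T(z):=\sum_{1\le i,j\le d}\overline{B^{-1}(z)}_{ij}\,D_jT(z)\,(D_iT(z))^*,\quad z\in\mathbb{C}^d.$$ $\mathcal{B}(\mathcal{L}(\mathcal{H}))$ is the space of holomorphic $T:\mathbb{C}^d\to\mathcal{L}(\mathcal{H})$ with $\|T(0)\|_{\mathcal{L}(\mathcal{H})}+\sup_{z}\|Q_T(z)\|^{1/2}_{\mathcal{L}(\mathcal{H})}<\infty$.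 *)

theory Defs
  imports "HOL-Analysis.Analysis"
begin

subsection \<open>Complex normed spaces and separable complex Hilbert spaces\<close>

class scaleC =
  fixes scaleC :: "complex \<Rightarrow> 'a \<Rightarrow> 'a"  (infixr \<open>*\<^sub>C\<close> 75)

class complex_normed_vector = real_normed_vector + scaleC +
  assumes scaleC_add_right: "c *\<^sub>C (x + y) = c *\<^sub>C x + c *\<^sub>C y"
    and scaleC_add_left: "(c + c') *\<^sub>C x = c *\<^sub>C x + c' *\<^sub>C x"
    and scaleC_scaleC: "c *\<^sub>C (c' *\<^sub>C x) = (c * c') *\<^sub>C x"
    and scaleR_scaleC: "r *\<^sub>R x = complex_of_real r *\<^sub>C x"
    and norm_scaleC: "norm (c *\<^sub>C x) = cmod c * norm x"

text \<open>The inner product is linear in its first argument.\<close>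

class complex_hilbert_space = complex_normed_vector + complete_space +
  fixes cinner :: "'a \<Rightarrow> 'a \<Rightarrow> complex"
  assumes cinner_add_left: "cinner (x + y) v = cinner x v + cinner y v"
    and cinner_scaleC_left: "cinner (c *\<^sub>C x) v = c * cinner x v"
    and cinner_commute: "cinner x y = cnj (cinner y x)"
    and cinner_self: "cinner x x = complex_of_real ((norm x)\<^sup>2)"

class separable_complex_hilbert_space = complex_hilbert_space +
  assumes separable: "\<exists>D. countable D \<and> (\<forall>x. \<forall>e>0. \<exists>y\<in>D. dist x y < e)"

instantiation complex :: complex_normed_vector
begin

definition scaleC_complex_def: "c *\<^sub>C (x :: complex) = c * x"

instance
  by standard (simp_all add: scaleC_complex_def algebra_simps norm_mult scaleR_conv_of_real)

end

lemma bounded_linear_scaleC: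
  "bounded_linear (\<lambda>x :: 'a :: complex_normed_vector. c *\<^sub>C x)"
proof (rule bounded_linear_intro[where K = "cmod c"])
  fix x y :: 'a and r :: real
  show "c *\<^sub>C (x + y) = c *\<^sub>C x + c *\<^sub>C y"
    by (rule scaleC_add_right)
  show "c *\<^sub>C (r *\<^sub>R x) = r *\<^sub>R (c *\<^sub>C x)"
    by (simp add: scaleR_scaleC scaleC_scaleC mult.commute)
  show "norm (c *\<^sub>C x) \<le> norm x * cmod c"
    by (simp add: norm_scaleC mult.commute)
qed

text \<open>
  The type \<open>'a \<Rightarrow>\<^sub>L 'b\<close> consists of the bounded real-linear maps.  If the target is a complex
  space, it is a complex normed space under pointwise scaling.
\<close>

instantiation blinfun :: (real_normed_vector, complex_normed_vector) complex_normed_vector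
begin

definition scaleC_blinfun_def: "c *\<^sub>C (A :: 'a \<Rightarrow>\<^sub>L 'b) = Blinfun (\<lambda>y. c *\<^sub>C y) o\<^sub>L A"

lemma scaleC_blinfun_apply:
  "blinfun_apply (c *\<^sub>C (A :: 'a \<Rightarrow>\<^sub>L 'b)) x = c *\<^sub>C blinfun_apply A x"
  by (simp add: scaleC_blinfun_def bounded_linear_Blinfun_apply bounded_linear_scaleC)

instance
proof
  fix c c' :: complex and r :: real and A A' :: "'a \<Rightarrow>\<^sub>L 'b"
  show "c *\<^sub>C (A + A') = c *\<^sub>C A + c *\<^sub>C A'"
    by (rule blinfun_eqI) (simp add: scaleC_blinfun_apply blinfun.add_left scaleC_add_right)
  show "(c + c') *\<^sub>C A = c *\<^sub>C A + c' *\<^sub>C A"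
    by (rule blinfun_eqI) (simp add: scaleC_blinfun_apply blinfun.add_left scaleC_add_left)
  show "c *\<^sub>C (c' *\<^sub>C A) = (c * c') *\<^sub>C A"
    by (rule blinfun_eqI) (simp add: scaleC_blinfun_apply scaleC_scaleC)
  show "r *\<^sub>R A = complex_of_real r *\<^sub>C A"
    by (rule blinfun_eqI) (simp add: scaleC_blinfun_apply blinfun.scaleR_left scaleR_scaleC)
  have le: "norm (e *\<^sub>C B) \<le> cmod e * norm B" for e and B :: "'a \<Rightarrow>\<^sub>L 'b"
  proof (rule norm_blinfun_bound)
    fix x
    show "norm (blinfun_apply (e *\<^sub>C B) x) \<le> cmod e * norm B * norm x"
      using mult_left_mono[OF norm_blinfun[of B x], of "cmod e"]
      by (simp add: scaleC_blinfun_apply norm_scaleC mult.assoc)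
  qed simp
  show "norm (c *\<^sub>C A) = cmod c * norm A"
  proof (cases "c = 0")
    case True
    then show ?thesis using le[of 0 A] by simp
  next
    case False
    have "inverse c *\<^sub>C (c *\<^sub>C A) = A"
      using False scaleR_scaleC[where 'a = 'b, of 1]
      by (intro blinfun_eqI) (simp add: scaleC_blinfun_apply scaleC_scaleC)
    then have "norm A \<le> inverse (cmod c) * norm (c *\<^sub>C A)"
      using le[of "inverse c" "c *\<^sub>C A"] by (simp add: norm_inverse)
    then have "cmod c * norm A \<le> norm (c *\<^sub>C A)"
      using False by (simp add: field_simps)
    with le[of c A] show ?thesis by simp
  qed
qed

end

text \<open>The space \<open>\<L>(\<H>)\<close>; its operator norm is the norm of the type \<open>'h \<Rightarrow>\<^sub>L 'h\<close>.\<close>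

definition bounded_operators :: "('h :: complex_normed_vector \<Rightarrow>\<^sub>L 'h) set" where
  "bounded_operators = {A. \<forall>c x. blinfun_apply A (c *\<^sub>C x) = c *\<^sub>C blinfun_apply A x}"

definition adj :: "('h :: complex_hilbert_space \<Rightarrow>\<^sub>L 'h) \<Rightarrow> ('h \<Rightarrow>\<^sub>L 'h)" where
  "adj A = (THE B. \<forall>x y. cinner (blinfun_apply A x) y = cinner x (blinfun_apply B y))"


subsection \<open>Holomorphic functions on \<open>\<complex>\<^sup>d\<close> and Wirtinger derivatives\<close>

definition entire :: "(complex ^ 'd \<Rightarrow> 'b :: complex_normed_vector) \<Rightarrow> bool" where
  "entire f \<longleftrightarrow>
     (\<forall>z. \<exists>D. (f has_derivative D) (at z) \<and> (\<forall>c v. D (c *s v) = c *\<^sub>C D v))"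

definition dir_deriv ::
    "complex ^ 'd \<Rightarrow> (complex ^ 'd \<Rightarrow> 'b :: real_normed_vector) \<Rightarrow> complex ^ 'd \<Rightarrow> 'b" where
  "dir_deriv v f z = vector_derivative (\<lambda>t :: real. f (z + t *\<^sub>R v)) (at 0)"

text \<open>
  With \<open>z\<^sub>k = x\<^sub>k + i y\<^sub>k\<close>: \<open>\<partial>/\<partial>z\<^sub>k = (\<partial>/\<partial>x\<^sub>k - i \<partial>/\<partial>y\<^sub>k)/2\<close>
  and \<open>\<partial>/\<partial>\<bar>z\<^sub>k = (\<partial>/\<partial>x\<^sub>k + i \<partial>/\<partial>y\<^sub>k)/2\<close>.
\<close>

definition dz :: "'d \<Rightarrow> (complex ^ 'd \<Rightarrow> 'b :: complex_normed_vector) \<Rightarrow> complex ^ 'd \<Rightarrow> 'b" where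
  "dz k f z = (1 / 2) *\<^sub>R (dir_deriv (axis k 1) f z - \<i> *\<^sub>C dir_deriv (axis k \<i>) f z)"

definition dzbar :: "'d \<Rightarrow> (complex ^ 'd \<Rightarrow> 'b :: complex_normed_vector) \<Rightarrow> complex ^ 'd \<Rightarrow> 'b" where
  "dzbar k f z = (1 / 2) *\<^sub>R (dir_deriv (axis k 1) f z + \<i> *\<^sub>C dir_deriv (axis k \<i>) f z)"


subsection \<open>Weights\<close>

text \<open>
  Functions on \<open>[0,\<infinity>)\<close> are represented by total functions on the reals whose values at negative
  arguments are never used; at \<open>0\<close> derivatives are one-sided.
\<close>

definition hderiv :: "(real \<Rightarrow> real) \<Rightarrow> real \<Rightarrow> real" where
  "hderiv f x = vector_derivative f (at x within {0..})"

definition C3_halfline :: "(real \<Rightarrow> real) \<Rightarrow> bool" where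
  "C3_halfline f \<longleftrightarrow>
     f differentiable_on {0..} \<and> hderiv f differentiable_on {0..} \<and>
     hderiv (hderiv f) differentiable_on {0..} \<and>
     continuous_on {0..} (hderiv (hderiv (hderiv f)))"

definition class_S :: "(real \<Rightarrow> real) set" where
  "class_S = {g. (\<forall>x\<ge>0. 0 \<le> g x) \<and>
     g differentiable_on {0..} \<and> hderiv g differentiable_on {0..} \<and>
     (\<exists>\<eta><1/2. hderiv (hderiv g) \<in> O[at_top](\<lambda>x. x powr (- 1/2) * hderiv g x powr (1 + \<eta>)))}"

definition Phi :: "(real \<Rightarrow> real) \<Rightarrow> real \<Rightarrow> real" where
  "Phi \<Psi> x = x * hderiv \<Psi> x"


subsection \<open>The Fock space, its reproducing kernel and the Bergman matrix\<close>

definition fock_measure :: "(real \<Rightarrow> real) \<Rightarrow> (complex ^ 'd) measure" where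
  "fock_measure \<Psi> = density lborel (\<lambda>z. ennreal (exp (- \<Psi> ((norm z)\<^sup>2))))"

definition fock_space :: "(real \<Rightarrow> real) \<Rightarrow> (complex ^ 'd \<Rightarrow> complex) set" where
  "fock_space \<Psi> = {f. entire f \<and> integrable (fock_measure \<Psi>) (\<lambda>z. (cmod (f z))\<^sup>2)}"

definition is_reproducing_kernel ::
    "(real \<Rightarrow> real) \<Rightarrow> (complex ^ 'd \<Rightarrow> complex ^ 'd \<Rightarrow> complex) \<Rightarrow> bool" where
  "is_reproducing_kernel \<Psi> K \<longleftrightarrow>
     (\<forall>w. (\<lambda>z. K z w) \<in> fock_space \<Psi> \<and>
          (\<forall>f\<in>fock_space \<Psi>. f w = (\<integral>z. f z * cnj (K z w) \<partial>fock_measure \<Psi>)))"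

definition kernel :: "(real \<Rightarrow> real) \<Rightarrow> complex ^ 'd \<Rightarrow> complex ^ 'd \<Rightarrow> complex" where
  "kernel \<Psi> = (THE K. is_reproducing_kernel \<Psi> K)"

definition bergman_matrix :: "(real \<Rightarrow> real) \<Rightarrow> complex ^ 'd \<Rightarrow> complex ^ 'd ^ 'd" where
  "bergman_matrix \<Psi> z = (\<chi> j k. dzbar j (dz k (\<lambda>u. ln (kernel \<Psi> u u))) z)"


subsection \<open>The Bloch space, radial and tangential derivatives\<close>

definition Q ::
    "(real \<Rightarrow> real) \<Rightarrow> (complex ^ 'd \<Rightarrow> ('h :: complex_hilbert_space \<Rightarrow>\<^sub>L 'h)) \<Rightarrow>
     complex ^ 'd \<Rightarrow> ('h \<Rightarrow>\<^sub>L 'h)" where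
  "Q \<Psi> T z = (\<Sum>i\<in>UNIV. \<Sum>j\<in>UNIV.
     cnj (matrix_inv (bergman_matrix \<Psi> z) $ i $ j) *\<^sub>C (dz j T z o\<^sub>L adj (dz i T z)))"

definition holomorphic_operator_functions ::
    "(complex ^ 'd \<Rightarrow> ('h :: complex_hilbert_space \<Rightarrow>\<^sub>L 'h)) set" where
  "holomorphic_operator_functions = {T. (\<forall>z. T z \<in> bounded_operators) \<and> entire T}"

definition bloch_space ::
    "(real \<Rightarrow> real) \<Rightarrow> (complex ^ 'd \<Rightarrow> ('h :: complex_hilbert_space \<Rightarrow>\<^sub>L 'h)) set" where
  "bloch_space \<Psi> = {T \<in> holomorphic_operator_functions.
     ereal (norm (T 0)) + (SUP z. ereal (sqrt (norm (Q \<Psi> T z)))) < \<infinity>}"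

definition radial_deriv ::
    "(complex ^ 'd \<Rightarrow> 'b :: complex_normed_vector) \<Rightarrow> complex ^ 'd \<Rightarrow> 'b" where
  "radial_deriv T z = (\<Sum>k\<in>UNIV. (z $ k) *\<^sub>C dz k T z)"

definition tangential_deriv ::
    "'d \<Rightarrow> 'd \<Rightarrow> (complex ^ 'd \<Rightarrow> 'b :: complex_normed_vector) \<Rightarrow> complex ^ 'd \<Rightarrow> 'b" where
  "tangential_deriv i j T z = cnj (z $ i) *\<^sub>C dz j T z - cnj (z $ j) *\<^sub>C dz i T z"

end

theory Submission
  imports Defs "HOL-Complex_Analysis.Complex_Analysis"
begin

text \<open>
  The kernel on the diagonal is \<open>F (\<bar>z\<bar>\<^sup>2)\<close> for a power series \<open>F\<close> whose coefficients are, up to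
  factorials, the reciprocal moments of \<open>exp (- \<Psi>)\<close>.  Hence the Bergman matrix acts as \<open>g'\<close> in the
  radial direction and as \<open>L'\<close> in the tangential ones, where \<open>L = ln F\<close> and \<open>g x = x * L' x\<close>, and
  the Lagrange identity gives
  \<open>\<bar>z\<bar>\<^sup>2 Q = R R\<^sup>* / g' + (\<Sum>i j. T\<^sub>i\<^sub>j T\<^sub>i\<^sub>j\<^sup>*) / (2 L')\<close> with \<open>R\<close> and \<open>T\<^sub>i\<^sub>j\<close> the radial and tangential derivatives.

  All summands are positive, so it suffices to compare \<open>g'\<close> with \<open>\<Phi>'\<close>, and \<open>L'\<close> with \<open>\<Psi>'\<close>; the
  second comparison is the first one integrated.  Now \<open>x * g' x\<close> is the variance of the probability
  on the naturals proportional to the terms of the series \<open>F x\<close>.  In the variable \<open>t = ln x\<close> the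
  weight \<open>\<psi> t = \<Psi> (exp t)\<close> has \<open>\<psi>'' t = x * \<Phi>' x\<close>, and class \<open>\<S>\<close> makes \<open>\<psi>\<close> self-concordant,
  \<open>\<bar>\<psi>'''\<bar> \<le> C \<psi>'' powr (3/2)\<close>.  So \<open>\<psi>\<close> is quadratic up to constants on the scale \<open>\<psi>'' powr (-1/2)\<close>,
  Laplace's method bounds the moments on both sides, and the terms of the series concentrate
  around \<open>\<Phi> x\<close> with width \<open>sqrt (x * \<Phi>' x)\<close>.
\<close>

subsection \<open>Curvature and Laplace bounds for the moments\<close>

text \<open>The coefficients of \<open>F\<close> are reciprocals of moments. So the moments must be
  bounded below at every index, to make the terms decay, but above only near the peak, to make the
  terms there large. This asymmetry shapes all estimates of the Laplace type.

  The coefficients themselves have to be known exactly up to a common factor. No integral over a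
  sphere is evaluated for this. Homogeneity gives the integral of
  \<open>cmod (ip z w) ^ (2 * n)\<close> against every radial weight up to a constant that depends
  on \<open>n\<close> but not on the weight, and the Gaussian weight, where completing the square
  yields a generating function, determines that constant. No orthonormal basis is needed either:
  averages over two circle actions reduce the integral of \<open>f\<close> against a conjugate power
  of \<open>ip z w\<close> to a Taylor coefficient of \<open>f\<close> on a complex line, so the
  candidate kernel is seen to reproduce \<open>f\<close> term by term.\<close>

lemma taylor_second_order:
  fixes f f' f'' :: "real \<Rightarrow> real"
  assumes "\<And>s. (f has_real_derivative f' s) (at s)"
    and "\<And>s. (f' has_real_derivative f'' s) (at s)"
  shows "\<exists>\<xi>. \<bar>\<xi> - a\<bar> \<le> \<bar>b - a\<bar> \<and> f b - f a - f' a * (b - a) = f'' \<xi> / 2 * (b - a)\<^sup>2"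
proof (cases "a = b")
  case False
  define diff where "diff = (\<lambda>m::nat. if m = 0 then f else if m = 1 then f' else f'')"
  have "\<exists>\<xi>. (if b < a then b < \<xi> \<and> \<xi> < a else a < \<xi> \<and> \<xi> < b) \<and>
        f b = (\<Sum>m<2. (diff m a / fact m) * (b - a)^m) + (diff 2 \<xi> / fact 2) * (b - a)^2"
  proof (rule Taylor[where a = "min a b" and b = "max a b"])
    show "\<forall>m t. m < 2 \<and> min a b \<le> t \<and> t \<le> max a b \<longrightarrow> DERIV (diff m) t :> diff (Suc m) t"
      using assms by (auto simp: diff_def less_2_cases_iff)
  qed (use False in \<open>auto simp: diff_def\<close>)
  then show ?thesis
    by (force simp: diff_def numeral_2_eq_2 split: if_splits)
qed (auto intro!: exI[of _ b])

text \<open>The bound on \<open>r\<close> says that \<open>1 / sqrt q\<close> is Lipschitz with constant \<open>C\<close>, so \<open>q\<close> does not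
  change its order of magnitude on the scale \<open>1 / sqrt (q t)\<close>.\<close>

lemma self_concordant_window:
  fixes q r :: "real \<Rightarrow> real"
  assumes dq: "\<And>s. (q has_real_derivative r s) (at s)"
    and qpos: "\<And>s. q s > 0"
    and sc: "\<And>s. s \<ge> \<tau> \<Longrightarrow> \<bar>r s\<bar> \<le> 2 * C * (q s * sqrt (q s))"
    and t: "t - 1 \<ge> \<tau>" and \<sigma>: "\<sigma> = sqrt (q t)" "\<sigma> \<ge> 1"
    and \<delta>: "0 < \<delta>" "\<delta> \<le> 1" "C * \<delta> \<le> 1 / 2" "C \<ge> 0"
    and u: "\<bar>u\<bar> \<le> \<delta> / \<sigma>"
  shows "4 / 9 * \<sigma>\<^sup>2 \<le> q (t + u)" "q (t + u) \<le> 4 * \<sigma>\<^sup>2"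
proof -
  \<comment> \<open>\<open>\<delta> \<le> 1\<close> and \<open>\<sigma> \<ge> 1\<close> keep
    \<open>t + u\<close> within distance 1 of \<open>t\<close>, hence above \<open>\<tau>\<close>,
    where the bound on \<open>r\<close> holds.\<close>
  have w1: "\<delta> / \<sigma> \<le> 1" using order_trans[OF \<delta>(2) \<sigma>(2)] \<sigma>(2) by simp
  define k where "k s = 1 / sqrt (q s)" for s
  define k' where "k' s = - r s / (2 * (q s * sqrt (q s)))" for s
  have dk: "(k has_real_derivative k' s) (at s)" for s
    unfolding k_def k'_def using qpos[of s]
    by (auto intro!: derivative_eq_intros dq simp: field_simps power2_eq_square)
  have k'b: "\<bar>k' s\<bar> \<le> C" if "s \<ge> \<tau>" for s
    using sc[OF that] qpos[of s]
    by (simp add: k'_def abs_divide abs_mult divide_le_eq algebra_simps)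
  have "\<bar>k (t + u) - k t\<bar> \<le> C * \<bar>(t + u) - t\<bar>"
  proof -
    have "norm (k (t+u) - k t) \<le> C * norm ((t + u) - t)"
    proof (rule field_differentiable_bound[where S = "{t-1..t+1}" and f' = k'])
      show "(k has_field_derivative k' z) (at z within {t - 1..t + 1})" for z
        using dk by (rule has_field_derivative_at_within)
      show "norm (k' z) \<le> C" if "z \<in> {t - 1..t + 1}" for z
        using k'b[of z] that t by auto
    qed (use u w1 in auto)
    then show ?thesis by simp
  qed
  also have "\<dots> \<le> C * (\<delta> / \<sigma>)" using u \<delta> by (intro mult_left_mono) auto
  also have "\<dots> \<le> 1 / (2 * \<sigma>)" using \<delta> \<sigma> by (simp add: field_simps)
  finally have *: "\<bar>k (t + u) - 1 / \<sigma>\<bar> \<le> 1 / (2 * \<sigma>)" by (simp add: k_def \<sigma>)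
  define Q where "Q = sqrt (q (t + u))"
  have Q: "Q > 0" "Q\<^sup>2 = q (t + u)" using qpos[of "t+u"] by (auto simp: Q_def)
  from * have "1 / Q - 1 / \<sigma> \<le> 1 / (2 * \<sigma>)" "1 / \<sigma> - 1 / Q \<le> 1 / (2 * \<sigma>)"
    unfolding k_def Q_def by linarith+
  moreover have "1 / \<sigma> = 2 * (1 / (2 * \<sigma>))" "3 / (2 * \<sigma>) = 3 * (1 / (2 * \<sigma>))" by simp_all
  ultimately have "1 / Q \<le> 3 / (2 * \<sigma>)" "1 / Q \<ge> 1 / (2 * \<sigma>)"
    by linarith+
  \<comment> \<open>\<open>1 / Q\<close> differs from \<open>1 / \<sigma>\<close> by at most half of
    it, so \<open>Q / \<sigma>\<close> lies between 2/3 and 2; the constants 4/9 and 4 are the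
    squares.\<close>
  then have "2 / 3 * \<sigma> \<le> Q" "Q \<le> 2 * \<sigma>" using Q \<sigma>(2) by (auto simp: field_simps)
  then have "(2 / 3 * \<sigma>)\<^sup>2 \<le> Q\<^sup>2" "Q\<^sup>2 \<le> (2 * \<sigma>)\<^sup>2"
    using \<sigma>(2) Q(1) by (intro power_mono; simp)+
  then show "4 / 9 * \<sigma>\<^sup>2 \<le> q (t + u)" "q (t + u) \<le> 4 * \<sigma>\<^sup>2"
    unfolding Q(2) by (simp_all add: power_mult_distrib power_divide)
qed

text \<open>Only the window \<open>\<bar>u\<bar> \<le> \<delta> / \<sigma>\<close> has quadratic
  control. Outside it convexity suffices: by the edge of the window the slope has moved away from
  \<open>p t\<close> by at least \<open>4 / 9 * \<sigma> * \<delta>\<close>, and it cannot come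
  back. The resulting linear growth is all that an exponential tail needs.\<close>

lemma bregman_bounds:
  fixes \<psi> p q r :: "real \<Rightarrow> real"
  assumes d\<psi>: "\<And>s. (\<psi> has_real_derivative p s) (at s)"
    and dp: "\<And>s. (p has_real_derivative q s) (at s)"
    and dq: "\<And>s. (q has_real_derivative r s) (at s)"
    and qpos: "\<And>s. q s > 0"
    and sc: "\<And>s. s \<ge> \<tau> \<Longrightarrow> \<bar>r s\<bar> \<le> 2 * C * (q s * sqrt (q s))"
    and t: "t - 1 \<ge> \<tau>" and \<sigma>: "\<sigma> = sqrt (q t)" "\<sigma> \<ge> 1"
    and \<delta>: "0 < \<delta>" "\<delta> \<le> 1" "C * \<delta> \<le> 1 / 2" "C \<ge> 0"
  shows "\<bar>u\<bar> \<le> \<delta> / \<sigma> \<Longrightarrow> \<psi> (t + u) - \<psi> t - p t * u \<le> 2 * \<sigma>\<^sup>2 * u\<^sup>2"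
    and "\<psi> (t + u) - \<psi> t - p t * u \<ge> 4 / 9 * \<delta> * (\<sigma> * \<bar>u\<bar> - \<delta>)"
proof -
  define w where "w = \<delta> / \<sigma>"
  have w: "w > 0" "\<sigma> * w = \<delta>" using \<sigma> \<delta> by (auto simp: w_def)
  have win: "4 / 9 * \<sigma>\<^sup>2 \<le> q (t + v)" "q (t + v) \<le> 4 * \<sigma>\<^sup>2" if "\<bar>v\<bar> \<le> w" for v
    using self_concordant_window[of q r \<tau> C t \<sigma> \<delta> v] dq qpos sc t \<sigma> \<delta> that
    by (auto simp: w_def)
  show "\<psi> (t + u) - \<psi> t - p t * u \<le> 2 * \<sigma>\<^sup>2 * u\<^sup>2" if "\<bar>u\<bar> \<le> \<delta> / \<sigma>"
  proof -
    obtain \<xi> where \<xi>: "\<bar>\<xi> - t\<bar> \<le> \<bar>u\<bar>" "\<psi> (t + u) - \<psi> t - p t * u = q \<xi> / 2 * u\<^sup>2"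
      using taylor_second_order[OF d\<psi> dp, of t "t + u"] by auto
    have "q \<xi> \<le> 4 * \<sigma>\<^sup>2" using win(2)[of "\<xi> - t"] \<xi>(1) that by (simp add: w_def)
    then have "q \<xi> / 2 * u\<^sup>2 \<le> 2 * \<sigma>\<^sup>2 * u\<^sup>2" by (intro mult_right_mono) auto
    with \<xi>(2) show ?thesis by simp
  qed
  have conv: "\<psi> b \<ge> \<psi> a + p a * (b - a)" for a b
  proof -
    obtain \<xi> where "\<psi> b - \<psi> a - p a * (b - a) = q \<xi> / 2 * (b - a)\<^sup>2"
      using taylor_second_order[OF d\<psi> dp, of a b] by auto
    moreover have "q \<xi> / 2 * (b - a)\<^sup>2 \<ge> 0" using qpos[of \<xi>] by simp
    ultimately show ?thesis by linarith
  qed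
  show "\<psi> (t + u) - \<psi> t - p t * u \<ge> 4 / 9 * \<delta> * (\<sigma> * \<bar>u\<bar> - \<delta>)"
  proof (cases "\<bar>u\<bar> \<le> w")
    case True
    \<comment> \<open>Inside the window the claimed lower bound is nonpositive, so it follows from
      the graph lying above its tangent at \<open>t\<close>.\<close>
    then have "\<sigma> * \<bar>u\<bar> \<le> \<delta>" using \<sigma> w by (metis mult_left_mono order_trans zero_le_one)
    then have "4 / 9 * \<delta> * (\<sigma> * \<bar>u\<bar> - \<delta>) \<le> 0" using \<delta> by (simp add: mult_nonneg_nonpos)
    with conv[of t "t + u"] show ?thesis by simp
  next
    case False
    define s where "s = sgn u"
    have s: "s = 1 \<or> s = -1" "u = s * \<bar>u\<bar>" using False w by (auto simp: s_def sgn_if)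
    then have ss: "s * s = 1" by auto
    have slope: "s * (p (t + s * w) - p t) \<ge> 4 / 9 * \<sigma> * \<delta>"
    proof -
      have "\<exists>\<xi>. \<bar>\<xi>\<bar> \<le> w \<and> p (t + s * w) - p t = s * w * q (t + \<xi>)"
      proof (cases "s = 1")
        case True
        obtain z where "t < z" "z < t + w" "p (t + w) - p t = (t + w - t) * q z"
          using MVT2[of t "t + w" p q] dp w by auto
        then show ?thesis using True by (intro exI[of _ "z - t"]) auto
      next
        case False
        then have s1: "s = -1" using s by auto
        obtain z where "t - w < z" "z < t" "p t - p (t - w) = (t - (t - w)) * q z"
          using MVT2[of "t - w" t p q] dp w by auto
        then show ?thesis using s1 by (intro exI[of _ "z - t"]) (auto simp: algebra_simps)
      qed
      then obtain \<xi> where \<xi>: "\<bar>\<xi>\<bar> \<le> w" "p (t + s * w) - p t = s * w * q (t + \<xi>)" by blast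
      have "s * (p (t + s * w) - p t) = w * q (t + \<xi>)" using ss by (simp add: \<xi> mult.assoc[symmetric])
      also have "\<dots> \<ge> w * (4 / 9 * \<sigma>\<^sup>2)" using w win(1)[OF \<xi>(1)] by (intro mult_left_mono) auto
      also have "w * (4 / 9 * \<sigma>\<^sup>2) = 4 / 9 * \<sigma> * (\<sigma> * w)" by (simp add: power2_eq_square)
      finally show ?thesis by (simp add: w)
    qed
    \<comment> \<open>Two supporting lines, one at the edge \<open>t + s * w\<close> and one at
      \<open>t\<close>; the difference of their slopes is what \<open>slope\<close> bounds.\<close>
    have "\<psi> (t + u) \<ge> \<psi> (t + s * w) + p (t + s * w) * (u - s * w)"
      using conv[of "t + s * w" "t + u"] by (simp add: algebra_simps)
    moreover have "\<psi> (t + s * w) \<ge> \<psi> t + p t * (s * w)" using conv[of t "t + s * w"] by simp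
    ultimately have "\<psi> (t + u) - \<psi> t - p t * u \<ge> (p (t + s * w) - p t) * (u - s * w)"
      by (simp add: algebra_simps)
    also have "(p (t + s * w) - p t) * (u - s * w) = (s * (p (t + s * w) - p t)) * (\<bar>u\<bar> - w)"
      by (subst s(2)) (simp add: algebra_simps)
    also have "\<dots> \<ge> (4 / 9 * \<sigma> * \<delta>) * (\<bar>u\<bar> - w)"
      using False slope by (intro mult_right_mono) auto
    also have "(4 / 9 * \<sigma> * \<delta>) * (\<bar>u\<bar> - w) = 4 / 9 * \<delta> * (\<sigma> * \<bar>u\<bar> - \<sigma> * w)"
      by (simp add: algebra_simps)
    finally show ?thesis by (simp add: w)
  qed
qed

section \<open>Moment integrals on the logarithmic scale\<close>

text \<open>With \<open>u = ln (y / x)\<close> the measure \<open>dy / y\<close> becomes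
  \<open>du\<close> and the integrand \<open>exp (- \<beta> * \<bar>u\<bar>)\<close>, whose integral
  is \<open>2 / \<beta>\<close>. Splitting at \<open>y = x\<close> replaces the substitution by two
  integrals of powers, \<open>f\<close> below \<open>x\<close> and \<open>g\<close> above, worth
  \<open>1 / \<beta>\<close> each.\<close>

lemma nn_integral_exp_abs_ln:
  fixes \<beta> x :: real
  assumes "\<beta> > 0" "x > 0"
  shows "(\<integral>\<^sup>+y. ennreal (exp (- \<beta> * \<bar>ln (y / x)\<bar>) / y) * indicator {0<..} y \<partial>lborel) \<le> ennreal (2 / \<beta>)"
proof -
  define f where "f y = (if y \<in> {0..x} then x powr (-\<beta>) * y powr (\<beta> - 1) else 0)" for y
  define g where "g y = (if y \<in> {x..} then x powr \<beta> * y powr (- \<beta> - 1) else 0)" for y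
  have f: "integral\<^sup>N lborel f = ennreal (1 / \<beta>)"
  proof (rule nn_integral_has_integral_lborel)
    show "f \<in> borel_measurable borel" unfolding f_def by measurable
    show "f y \<ge> 0" for y by (auto simp: f_def)
    have "((\<lambda>y. x powr (-\<beta>) * y powr (\<beta> - 1)) has_integral x powr (-\<beta>) * (x powr (\<beta> - 1 + 1) / (\<beta> - 1 + 1))) {0..x}"
      by (intro has_integral_mult_right has_integral_powr_from_0) (use assms in auto)
    also have "x powr (-\<beta>) * (x powr (\<beta> - 1 + 1) / (\<beta> - 1 + 1)) = 1 / \<beta>"
      using assms by (simp add: powr_minus)
    finally show "(f has_integral 1 / \<beta>) UNIV"
      unfolding f_def has_integral_restrict_UNIV .
  qed
  have g: "integral\<^sup>N lborel g = ennreal (1 / \<beta>)"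
  proof (rule nn_integral_has_integral_lborel)
    show "g \<in> borel_measurable borel" unfolding g_def by measurable
    show "g y \<ge> 0" for y by (auto simp: g_def)
    have "((\<lambda>y. x powr \<beta> * y powr (- \<beta> - 1)) has_integral x powr \<beta> * (- (x powr (- \<beta> - 1 + 1)) / (- \<beta> - 1 + 1))) {x..}"
      by (intro has_integral_mult_right has_integral_powr_to_inf) (use assms in auto)
    also have "x powr \<beta> * (- (x powr (- \<beta> - 1 + 1)) / (- \<beta> - 1 + 1)) = 1 / \<beta>"
      using assms by (simp add: powr_minus field_simps)
    finally show "(g has_integral 1 / \<beta>) UNIV"
      unfolding g_def has_integral_restrict_UNIV .
  qed
  have "(\<integral>\<^sup>+y. ennreal (exp (- \<beta> * \<bar>ln (y / x)\<bar>) / y) * indicator {0<..} y \<partial>lborel)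
      \<le> (\<integral>\<^sup>+y. ennreal (f y) + ennreal (g y) \<partial>lborel)"
  proof (rule nn_integral_mono)
    fix y :: real
    show "ennreal (exp (- \<beta> * \<bar>ln (y / x)\<bar>) / y) * indicator {0<..} y \<le> ennreal (f y) + ennreal (g y)"
    proof (cases "y > 0")
      case True
      have "exp (- \<beta> * \<bar>ln (y / x)\<bar>) / y \<le> f y + g y"
      proof (cases "y \<le> x")
        case le: True
        then have "exp (- \<beta> * \<bar>ln (y / x)\<bar>) / y = exp (\<beta> * (ln y - ln x)) / y"
          using True assms by (simp add: ln_div algebra_simps)
        also have "\<dots> = x powr (-\<beta>) * y powr (\<beta> - 1)"
          using True assms by (simp add: powr_def exp_diff exp_minus algebra_simps divide_simps flip: exp_add)
        also have "\<dots> = f y" using True le by (simp add: f_def)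
        also have "\<dots> \<le> f y + g y" by (auto simp: g_def)
        finally show ?thesis .
      next
        case False
        then have "exp (- \<beta> * \<bar>ln (y / x)\<bar>) / y = exp (- \<beta> * (ln y - ln x)) / y"
          using True assms by (simp add: ln_div)
        also have "\<dots> = x powr \<beta> * y powr (- \<beta> - 1)"
          using True assms by (simp add: powr_def exp_diff exp_minus algebra_simps divide_simps flip: exp_add)
        also have "\<dots> = g y" using True False by (simp add: g_def)
        also have "\<dots> \<le> f y + g y" by (auto simp: f_def)
        finally show ?thesis .
      qed
      then show ?thesis
        using True by (simp add: f_def g_def ennreal_plus[symmetric] del: ennreal_plus)
    qed auto
  qed
  also have "\<dots> = integral\<^sup>N lborel f + integral\<^sup>N lborel g"
    by (rule nn_integral_add) (auto simp: f_def g_def)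
  also have "\<dots> = ennreal (2 / \<beta>)"
    using assms by (simp add: f g flip: ennreal_plus)
  finally show ?thesis .
qed

lemma one_minus_exp_ge:
  assumes "0 \<le> v" "v \<le> (1::real)"
  shows "1 - exp (- v) \<ge> v / 2"
proof -
  have "exp (-v) = 1 / exp v" by (simp add: exp_minus field_simps)
  also have "\<dots> \<le> 1 / (1 + v)" using assms by (intro divide_left_mono) (auto intro: exp_ge_add_one_self)
  finally have "1 - exp (-v) \<ge> v / (1 + v)" using assms by (simp add: field_simps)
  moreover have "v / (1 + v) \<ge> v / 2" using assms by (intro divide_left_mono) auto
  ultimately show ?thesis by linarith
qed

text \<open>The lower half of Laplace's method without a substitution: on the image of
  \<open>{a..b}\<close> the density \<open>K / y\<close> is at least its value at the right end, and
  the length of the image relative to that end, \<open>1 - exp (- (b - a))\<close>, is at least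
  \<open>(b - a) / 2\<close> because \<open>b - a \<le> 1\<close>.\<close>

lemma nn_integral_log_scale_lower:
  fixes x a b K :: real
  assumes "x > 0" "a \<le> b" "b - a \<le> 1" "K \<ge> 0"
    and f: "\<And>u. a \<le> u \<Longrightarrow> u \<le> b \<Longrightarrow> f (x * exp u) \<ge> ennreal (K / (x * exp u))"
  shows "(\<integral>\<^sup>+y. f y \<partial>lborel) \<ge> ennreal (K * (b - a) / 2)"
proof -
  define l r where "l = x * exp a" and "r = x * exp b"
  have lr: "0 < l" "l \<le> r" using assms by (auto simp: l_def r_def)
  have "ennreal (K * (b - a) / 2) \<le> ennreal (K / r) * emeasure lborel {l..r}"
  proof -
    have "K * (b - a) / 2 \<le> K * (1 - exp (- (b - a)))"
      using mult_left_mono[OF one_minus_exp_ge[of "b - a"] \<open>K \<ge> 0\<close>] assms by simp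
    also have "1 - exp (- (b - a)) = (r - l) / r"
      using assms by (simp add: l_def r_def exp_minus exp_diff field_simps)
    finally show ?thesis
      using lr assms by (simp add: emeasure_lborel_Icc ennreal_mult'[symmetric] ennreal_leI)
  qed
  also have "\<dots> = (\<integral>\<^sup>+y. ennreal (K / r) * indicator {l..r} y \<partial>lborel)"
    by (simp add: nn_integral_cmult_indicator)
  also have "\<dots> \<le> (\<integral>\<^sup>+y. f y \<partial>lborel)"
  proof (rule nn_integral_mono)
    fix y
    show "ennreal (K / r) * indicator {l..r} y \<le> f y"
    proof (cases "y \<in> {l..r}")
      case True
      define u where "u = ln (y / x)"
      have y: "y = x * exp u" "y > 0" using True lr assms by (auto simp: u_def)
      have "a \<le> u" "u \<le> b" using True assms by (auto simp: y l_def r_def)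
      then have "ennreal (K / y) \<le> f y" using f[of u] by (simp add: y)
      moreover have "K / r \<le> K / y" using True lr assms by (intro divide_left_mono) auto
      ultimately show ?thesis using True by (auto intro: order_trans[OF ennreal_leI])
    qed auto
  qed
  finally show ?thesis .
qed

definition halfline_moment :: "(real \<Rightarrow> real) \<Rightarrow> nat \<Rightarrow> ennreal" where
  "halfline_moment \<Psi> m = (\<integral>\<^sup>+y. ennreal (y ^ m * exp (- \<Psi> y)) * indicator {0..} y \<partial>lborel)"

text \<open>Writing \<open>y ^ m\<close> as \<open>y ^ Suc m / y\<close> turns \<open>dy\<close>
  into \<open>du\<close> on the scale \<open>y = x * exp u\<close>. This is why
  \<open>Suc m\<close>, not \<open>m\<close>, is compared with the slope of the weight in the moment
  bounds.\<close>

lemma moment_integrand_log_scale: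
  fixes x u :: real
  assumes "x > 0"
  shows "(x * exp u) ^ m * exp (- \<Psi> (x * exp u)) =
    x ^ Suc m * exp (- \<Psi> x) * (exp (real (Suc m) * u - (\<Psi> (x * exp u) - \<Psi> x)) / (x * exp u))"
proof -
  have "(x * exp u) ^ m = (x * exp u) ^ Suc m / (x * exp u)" using assms by simp
  also have "(x * exp u) ^ Suc m = x ^ Suc m * exp (real (Suc m) * u)"
    by (simp only: power_mult_distrib exp_of_nat_mult)
  also have "\<dots> / (x * exp u) * exp (- \<Psi> (x * exp u)) = x ^ Suc m *
      (exp (real (Suc m) * u) * exp (- \<Psi> (x * exp u))) / (x * exp u)" by simp
  also have "exp (real (Suc m) * u) * exp (- \<Psi> (x * exp u)) =
      exp (- \<Psi> x) * exp (real (Suc m) * u - (\<Psi> (x * exp u) - \<Psi> x))"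
    by (simp flip: exp_add)
  finally show ?thesis by simp
qed

text \<open>The exponent is \<open>(Suc m - \<Lambda>) * u\<close> minus the deviation of the weight
  from its tangent. For the lower bound the integral is restricted to the outer half of the window,
  on the side where the linear term is positive; this gains a factor exponential in
  \<open>\<bar>Suc m - \<Lambda>\<bar> / \<sigma>\<close> and works for all \<open>m\<close>. For
  the upper bound the linear term must not beat the growth of the weight, hence the restriction on
  \<open>m\<close>.\<close>

lemma halfline_moment_bounds:
  fixes \<Psi> :: "real \<Rightarrow> real"
  assumes x: "x > 0" and \<sigma>: "\<sigma> \<ge> 1" and \<delta>: "0 < \<delta>" "\<delta> \<le> 1" and c: "c > 0"
    and upper: "\<And>u. \<bar>u\<bar> \<le> \<delta> / \<sigma> \<Longrightarrow> \<Psi> (x * exp u) - \<Psi> x - \<Lambda> * u \<le> 2 * \<sigma>\<^sup>2 * u\<^sup>2"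
    and lower: "\<And>u. \<Psi> (x * exp u) - \<Psi> x - \<Lambda> * u \<ge> c * (\<sigma> * \<bar>u\<bar> - \<delta>)"
  shows "halfline_moment \<Psi> m \<ge> ennreal (x ^ Suc m * exp (- \<Psi> x) *
           (\<delta> / (4 * \<sigma>) * exp (\<bar>real (Suc m) - \<Lambda>\<bar> * \<delta> / (2 * \<sigma>) - 2)))"
    and "\<bar>real (Suc m) - \<Lambda>\<bar> \<le> c / 2 * \<sigma> \<Longrightarrow> halfline_moment \<Psi> m \<le> ennreal (x ^ Suc m * exp (- \<Psi> x) *
           (exp c * 4 / (c * \<sigma>)))"
proof -
  define M where "M = x ^ Suc m * exp (- \<Psi> x)"
  have M: "M > 0" using x by (simp add: M_def)
  define \<kappa> where "\<kappa> = real (Suc m)"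
  define w where "w = \<delta> / (2 * \<sigma>)"
  have w: "0 < w" "w \<le> 1" "2 * w = \<delta> / \<sigma>" using \<sigma> \<delta> by (auto simp: w_def field_simps)
  have \<sigma>w: "\<sigma> * (2 * w) = \<delta>" using \<sigma> by (simp add: w)
  note scale = moment_integrand_log_scale[OF x, where m = m and \<Psi> = \<Psi>, folded M_def \<kappa>_def]
  define K where "K = M * exp (\<bar>\<kappa> - \<Lambda>\<bar> * w - 2)"
  have key: "ennreal ((x * exp u) ^ m * exp (- \<Psi> (x * exp u))) * indicator {0..} (x * exp u) \<ge> ennreal (K / (x * exp u))"
    if "\<bar>u\<bar> \<le> 2 * w" "(\<kappa> - \<Lambda>) * u \<ge> \<bar>\<kappa> - \<Lambda>\<bar> * w" for u
  proof -
    \<comment> \<open>In the window the quadratic deviation costs at most 2, the constant subtracted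
      in \<open>K\<close>.\<close>
    have "\<sigma> * \<bar>u\<bar> \<le> \<delta>" using mult_left_mono[OF that(1), of \<sigma>] \<sigma> \<sigma>w by simp
    then have "(\<sigma> * \<bar>u\<bar>)\<^sup>2 \<le> 1" using \<delta> \<sigma> by (intro power_le_one) auto
    then have "2 * \<sigma>\<^sup>2 * u\<^sup>2 \<le> 2" by (simp add: power_mult_distrib)
    then have "\<kappa> * u - (\<Psi> (x * exp u) - \<Psi> x) \<ge> \<bar>\<kappa> - \<Lambda>\<bar> * w - 2"
      using upper[of u] that w by (simp add: algebra_simps)
    then have "K / (x * exp u) \<le> M * (exp (\<kappa> * u - (\<Psi> (x * exp u) - \<Psi> x)) / (x * exp u))"
      using x M by (simp add: K_def divide_right_mono)
    then show ?thesis using x by (subst scale) (auto intro!: ennreal_leI)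
  qed
  have "halfline_moment \<Psi> m \<ge> ennreal (K * w / 2)"
  proof (cases "\<kappa> \<ge> \<Lambda>")
    case True
    have "ennreal (K * (2 * w - w) / 2) \<le> halfline_moment \<Psi> m"
      unfolding halfline_moment_def
    proof (rule nn_integral_log_scale_lower[OF x])
      fix u assume "w \<le> u" "u \<le> 2 * w"
      then show "ennreal (K / (x * exp u)) \<le> ennreal ((x * exp u) ^ m * exp (- \<Psi> (x * exp u))) * indicator {0..} (x * exp u)"
        using True w by (intro key) (auto intro!: mult_left_mono)
    qed (use w M in \<open>auto simp: K_def\<close>)
    then show ?thesis by simp
  next
    case False
    have "ennreal (K * (- w - (- 2 * w)) / 2) \<le> halfline_moment \<Psi> m"
      unfolding halfline_moment_def
    proof (rule nn_integral_log_scale_lower[OF x])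
      fix u assume u: "- 2 * w \<le> u" "u \<le> - w"
      have "\<bar>\<kappa> - \<Lambda>\<bar> * w \<le> \<bar>\<kappa> - \<Lambda>\<bar> * (- u)" using u by (intro mult_left_mono) auto
      also have "\<dots> = (\<kappa> - \<Lambda>) * u" using False by (simp add: algebra_simps)
      finally show "ennreal (K / (x * exp u)) \<le> ennreal ((x * exp u) ^ m * exp (- \<Psi> (x * exp u))) * indicator {0..} (x * exp u)"
        using u w by (intro key) auto
    qed (use w M in \<open>auto simp: K_def\<close>)
    then show ?thesis by simp
  qed
  moreover have "K * w / 2 = M * (\<delta> / (4 * \<sigma>) * exp (\<bar>\<kappa> - \<Lambda>\<bar> * \<delta> / (2 * \<sigma>) - 2))"
    by (simp add: K_def w_def)
  ultimately show "halfline_moment \<Psi> m \<ge> ennreal (x ^ Suc m * exp (- \<Psi> x) *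
           (\<delta> / (4 * \<sigma>) * exp (\<bar>real (Suc m) - \<Lambda>\<bar> * \<delta> / (2 * \<sigma>) - 2)))"
    unfolding M_def \<kappa>_def by simp
  assume "\<bar>real (Suc m) - \<Lambda>\<bar> \<le> c / 2 * \<sigma>"
  then have near: "\<bar>\<kappa> - \<Lambda>\<bar> \<le> c / 2 * \<sigma>" by (simp add: \<kappa>_def)
  \<comment> \<open>The weight grows with slope \<open>c * \<sigma>\<close>: half of it pays for the
    linear term with coefficient \<open>\<kappa> - \<Lambda>\<close>, the other half
    \<open>\<beta>\<close> remains as decay.\<close>
  define \<beta> where "\<beta> = c / 2 * \<sigma>"
  have \<beta>: "\<beta> > 0" using c \<sigma> by (simp add: \<beta>_def)
  have "halfline_moment \<Psi> m \<le>
     (\<integral>\<^sup>+y. ennreal (M * exp c) * (ennreal (exp (- \<beta> * \<bar>ln (y / x)\<bar>) / y) * indicator {0<..} y) \<partial>lborel)"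
    unfolding halfline_moment_def
  proof (rule nn_integral_mono_AE)
    \<comment> \<open>The moment includes the point 0, the logarithmic integral does not.\<close>
    have "AE y in lborel. y \<noteq> (0::real)" by (rule AE_lborel_singleton)
    then show "AE y in lborel. ennreal (y ^ m * exp (- \<Psi> y)) * indicator {0..} y
       \<le> ennreal (M * exp c) * (ennreal (exp (- \<beta> * \<bar>ln (y / x)\<bar>) / y) * indicator {0<..} y)"
    proof eventually_elim
      case (elim y)
      show ?case
      proof (cases "y > 0")
        case True
        define u where "u = ln (y / x)"
        have y: "y = x * exp u" "y > 0" using True x by (auto simp: u_def)
        have "(\<kappa> - \<Lambda>) * u \<le> \<beta> * \<bar>u\<bar>"
          using mult_right_mono[OF near, of "\<bar>u\<bar>"] by (metis \<beta>_def abs_ge_self abs_ge_zero abs_mult order_trans)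
        moreover have "c * (\<sigma> * \<bar>u\<bar> - \<delta>) \<ge> 2 * \<beta> * \<bar>u\<bar> - c"
          using c \<delta> by (simp add: \<beta>_def algebra_simps)
        ultimately have "\<kappa> * u - (\<Psi> (x * exp u) - \<Psi> x) \<le> c - \<beta> * \<bar>u\<bar>"
          using lower[of u] by (simp add: algebra_simps)
        then have "exp (\<kappa> * u - (\<Psi> (x * exp u) - \<Psi> x)) \<le> exp c * exp (- \<beta> * \<bar>u\<bar>)"
          by (simp flip: exp_add)
        then have "M * (exp (\<kappa> * u - (\<Psi> (x * exp u) - \<Psi> x)) / (x * exp u))
          \<le> M * (exp c * exp (- \<beta> * \<bar>u\<bar>) / (x * exp u))"
          using M x by (intro mult_left_mono divide_right_mono) auto
        then have "y ^ m * exp (- \<Psi> y) \<le> M * exp c * (exp (- \<beta> * \<bar>u\<bar>) / y)"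
          unfolding y(1) scale by simp
        then show ?thesis
          using True M by (simp add: u_def ennreal_leI flip: ennreal_mult')
      qed (use elim in auto)
    qed
  qed
  also have "\<dots> = ennreal (M * exp c) * (\<integral>\<^sup>+y. ennreal (exp (- \<beta> * \<bar>ln (y / x)\<bar>) / y) * indicator {0<..} y \<partial>lborel)"
    by (rule nn_integral_cmult) measurable
  also have "\<dots> \<le> ennreal (M * exp c) * ennreal (2 / \<beta>)"
    by (intro mult_left_mono nn_integral_exp_abs_ln \<beta> x) auto
  also have "\<dots> = ennreal (M * (exp c * 4 / (c * \<sigma>)))"
    using M \<beta> by (simp add: \<beta>_def field_simps flip: ennreal_mult)
  finally show "halfline_moment \<Psi> m \<le> ennreal (x ^ Suc m * exp (- \<Psi> x) * (exp c * 4 / (c * \<sigma>)))"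
    by (simp add: M_def)
qed

section \<open>Weights on the naturals that concentrate around a point\<close>

lemma sums_geometric_abs_diff:
  fixes r :: real and m :: nat
  assumes "0 < r" "r < 1" and f: "\<And>n. 0 \<le> f n" "\<And>n. f n \<le> r powr \<bar>real n - real m\<bar>"
  shows "summable f" "suminf f \<le> 2 / (1 - r)"
proof -
  define g where "g n = (if n < m then 0 else r ^ (n - m))" for n
  define h where "h n = (if n \<in> {..m} then r ^ (m - n) else 0)" for n
  have "(\<lambda>n. g (n + m)) sums (1 / (1 - r))"
    using geometric_sums[of r] assms by (simp add: g_def)
  then have g: "g sums (1 / (1 - r))"
    by (subst (asm) sums_iff_shift) (simp add: g_def)
  have h: "h sums (\<Sum>n\<le>m. r ^ (m - n))"
    unfolding h_def by (rule sums_If_finite_set) simp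
  have "(\<Sum>n\<le>m. r ^ (m - n)) = (\<Sum>n\<le>m. r ^ n)"
    by (rule sum.reindex_bij_witness[of _ "\<lambda>n. m - n" "\<lambda>n. m - n"]) auto
  also have "\<dots> \<le> (\<Sum>n. r ^ n)"
    using assms by (intro sum_le_suminf) (auto simp: summable_geometric)
  also have "\<dots> = 1 / (1 - r)" using assms by (simp add: suminf_geometric)
  finally have h2: "suminf h \<le> 1 / (1 - r)" using h by (simp add: sums_iff)
  have fb: "f n \<le> g n + h n" for n
  proof -
    have "f n \<le> r powr \<bar>real n - real m\<bar>" by (rule f)
    also have "\<dots> \<le> g n + h n"
      using assms by (auto simp: g_def h_def abs_if powr_realpow of_nat_diff[symmetric] not_less
          simp del: of_nat_diff)
    finally show ?thesis .
  qed
  have gh: "summable (\<lambda>n. g n + h n)" using g h by (intro summable_add) (auto simp: sums_iff)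
  show "summable f" by (rule summable_comparison_test'[OF gh, of 0]) (use f fb in auto)
  then have "suminf f \<le> (\<Sum>n. g n + h n)" using gh fb by (intro suminf_le) auto
  also have "\<dots> = suminf g + suminf h" using g h by (intro suminf_add[symmetric]) (auto simp: sums_iff)
  also have "\<dots> \<le> 2 / (1 - r)" using g h2 by (simp add: sums_iff)
  finally show "suminf f \<le> 2 / (1 - r)" .
qed

lemma suminf_exp_decay:
  fixes c \<sigma> a :: real
  assumes c: "c > 0" "\<sigma> \<ge> 1" "c \<le> 1" and "a \<ge> 0"
  shows "summable (\<lambda>n. exp (- c * \<bar>real n - a\<bar> / \<sigma>))"
    and "(\<Sum>n. exp (- c * \<bar>real n - a\<bar> / \<sigma>)) \<le> 12 * \<sigma> / c"
proof -
  define r where "r = exp (- (c / \<sigma>))"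
  define m where "m = nat \<lfloor>a\<rfloor>"
  have cs: "0 < c / \<sigma>" "c / \<sigma> \<le> 1" using c by (auto simp: divide_le_eq)
  have r: "0 < r" "r < 1" using cs by (auto simp: r_def)
  have m: "\<bar>a - real m\<bar> \<le> 1" using \<open>a \<ge> 0\<close> unfolding m_def by linarith
  \<comment> \<open>The first factor pays for replacing the centre \<open>a\<close> by the integer
    \<open>m\<close> at distance at most 1; it is undone below at the cost of
    \<open>exp (c / \<sigma>) \<le> 3\<close>.\<close>
  define f where "f n = exp (- (c / \<sigma>)) * exp (- c * \<bar>real n - a\<bar> / \<sigma>)" for n
  have fb: "f n \<le> r powr \<bar>real n - real m\<bar>" for n
  proof -
    have "(c / \<sigma>) * \<bar>real n - real m\<bar> \<le> (c / \<sigma>) * (1 + \<bar>real n - a\<bar>)"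
      using cs m by (intro mult_left_mono) auto
    then show ?thesis
      unfolding f_def r_def powr_def using cs by (simp add: algebra_simps flip: exp_add)
  qed
  note * = sums_geometric_abs_diff[OF r, of f m]
  have f0: "f n \<ge> 0" for n by (simp add: f_def)
  have s: "summable f" "suminf f \<le> 2 / (1 - r)" using *[OF f0 fb] by auto
  have eq: "(\<lambda>n. exp (- c * \<bar>real n - a\<bar> / \<sigma>)) = (\<lambda>n. exp (c / \<sigma>) * f n)"
    by (simp add: f_def fun_eq_iff exp_minus field_simps)
  show "summable (\<lambda>n. exp (- c * \<bar>real n - a\<bar> / \<sigma>))" unfolding eq using s by (intro summable_mult)
  have "(\<Sum>n. exp (- c * \<bar>real n - a\<bar> / \<sigma>)) = exp (c / \<sigma>) * suminf f"
    unfolding eq using s by (intro suminf_mult)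
  also have "\<dots> \<le> 3 * (2 / (c / \<sigma> / 2))"
  proof (intro mult_mono)
    show "exp (c / \<sigma>) \<le> 3" using cs exp_le order_trans[of "exp (c / \<sigma>)" "exp 1" 3] by simp
    have "1 - r \<ge> c / \<sigma> / 2" unfolding r_def using one_minus_exp_ge[of "c / \<sigma>"] cs by simp
    then have "2 / (1 - r) \<le> 2 / (c / \<sigma> / 2)"
      using cs r by (intro divide_left_mono mult_pos_pos) auto
    then show "suminf f \<le> 2 / (c / \<sigma> / 2)" using s by simp
  qed (use suminf_nonneg[OF s(1)] f0 in auto)
  finally show "(\<Sum>n. exp (- c * \<bar>real n - a\<bar> / \<sigma>)) \<le> 12 * \<sigma> / c" using c by simp
qed

lemma card_nat_interval_ge:
  fixes l h :: real
  assumes "l \<ge> 0"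
  shows "finite {n::nat. l \<le> real n \<and> real n \<le> l + h}"
    and "real (card {n::nat. l \<le> real n \<and> real n \<le> l + h}) \<ge> h - 1"
proof -
  have sub: "{n::nat. l \<le> real n \<and> real n \<le> l + h} = {nat \<lceil>l\<rceil>..<nat (\<lfloor>l + h\<rfloor> + 1)}"
    using assms by (auto simp: le_nat_iff nat_le_iff) linarith+
  show "finite {n::nat. l \<le> real n \<and> real n \<le> l + h}" unfolding sub by simp
  show "real (card {n::nat. l \<le> real n \<and> real n \<le> l + h}) \<ge> h - 1"
    unfolding sub using assms by simp linarith
qed

text \<open>The variance is the minimum over all centres of the second moment. Bounding the latter
  from above at one centre and from below at all of them states that the variance divided by
  \<open>v\<close> lies between \<open>K2\<close> and \<open>K1\<close>, without a formula for the
  mean. The summability premise excludes the arbitrary value of a divergent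
  \<open>suminf\<close>.\<close>

definition variance_comparable :: "real \<Rightarrow> real \<Rightarrow> real \<Rightarrow> (nat \<Rightarrow> real) \<Rightarrow> bool" where
  "variance_comparable K1 K2 v P \<longleftrightarrow>
    (\<exists>a. (\<Sum>n. (real n - a)\<^sup>2 * P n) \<le> K1 * v * suminf P) \<and>
    (\<forall>\<mu>. summable (\<lambda>n. (real n - \<mu>)\<^sup>2 * P n) \<longrightarrow> K2 * v * suminf P \<le> (\<Sum>n. (real n - \<mu>)\<^sup>2 * P n))"

text \<open>The constants depend on the profile \<open>C\<close>, \<open>c\<close>,
  \<open>k\<close>, \<open>\<epsilon>\<close> only, not on the height \<open>A\<close>, the width
  \<open>\<sigma>\<close> or the centre \<open>a\<close>. The exponential tail bounds the second
  moment about \<open>a\<close>. Conversely, any \<open>\<mu>\<close> has distance at least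
  \<open>\<epsilon> * \<sigma> / 2\<close> from a window of that length on the other side of
  \<open>a\<close>, where \<open>P\<close> is large.\<close>

lemma concentrated_weights_variance:
  fixes C c k \<epsilon> :: real
  assumes pos: "C > 0" "0 < c" "c \<le> 1" "k > 0" "\<epsilon> > 0"
  shows "\<exists>K1>0. \<exists>K2>0. \<forall>(P::nat \<Rightarrow> real) A \<sigma> a. \<sigma> \<ge> 1 \<longrightarrow> A > 0 \<longrightarrow> a \<ge> \<epsilon> * \<sigma> \<longrightarrow> \<epsilon> * \<sigma> \<ge> 8 \<longrightarrow>
    (\<forall>n. 0 \<le> P n \<and> P n \<le> A * C * exp (- c * \<bar>real n - a\<bar> / \<sigma>)) \<longrightarrow>
    (\<forall>n. \<bar>real n - a\<bar> \<le> \<epsilon> * \<sigma> \<longrightarrow> P n \<ge> A * k) \<longrightarrow>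
    variance_comparable K1 K2 (\<sigma>\<^sup>2) P"
proof -
  \<comment> \<open>Each constant is a bound for a second moment divided by a bound for the total
    mass; 24 is the 12 of \<open>suminf_exp_decay\<close> with the rate halved.\<close>
  define K1 where "K1 = (C * (8 / c\<^sup>2) * (24 / c)) / (k * (\<epsilon> / 4))"
  define K2 where "K2 = (k * (\<epsilon> / 2)\<^sup>2 * (\<epsilon> / 4)) / (C * (12 / c))"
  have K: "K1 > 0" "K2 > 0" using pos by (auto simp: K1_def K2_def)
  show ?thesis
  proof (rule exI[of _ K1], rule conjI[OF K(1)], rule exI[of _ K2], rule conjI[OF K(2)],
      unfold variance_comparable_def, intro allI impI conjI)
    fix P :: "nat \<Rightarrow> real" and A \<sigma> a
    assume \<sigma>: "\<sigma> \<ge> 1" and A: "A > 0" and a: "a \<ge> \<epsilon> * \<sigma>" and big: "\<epsilon> * \<sigma> \<ge> 8"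
      and "\<forall>n. 0 \<le> P n \<and> P n \<le> A * C * exp (- c * \<bar>real n - a\<bar> / \<sigma>)"
      and "\<forall>n. \<bar>real n - a\<bar> \<le> \<epsilon> * \<sigma> \<longrightarrow> P n \<ge> A * k"
    then have P0: "\<And>n. 0 \<le> P n" and Pub: "\<And>n. P n \<le> A * C * exp (- c * \<bar>real n - a\<bar> / \<sigma>)"
      and Plb: "\<And>n. \<bar>real n - a\<bar> \<le> \<epsilon> * \<sigma> \<Longrightarrow> P n \<ge> A * k" by auto
    have a0: "a \<ge> 0" using a big by linarith
    note ed = suminf_exp_decay[OF pos(2) \<sigma> pos(3) a0]
    have sP: "summable P"
      by (rule summable_comparison_test'[of "\<lambda>n. A * C * exp (- c * \<bar>real n - a\<bar> / \<sigma>)" 0])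
         (use ed P0 Pub in \<open>auto intro: summable_mult\<close>)
    have "suminf P \<le> (\<Sum>n. A * C * exp (- c * \<bar>real n - a\<bar> / \<sigma>))"
      using sP ed Pub by (intro suminf_le summable_mult) auto
    also have "\<dots> = A * C * (\<Sum>n. exp (- c * \<bar>real n - a\<bar> / \<sigma>))"
      by (rule suminf_mult[OF ed(1)])
    also have "\<dots> \<le> A * C * (12 * \<sigma> / c)" using ed A pos by (intro mult_left_mono) auto
    finally have Pup: "suminf P \<le> A * C * (12 * \<sigma> / c)" .
    \<comment> \<open>As \<open>\<epsilon> * \<sigma> \<ge> 8\<close>, such a window contains at
      least \<open>\<epsilon> * \<sigma> / 2 - 1 \<ge> \<epsilon> * \<sigma> / 4\<close> integers,
      and \<open>a \<ge> \<epsilon> * \<sigma>\<close> prevents it from reaching below 0.\<close>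
    have window: "suminf (\<lambda>n. w n * P n) \<ge> v * (A * k) * (\<epsilon> * \<sigma> / 4)"
      if l: "l = a + \<epsilon> * \<sigma> / 2 \<or> l = a - \<epsilon> * \<sigma>" and w: "\<And>n. w n \<ge> 0" "v \<ge> 0"
        "\<And>n. l \<le> real n \<Longrightarrow> real n \<le> l + \<epsilon> * \<sigma> / 2 \<Longrightarrow> w n \<ge> v" and sw: "summable (\<lambda>n. w n * P n)"
      for l v and w :: "nat \<Rightarrow> real"
    proof -
      define W where "W = {n::nat. l \<le> real n \<and> real n \<le> l + \<epsilon> * \<sigma> / 2}"
      have l0: "l \<ge> 0" using l a big by auto
      have W: "finite W" "real (card W) \<ge> \<epsilon> * \<sigma> / 2 - 1"
        using card_nat_interval_ge[OF l0, of "\<epsilon> * \<sigma> / 2"] by (auto simp: W_def)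
      have "v * (A * k) * (\<epsilon> * \<sigma> / 4) \<le> v * (A * k) * real (card W)"
        using W big w A pos by (intro mult_left_mono) auto
      also have "\<dots> = (\<Sum>n\<in>W. v * (A * k))" by simp
      also have "\<dots> \<le> (\<Sum>n\<in>W. w n * P n)"
      proof (rule sum_mono)
        fix n assume n: "n \<in> W"
        have "P n \<ge> A * k" by (rule Plb) (use n l in \<open>auto simp: W_def abs_le_iff field_simps\<close>)
        then show "v * (A * k) \<le> w n * P n" using n w A pos by (intro mult_mono) (auto simp: W_def)
      qed
      also have "\<dots> \<le> suminf (\<lambda>n. w n * P n)"
        using sw W w P0 by (intro sum_le_suminf) auto
      finally show ?thesis .
    qed
    have Plow: "suminf P \<ge> (A * k) * (\<epsilon> * \<sigma> / 4)"
      using window[of "a + \<epsilon> * \<sigma> / 2" "\<lambda>_. 1" 1] sP by simp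
    have c2: "0 < c / 2" "c / 2 \<le> 1" using pos by auto
    note ed2 = suminf_exp_decay[OF c2(1) \<sigma> c2(2) a0]
    \<comment> \<open>Half of the decay rate absorbs the square, through
      \<open>y\<^sup>2 / 2 \<le> exp y\<close>.\<close>
    have sq: "(real n - a)\<^sup>2 * P n \<le> A * C * (8 / c\<^sup>2) * \<sigma>\<^sup>2 * exp (- (c / 2) * \<bar>real n - a\<bar> / \<sigma>)" for n
    proof -
      define y where "y = c / 2 * \<bar>real n - a\<bar> / \<sigma>"
      have y0: "y \<ge> 0" using pos \<sigma> by (simp add: y_def)
      have "y\<^sup>2 / 2 \<le> exp y" using exp_lower_Taylor_quadratic[OF y0] y0 by linarith
      then have "y\<^sup>2 * exp (- (2 * y)) \<le> 2 * exp y * exp (- (2 * y))" by (intro mult_right_mono) auto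
      then have yy: "y\<^sup>2 * exp (- (2 * y)) \<le> 2 * exp (- y)" by (simp add: mult.assoc flip: exp_add)
      have d: "\<bar>real n - a\<bar> = 2 * \<sigma> / c * y" using pos \<sigma> by (simp add: y_def)
      have "(real n - a)\<^sup>2 = (2 * \<sigma> / c * y)\<^sup>2" using d by (metis power2_abs)
      then have sqe: "(real n - a)\<^sup>2 = 4 * \<sigma>\<^sup>2 / c\<^sup>2 * y\<^sup>2" by (simp add: power_mult_distrib power_divide)
      have "(real n - a)\<^sup>2 * P n \<le> (real n - a)\<^sup>2 * (A * C * exp (- c * \<bar>real n - a\<bar> / \<sigma>))"
        by (intro mult_left_mono Pub) auto
      also have "- c * \<bar>real n - a\<bar> / \<sigma> = - (2 * y)" by (simp add: y_def)
      also have "(real n - a)\<^sup>2 * (A * C * exp (- (2 * y))) = A * C * (4 * \<sigma>\<^sup>2 / c\<^sup>2) * (y\<^sup>2 * exp (- (2 * y)))"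
        by (simp add: sqe)
      also have "\<dots> \<le> A * C * (4 * \<sigma>\<^sup>2 / c\<^sup>2) * (2 * exp (- y))"
        using A pos yy by (intro mult_left_mono) auto
      also have "- y = - (c / 2) * \<bar>real n - a\<bar> / \<sigma>" by (simp add: y_def)
      finally show ?thesis by (simp add: mult_ac)
    qed
    have s2: "summable (\<lambda>n. (real n - a)\<^sup>2 * P n)"
      by (rule summable_comparison_test'[OF summable_mult[OF ed2(1)], of 0 _ "A * C * (8 / c\<^sup>2) * \<sigma>\<^sup>2"])
         (use P0 sq in auto)
    have "(\<Sum>n. (real n - a)\<^sup>2 * P n) \<le> (\<Sum>n. A * C * (8 / c\<^sup>2) * \<sigma>\<^sup>2 * exp (- (c / 2) * \<bar>real n - a\<bar> / \<sigma>))"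
      using s2 ed2(1) sq by (intro suminf_le summable_mult) auto
    also have "\<dots> = A * C * (8 / c\<^sup>2) * \<sigma>\<^sup>2 * (\<Sum>n. exp (- (c / 2) * \<bar>real n - a\<bar> / \<sigma>))"
      by (rule suminf_mult[OF ed2(1)])
    also have "\<dots> \<le> A * C * (8 / c\<^sup>2) * \<sigma>\<^sup>2 * (12 * \<sigma> / (c / 2))"
      using ed2 A pos by (intro mult_left_mono) auto
    also have "\<dots> = K1 * \<sigma>\<^sup>2 * ((A * k) * (\<epsilon> * \<sigma> / 4))"
      using pos by (simp add: K1_def field_simps)
    also have "\<dots> \<le> K1 * \<sigma>\<^sup>2 * suminf P" using Plow K by (intro mult_left_mono) auto
    finally show "\<exists>a. (\<Sum>n. (real n - a)\<^sup>2 * P n) \<le> K1 * \<sigma>\<^sup>2 * suminf P" by blast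
    fix \<mu> assume s\<mu>: "summable (\<lambda>n. (real n - \<mu>)\<^sup>2 * P n)"
    have "K2 * \<sigma>\<^sup>2 * suminf P \<le> K2 * \<sigma>\<^sup>2 * (A * C * (12 * \<sigma> / c))"
      using Pup K by (intro mult_left_mono) auto
    also have "\<dots> = (\<epsilon> * \<sigma> / 2)\<^sup>2 * (A * k) * (\<epsilon> * \<sigma> / 4)"
      using pos by (simp add: K2_def field_simps power2_eq_square)
    also have "\<dots> \<le> (\<Sum>n. (real n - \<mu>)\<^sup>2 * P n)"
    proof (cases "\<mu> \<le> a")
      case True
      show ?thesis
      proof (rule window[of "a + \<epsilon> * \<sigma> / 2"])
        show "(\<epsilon> * \<sigma> / 2)\<^sup>2 \<le> (real n - \<mu>)\<^sup>2" if "a + \<epsilon> * \<sigma> / 2 \<le> real n" for n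
          using that True big by (intro power_mono) linarith+
      qed (use s\<mu> in auto)
    next
      case False
      show ?thesis
      proof (rule window[of "a - \<epsilon> * \<sigma>"])
        show "(\<epsilon> * \<sigma> / 2)\<^sup>2 \<le> (real n - \<mu>)\<^sup>2" if "real n \<le> a - \<epsilon> * \<sigma> + \<epsilon> * \<sigma> / 2" for n
        proof -
          have "(\<epsilon> * \<sigma> / 2)\<^sup>2 \<le> (\<mu> - real n)\<^sup>2"
            using that False big by (intro power_mono) linarith+
          then show ?thesis by (simp add: power2_commute)
        qed
      qed (use s\<mu> in auto)
    qed
    finally show "K2 * \<sigma>\<^sup>2 * suminf P \<le> (\<Sum>n. (real n - \<mu>)\<^sup>2 * P n)" .
  qed
qed

lemma fact_ratio_bounds:
  "(real n + 1) ^ e \<le> fact (n + e) / fact n" "fact (n + e) / fact n \<le> (real n + real e + 1) ^ e"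
proof -
  show "(real n + 1) ^ e \<le> fact (n + e) / fact n"
  proof (induction e)
    case (Suc e)
    have "(real n + 1) ^ Suc e \<le> (real n + real e + 1) * (fact (n + e) / fact n)"
      unfolding power_Suc by (intro mult_mono Suc) auto
    also have "\<dots> = fact (n + Suc e) / fact n" by (simp add: algebra_simps)
    finally show ?case .
  qed simp
  show "fact (n + e) / fact n \<le> (real n + real e + 1) ^ e"
  proof (induction e)
    case (Suc e)
    have "fact (n + Suc e) / fact n = (real n + real e + 1) * (fact (n + e) / fact n)"
      by (simp add: algebra_simps add_divide_distrib)
    also have "\<dots> \<le> (real n + real (Suc e) + 1) * (real n + real (Suc e) + 1) ^ e"
      by (intro mult_mono order_trans[OF Suc] power_mono) auto
    finally show ?case by simp
  qed simp
qed

lemma power_le_exp: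
  fixes y :: real assumes "y \<ge> 0" shows "y ^ e \<le> fact e * exp y"
proof -
  have "(\<Sum>n\<in>{e}. y ^ n /\<^sub>R fact n) \<le> exp y"
    unfolding exp_def using assms by (intro sum_le_suminf summable_exp_generic) auto
  then show ?thesis by (simp add: field_simps)
qed

text \<open>The factor \<open>fact (n + e) / fact n\<close> grows like \<open>n ^ e\<close>: near
  the peak it is comparable to \<open>\<Lambda> ^ e\<close>, and far away half of the exponential
  decay absorbs it. The condition \<open>\<sigma> \<le> B * \<Lambda>\<close> keeps the width of the
  peak from exceeding the order of its position. The constants are independent of the weight and of
  \<open>x\<close>, so that \<open>x\<close> may tend to infinity.\<close>

lemma moment_weights_variance:
  fixes \<delta> c B :: real and e :: nat
  assumes \<delta>: "0 < \<delta>" "\<delta> \<le> 1" and c: "c > 0" and B: "B > 0"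
  shows "\<exists>K1>0. \<exists>K2>0. \<exists>\<sigma>0. \<forall>(\<Psi>::real \<Rightarrow> real) s x \<sigma> \<Lambda>. x > 0 \<longrightarrow> \<sigma> \<ge> \<sigma>0 \<longrightarrow> \<sigma> \<ge> 1 \<longrightarrow> \<sigma> \<le> B * \<Lambda> \<longrightarrow>
    \<Lambda> \<ge> 2 * (real e + 1) \<longrightarrow> (\<forall>m. s m > 0 \<and> halfline_moment \<Psi> m = ennreal (s m)) \<longrightarrow>
    (\<forall>u. \<bar>u\<bar> \<le> \<delta> / \<sigma> \<longrightarrow> \<Psi> (x * exp u) - \<Psi> x - \<Lambda> * u \<le> 2 * \<sigma>\<^sup>2 * u\<^sup>2) \<longrightarrow>
    (\<forall>u. \<Psi> (x * exp u) - \<Psi> x - \<Lambda> * u \<ge> c * (\<sigma> * \<bar>u\<bar> - \<delta>)) \<longrightarrow>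
    variance_comparable K1 K2 (\<sigma>\<^sup>2) (\<lambda>n. fact (n + e) / fact n / s (n + e) * x ^ n)"
proof -
  \<comment> \<open>\<open>c / 2\<close> admits the upper moment bound in the whole window;
    \<open>1 / (2 * B)\<close> gives \<open>\<epsilon> * \<sigma> \<le> \<Lambda> / 2\<close>, so
    the window stays at indices of order \<open>\<Lambda>\<close>.\<close>
  define \<epsilon> where "\<epsilon> = min (c / 2) (1 / (2 * B))"
  have \<epsilon>: "\<epsilon> > 0" "\<epsilon> \<le> c / 2" "\<epsilon> * B \<le> 1 / 2" using c B by (auto simp: \<epsilon>_def min_def field_simps)
  define C where "C = (4 / \<delta>) * exp 2 * ((4 * B / \<delta>) ^ e * fact e * exp (\<delta> / (4 * B)))"
  define k where "k = (1 / (2 * (real e + 1))) ^ e * (c / (4 * exp c))"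
  have pos: "C > 0" "0 < \<delta> / 4" "\<delta> / 4 \<le> 1" "k > 0" "\<epsilon> > 0"
    using \<delta> c B \<epsilon> by (auto simp: C_def k_def)
  obtain K1 K2 where K: "K1 > 0" "K2 > 0"
    and *: "\<And>P A \<sigma> a. \<sigma> \<ge> 1 \<Longrightarrow> A > 0 \<Longrightarrow> a \<ge> \<epsilon> * \<sigma> \<Longrightarrow> \<epsilon> * \<sigma> \<ge> 8 \<Longrightarrow>
    (\<forall>n. 0 \<le> P n \<and> P n \<le> A * C * exp (- (\<delta> / 4) * \<bar>real n - a\<bar> / \<sigma>)) \<Longrightarrow>
    (\<forall>n. \<bar>real n - a\<bar> \<le> \<epsilon> * \<sigma> \<longrightarrow> P n \<ge> A * k) \<Longrightarrow>
    variance_comparable K1 K2 (\<sigma>\<^sup>2) P"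
    using concentrated_weights_variance[OF pos] by (elim exE conjE) blast
  show ?thesis
  proof (rule exI[of _ K1], rule conjI[OF K(1)], rule exI[of _ K2], rule conjI[OF K(2)], rule exI[of _ "8 / \<epsilon>"], intro allI impI)
    fix \<Psi> s x \<sigma> \<Lambda>
    assume x: "x > 0" and \<sigma>: "8 / \<epsilon> \<le> \<sigma>" "\<sigma> \<ge> 1" and \<sigma>\<Lambda>: "\<sigma> \<le> B * \<Lambda>" and \<Lambda>: "\<Lambda> \<ge> 2 * (real e + 1)"
      and s: "\<forall>m. s m > 0 \<and> halfline_moment \<Psi> m = ennreal (s m)"
      and up: "\<forall>u. \<bar>u\<bar> \<le> \<delta> / \<sigma> \<longrightarrow> \<Psi> (x * exp u) - \<Psi> x - \<Lambda> * u \<le> 2 * \<sigma>\<^sup>2 * u\<^sup>2"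
      and low: "\<forall>u. \<Psi> (x * exp u) - \<Psi> x - \<Lambda> * u \<ge> c * (\<sigma> * \<bar>u\<bar> - \<delta>)"
    have s0: "s m > 0" for m using s by blast
    define P where "P n = fact (n + e) / fact n / s (n + e) * x ^ n" for n
    \<comment> \<open>Term \<open>n\<close> uses the moment \<open>n + e\<close>, whose exponent on
      the logarithmic scale is \<open>n + e + 1\<close>; hence the shift of the centre by
      \<open>e + 1\<close>.\<close>
    define a where "a = \<Lambda> - (real e + 1)"
    define A where "A = exp (\<Psi> x) / x ^ Suc e * \<Lambda> ^ e * \<sigma>"
    have \<Lambda>0: "\<Lambda> > 0" using \<Lambda> by (rule less_le_trans[rotated]) simp
    have A0: "A > 0" using x \<sigma> \<Lambda>0 by (simp add: A_def)
    have "\<epsilon> * \<sigma> \<le> (\<epsilon> * B) * \<Lambda>" using mult_left_mono[OF \<sigma>\<Lambda>, of \<epsilon>] \<epsilon> by (simp add: mult.assoc)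
    also have "\<dots> \<le> 1 / 2 * \<Lambda>" using \<epsilon> \<Lambda>0 by (intro mult_right_mono) auto
    finally have \<epsilon>\<sigma>: "\<epsilon> * \<sigma> \<le> \<Lambda> / 2" by simp
    have big: "\<epsilon> * \<sigma> \<ge> 8" using \<sigma> \<epsilon> by (simp add: field_simps)
    note hb = halfline_moment_bounds[OF x \<sigma>(2) \<delta> c, of \<Psi> \<Lambda>]
    have shift: "real (Suc (n + e)) - \<Lambda> = real n - a" for n by (simp add: a_def)
    have slow: "s (n + e) \<ge> x ^ Suc (n + e) * exp (- \<Psi> x) *
           (\<delta> / (4 * \<sigma>) * exp (\<bar>real n - a\<bar> * \<delta> / (2 * \<sigma>) - 2))" for n
      using hb(1)[of "n + e"] up low s s0[of "n + e"] unfolding shift by (simp add: ennreal_le_iff)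
    have sup: "s (n + e) \<le> x ^ Suc (n + e) * exp (- \<Psi> x) * (exp c * 4 / (c * \<sigma>))"
      if "\<bar>real n - a\<bar> \<le> \<epsilon> * \<sigma>" for n
    proof -
      have "\<bar>real n - a\<bar> \<le> c / 2 * \<sigma>"
        using that mult_right_mono[OF \<epsilon>(2), of \<sigma>] \<sigma> by linarith
      then show ?thesis
        using hb(2)[of "n + e"] up low s x c \<sigma> unfolding shift by (simp add: ennreal_le_iff)
    qed
    have "variance_comparable K1 K2 (\<sigma>\<^sup>2) P"
    proof (rule *[OF \<sigma>(2) A0 _ big], safe)
      show "\<epsilon> * \<sigma> \<le> a" using \<epsilon>\<sigma> \<Lambda> by (simp add: a_def)
      fix n
      show P0: "0 \<le> P n" using s0[of "n + e"] x by (simp add: P_def)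
      define y where "y = \<bar>real n - a\<bar> / \<sigma>"
      have y0: "y \<ge> 0" using \<sigma> by (simp add: y_def)
      have y: "\<bar>real n - a\<bar> = \<sigma> * y" using \<sigma> by (simp add: y_def)
      \<comment> \<open>The polynomial factor is traded for \<open>exp (\<delta> / 4 * y)\<close>,
        half of the decay \<open>exp (- (y * \<delta> / 2))\<close> that the moments
        provide.\<close>
      have W: "fact (n + e) / fact n \<le> \<Lambda> ^ e * ((4 * B / \<delta>) ^ e * fact e * exp (\<delta> / (4 * B)) * exp (\<delta> / 4 * y))"
      proof -
        have "real n + real e + 1 \<le> \<Lambda> + \<sigma> * y" using y by (simp add: a_def)
        also have "\<dots> \<le> \<Lambda> + B * \<Lambda> * y" using \<sigma>\<Lambda> y0 by (intro add_left_mono mult_right_mono) auto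
        also have "\<dots> = \<Lambda> * ((4 * B / \<delta>) * (\<delta> / (4 * B) + \<delta> / 4 * y))"
          using B \<delta> by (simp add: field_simps)
        finally have "(real n + real e + 1) ^ e \<le> (\<Lambda> * ((4 * B / \<delta>) * (\<delta> / (4 * B) + \<delta> / 4 * y))) ^ e"
          by (intro power_mono) auto
        also have "\<dots> = \<Lambda> ^ e * ((4 * B / \<delta>) ^ e * (\<delta> / (4 * B) + \<delta> / 4 * y) ^ e)"
          by (simp only: power_mult_distrib)
        also have "\<dots> \<le> \<Lambda> ^ e * ((4 * B / \<delta>) ^ e * (fact e * exp (\<delta> / (4 * B) + \<delta> / 4 * y)))"
          using \<Lambda>0 B \<delta> y0 by (intro mult_left_mono power_le_exp) auto
        finally have "(real n + real e + 1) ^ e \<le> \<Lambda> ^ e * ((4 * B / \<delta>) ^ e * fact e * exp (\<delta> / (4 * B)) * exp (\<delta> / 4 * y))"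
          by (simp add: exp_add mult_ac)
        then show ?thesis using fact_ratio_bounds(2)[of n e] by linarith
      qed
      show "P n \<le> A * C * exp (- (\<delta> / 4) * \<bar>real n - a\<bar> / \<sigma>)"
      proof -
        define S where "S = x ^ Suc (n + e) * exp (- \<Psi> x) * (\<delta> / (4 * \<sigma>) * exp (y * \<delta> / 2 - 2))"
        have S0: "S > 0" using x \<delta> \<sigma> by (simp add: S_def)
        have S: "S \<le> s (n + e)" using slow[of n] \<sigma> by (simp add: S_def y)
        have "P n \<le> fact (n + e) / fact n / S * x ^ n"
          unfolding P_def using S S0 x s0[of "n+e"] by (intro mult_right_mono divide_left_mono) auto
        also have "\<dots> \<le> \<Lambda> ^ e * ((4 * B / \<delta>) ^ e * fact e * exp (\<delta> / (4 * B)) * exp (\<delta> / 4 * y)) / S * x ^ n"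
          using S0 x by (intro mult_right_mono divide_right_mono W) auto
        also have "exp (\<delta> / 4 * y) = exp (- (\<delta> / 4 * y)) * (exp (y * \<delta> / 2 - 2) * exp 2)"
          by (simp flip: exp_add add: algebra_simps)
        also have "\<Lambda> ^ e * ((4 * B / \<delta>) ^ e * fact e * exp (\<delta> / (4 * B)) * (exp (- (\<delta> / 4 * y)) * (exp (y * \<delta> / 2 - 2) * exp 2))) / S * x ^ n
           = A * C * exp (- (\<delta> / 4 * y))"
          using x \<sigma> \<delta> by (simp add: A_def C_def S_def exp_minus power_add field_simps)
        finally show ?thesis by (simp add: y_def)
      qed
    next
      fix n assume n: "\<bar>real n - a\<bar> \<le> \<epsilon> * \<sigma>"
      \<comment> \<open>The lower bound \<open>(n + 1) ^ e\<close> of the factorial ratio is of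
        order \<open>\<Lambda> ^ e\<close> once \<open>n + e + 1 \<ge> \<Lambda> / 2\<close>, up to
        a factor depending on \<open>e\<close>.\<close>
      have "real n + real e + 1 \<ge> \<Lambda> / 2" using n \<epsilon>\<sigma> by (simp add: a_def abs_le_iff)
      moreover have "(real e + 1) * (real n + 1) \<ge> real n + real e + 1" by (simp add: algebra_simps)
      ultimately have "\<Lambda> / 2 \<le> (real e + 1) * (real n + 1)" by linarith
      then have "real n + 1 \<ge> \<Lambda> * (1 / (2 * (real e + 1)))"
        by (simp add: divide_le_eq algebra_simps)
      then have "(\<Lambda> * (1 / (2 * (real e + 1)))) ^ e \<le> (real n + 1) ^ e"
        using \<Lambda>0 by (intro power_mono) auto
      then have W: "\<Lambda> ^ e * (1 / (2 * (real e + 1))) ^ e \<le> fact (n + e) / fact n"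
        using fact_ratio_bounds(1)[of n e] by (simp only: power_mult_distrib)
      define S where "S = x ^ Suc (n + e) * exp (- \<Psi> x) * (exp c * 4 / (c * \<sigma>))"
      have S0: "S > 0" using x c \<sigma> by (simp add: S_def)
      have S: "s (n + e) \<le> S" using sup[OF n] by (simp add: S_def)
      have "A * k = \<Lambda> ^ e * (1 / (2 * (real e + 1))) ^ e / S * x ^ n"
        using x \<sigma> c by (simp add: A_def k_def S_def exp_minus power_add field_simps)
      also have "\<dots> \<le> fact (n + e) / fact n / S * x ^ n"
        using S0 x by (intro mult_right_mono divide_right_mono W) auto
      also have "\<dots> \<le> P n"
        unfolding P_def using S S0 x s0[of "n+e"] by (intro mult_right_mono divide_left_mono) auto
      finally show "A * k \<le> P n" .
    qed
    then show "variance_comparable K1 K2 (\<sigma>\<^sup>2) (\<lambda>n. fact (n + e) / fact n / s (n + e) * x ^ n)"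
      unfolding P_def[abs_def] .
  qed
qed

subsection \<open>Smooth weights\<close>

lemma hderiv_eq:
  assumes "(f has_real_derivative D) (at x within {0..})" "x \<ge> 0"
  shows "hderiv f x = D"
proof -
  have "at x within {0..} \<noteq> (bot :: real filter)"
  proof
    assume "at x within {0..} = bot"
    moreover have "at_right x \<le> at x within {0..}" by (rule at_le) (use assms in auto)
    ultimately show False by (simp add: bot_unique)
  qed
  then show ?thesis
    unfolding hderiv_def
    using assms(1) unfolding has_real_derivative_iff_has_vector_derivative
    by (rule vector_derivative_within)
qed

lemma hderiv_has_derivative:
  assumes "f differentiable_on {0..}" "x \<ge> 0"
  shows "(f has_real_derivative hderiv f x) (at x within {0..})"
proof -
  have "f differentiable (at x within {0..})" using assms by (auto simp: differentiable_on_def)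
  then obtain D where "(f has_real_derivative D) (at x within {0..})"
    by (auto simp: real_differentiable_def)
  then show ?thesis using hderiv_eq[of f D x] assms by simp
qed

lemma at_within_halfline: "x > 0 \<Longrightarrow> at x within {0..} = at (x::real)"
  by (rule at_within_interior) simp

lemma halfline_nondecreasing:
  fixes f f' :: "real \<Rightarrow> real"
  assumes d: "\<And>x. x \<ge> 0 \<Longrightarrow> (f has_real_derivative f' x) (at x within {0..})"
    and nn: "\<And>x. x \<ge> 0 \<Longrightarrow> f' x \<ge> 0" and "0 \<le> a" "a \<le> b"
  shows "f a \<le> f b"
proof (rule DERIV_nonneg_imp_increasing_open[OF \<open>a \<le> b\<close>])
  show "\<exists>y. DERIV f x :> y \<and> 0 \<le> y" if "a < x" for x
    using d[of x] nn[of x] that \<open>0 \<le> a\<close> at_within_halfline[of x] by (intro exI[of _ "f' x"]) simp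
  have "continuous_on {0..} f"
    using d by (intro DERIV_continuous_on[of _ _ f']) auto
  then show "continuous_on {a..b} f" by (rule continuous_on_subset) (use assms in auto)
qed

locale smooth_weight =
  fixes \<Psi> :: "real \<Rightarrow> real"
  assumes C3: "C3_halfline \<Psi>"
    and pos1: "\<And>x. x \<ge> 0 \<Longrightarrow> hderiv \<Psi> x > 0"
    and nonneg2: "\<And>x. x \<ge> 0 \<Longrightarrow> hderiv (hderiv \<Psi>) x \<ge> 0"
    and nonneg3: "\<And>x. x \<ge> 0 \<Longrightarrow> hderiv (hderiv (hderiv \<Psi>)) x \<ge> 0"
begin

abbreviation "\<Psi>1 \<equiv> hderiv \<Psi>"
abbreviation "\<Psi>2 \<equiv> hderiv (hderiv \<Psi>)"
abbreviation "\<Psi>3 \<equiv> hderiv (hderiv (hderiv \<Psi>))"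
abbreviation "\<Phi> \<equiv> Phi \<Psi>"
abbreviation "\<Phi>1 \<equiv> hderiv (Phi \<Psi>)"
text \<open>Second and third derivative of \<open>\<Psi> (exp s)\<close> in \<open>s\<close>; see
  \<open>derivs_log_scale\<close>.\<close>

abbreviation "curvature s \<equiv> exp s * hderiv (Phi \<Psi>) (exp s)"
abbreviation "curvature1 s \<equiv> curvature s + (exp s)\<^sup>2 * hderiv (hderiv (Phi \<Psi>)) (exp s)"

lemma deriv_\<Psi>:
  assumes "x \<ge> 0"
  shows "(\<Psi> has_real_derivative \<Psi>1 x) (at x within {0..})"
    and "(\<Psi>1 has_real_derivative \<Psi>2 x) (at x within {0..})"
    and "(\<Psi>2 has_real_derivative \<Psi>3 x) (at x within {0..})"
  using C3 assms unfolding C3_halfline_def by (simp_all add: hderiv_has_derivative)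

lemma deriv_\<Phi>: "x \<ge> 0 \<Longrightarrow> (\<Phi> has_real_derivative \<Psi>1 x + x * \<Psi>2 x) (at x within {0..})"
  using DERIV_mult[OF DERIV_ident deriv_\<Psi>(2)] by (simp add: Phi_def[abs_def] mult.commute)

lemma \<Phi>1_eq: "x \<ge> 0 \<Longrightarrow> \<Phi>1 x = \<Psi>1 x + x * \<Psi>2 x"
  using deriv_\<Phi> by (rule hderiv_eq)

lemma deriv_\<Phi>1: "x \<ge> 0 \<Longrightarrow> (\<Phi>1 has_real_derivative 2 * \<Psi>2 x + x * \<Psi>3 x) (at x within {0..})"
proof -
  assume x: "x \<ge> 0"
  have "((\<lambda>x. \<Psi>1 x + x * \<Psi>2 x) has_real_derivative 2 * \<Psi>2 x + x * \<Psi>3 x) (at x within {0..})"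
    using DERIV_add[OF deriv_\<Psi>(2)[OF x] DERIV_mult[OF DERIV_ident deriv_\<Psi>(3)[OF x]]]
    by (simp add: algebra_simps)
  then show ?thesis
    by (rule has_field_derivative_transform_within[OF _ zero_less_one]) (simp_all add: x \<Phi>1_eq)
qed

lemma \<Phi>2_eq: "x \<ge> 0 \<Longrightarrow> hderiv \<Phi>1 x = 2 * \<Psi>2 x + x * \<Psi>3 x"
  using deriv_\<Phi>1 by (rule hderiv_eq)

lemma \<Psi>1_lower: "x \<ge> 0 \<Longrightarrow> \<Psi>1 0 \<le> \<Psi>1 x"
  by (rule halfline_nondecreasing[OF deriv_\<Psi>(2) nonneg2]) auto

lemma \<Phi>1_lower: "x \<ge> 0 \<Longrightarrow> \<Psi>1 0 \<le> \<Phi>1 x"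
  using \<Psi>1_lower[of x] nonneg2[of x] by (simp add: \<Phi>1_eq add_increasing2)

lemma \<Phi>1_pos: "x \<ge> 0 \<Longrightarrow> \<Phi>1 x > 0"
  using \<Phi>1_lower[of x] pos1[of 0] by simp

text \<open>A consequence of convexity. Linear growth with slope \<open>\<Psi>1 0 > 0\<close> makes
  all moments and the Fock measure finite.\<close>

lemma \<Psi>_lower: "x \<ge> 0 \<Longrightarrow> \<Psi> 0 + \<Psi>1 0 * x \<le> \<Psi> x"
proof -
  assume x: "x \<ge> 0"
  have "(\<lambda>x. \<Psi> x - \<Psi>1 0 * x) 0 \<le> (\<lambda>x. \<Psi> x - \<Psi>1 0 * x) x"
  proof (rule halfline_nondecreasing[where f = "\<lambda>x. \<Psi> x - \<Psi>1 0 * x" and f' = "\<lambda>x. \<Psi>1 x - \<Psi>1 0"])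
    show "((\<lambda>x. \<Psi> x - \<Psi>1 0 * x) has_real_derivative \<Psi>1 x - \<Psi>1 0) (at x within {0..})" if "x \<ge> 0" for x
      using DERIV_diff[OF deriv_\<Psi>(1)[OF that] DERIV_cmult_Id[of "\<Psi>1 0"]] by simp
  qed (use \<Psi>1_lower x in auto)
  then show ?thesis by simp
qed

lemma continuous_on_\<Psi>: "continuous_on {0..} \<Psi>"
  using deriv_\<Psi> by (intro DERIV_continuous_on[of _ _ \<Psi>1]) auto

lemma continuous_on_\<Phi>1: "continuous_on {0..} \<Phi>1"
  using deriv_\<Phi>1 by (intro DERIV_continuous_on) auto

section \<open>The weight in the logarithmic variable\<close>

lemma derivs_log_scale:
  shows "((\<lambda>s. \<Psi> (exp s)) has_real_derivative \<Phi> (exp s)) (at s)"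
    and "((\<lambda>s. \<Phi> (exp s)) has_real_derivative curvature s) (at s)"
    and "((\<lambda>s. curvature s) has_real_derivative
       curvature1 s) (at s)"
proof -
  have e: "exp s > 0" by simp
  have d: "(f has_real_derivative D) (at (exp s))"
    if "(f has_real_derivative D) (at (exp s) within {0..})" for f D
    using that at_within_halfline[OF e] by simp
  have "((\<lambda>s. \<Psi> (exp s)) has_real_derivative \<Psi>1 (exp s) * exp s) (at s)"
    by (rule DERIV_chain2) (auto intro!: d deriv_\<Psi>)
  then show "((\<lambda>s. \<Psi> (exp s)) has_real_derivative \<Phi> (exp s)) (at s)"
    by (simp add: Phi_def mult.commute)
  have "((\<lambda>s. \<Phi> (exp s)) has_real_derivative \<Phi>1 (exp s) * exp s) (at s)"
    using d[OF deriv_\<Phi>] \<Phi>1_eq[of "exp s"] by (intro DERIV_chain2[where f = \<Phi>]) auto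
  then show "((\<lambda>s. \<Phi> (exp s)) has_real_derivative curvature s) (at s)"
    by (simp add: mult.commute)
  have "((\<lambda>s. \<Phi>1 (exp s)) has_real_derivative hderiv \<Phi>1 (exp s) * exp s) (at s)"
    using d[OF deriv_\<Phi>1] \<Phi>2_eq[of "exp s"] by (intro DERIV_chain2[where f = \<Phi>1]) auto
  then have "((\<lambda>s. curvature s) has_real_derivative
       curvature s + (hderiv \<Phi>1 (exp s) * exp s) * exp s) (at s)"
    by (intro DERIV_mult DERIV_exp)
  then show "((\<lambda>s. curvature s) has_real_derivative
       curvature1 s) (at s)"
    by (simp add: power2_eq_square mult_ac)
qed

text \<open>The third derivative is \<open>q + x\<^sup>2 * \<Phi>'' x\<close> with
  \<open>q = x * \<Phi>' x\<close>. Class \<S> bounds the second term by a multiple of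
  \<open>x powr (3/2) * \<Phi>' x powr (1 + \<eta>)\<close>. Compared with
  \<open>q powr (3/2)\<close> the excess is \<open>\<Phi>' x powr (\<eta> - 1/2)\<close>, which is
  bounded because the exponent is negative and \<open>\<Phi>'\<close> is bounded below by
  \<open>\<Psi>' 0 > 0\<close>.\<close>

lemma self_concordant:
  assumes "\<Phi> \<in> class_S"
  obtains C \<tau> where "C > 0" "\<And>s. s \<ge> \<tau> \<Longrightarrow>
     \<bar>curvature1 s\<bar> \<le>
       2 * C * (curvature s * sqrt (curvature s))"
proof -
  obtain \<eta> where \<eta>: "\<eta> < 1/2"
    and O: "hderiv \<Phi>1 \<in> O[at_top](\<lambda>x. x powr (- 1/2) * \<Phi>1 x powr (1 + \<eta>))"
    using assms by (auto simp: class_S_def)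
  obtain K where K: "K > 0"
    and ev: "\<forall>\<^sub>F x in at_top. norm (hderiv \<Phi>1 x) \<le> K * norm (x powr (- 1/2) * \<Phi>1 x powr (1 + \<eta>))"
    using landau_o.bigE[OF O] by blast
  obtain X where X: "\<And>x. x \<ge> X \<Longrightarrow> \<bar>hderiv \<Phi>1 x\<bar> \<le> K * (x powr (- 1/2) * \<Phi>1 x powr (1 + \<eta>))"
    using ev by (auto simp: eventually_at_top_linorder abs_mult)
  define \<mu> where "\<mu> = \<Psi>1 0"
  have \<mu>: "\<mu> > 0" using pos1[of 0] by (simp add: \<mu>_def)
  define K' where "K' = K * \<mu> powr (\<eta> - 1/2)"
  have K': "K' > 0" using K \<mu> by (simp add: K'_def)
  \<comment> \<open>Beyond \<open>1 / \<mu>\<close> one has \<open>q \<ge> 1\<close>, so the first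
    term \<open>q\<close> is at most \<open>q * sqrt q\<close>.\<close>
  define X' where "X' = max (max X 1) (1 / \<mu>)"
  have X'0: "X' > 0" by (simp add: X'_def)
  show ?thesis
  proof (rule that[of "(1 + K') / 2" "ln X'"])
    show "(1 + K') / 2 > 0" using K' by simp
    fix s assume "ln X' \<le> s"
    then have "X' \<le> exp s" using X'0 by (metis exp_ln exp_le_cancel_iff)
    define x where "x = exp s"
    have x: "x \<ge> X" "x \<ge> 1" "x \<ge> 1 / \<mu>" using \<open>X' \<le> exp s\<close> by (auto simp: X'_def x_def)
    define a where "a = \<Phi>1 x"
    have a: "a \<ge> \<mu>" "a > 0" using \<Phi>1_lower[of x] \<mu> x by (auto simp: a_def \<mu>_def)
    define q where "q = x * a"
    have "1 \<le> x * \<mu>" using x(3) \<mu> by (simp add: field_simps)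
    also have "\<dots> \<le> q" unfolding q_def using a x by (intro mult_left_mono) auto
    finally have q: "q \<ge> 1" .
    have q32: "q * sqrt q = x powr (3/2) * a powr (3/2)"
    proof -
      have "q powr (3/2) = q powr 1 * q powr (1/2)" by (subst powr_add[symmetric]) simp
      also have "\<dots> = q * sqrt q" using q by (simp add: powr_half_sqrt)
      finally show ?thesis using a x by (simp add: q_def powr_mult)
    qed
    have "a powr (1 + \<eta>) = a powr (\<eta> - 1/2) * a powr (3/2)" by (subst powr_add[symmetric]) simp
    also have "\<dots> \<le> \<mu> powr (\<eta> - 1/2) * a powr (3/2)"
      using \<eta> \<mu> a by (intro mult_right_mono powr_mono2') auto
    finally have "x\<^sup>2 * \<bar>hderiv \<Phi>1 x\<bar> \<le> x\<^sup>2 * (K * (x powr (- 1/2) * (\<mu> powr (\<eta> - 1/2) * a powr (3/2))))"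
      using X[OF x(1)] K unfolding a_def[symmetric]
      by (intro mult_left_mono order_trans[OF X[OF x(1), folded a_def]]) auto
    also have "\<dots> = K' * ((x powr 2 * x powr (-1/2)) * a powr (3/2))"
      using x by (simp add: K'_def mult_ac)
    also have "x powr 2 * x powr (-1/2) = x powr (3/2)" by (subst powr_add[symmetric]) simp
    finally have h: "x\<^sup>2 * \<bar>hderiv \<Phi>1 x\<bar> \<le> K' * (q * sqrt q)" by (simp add: q32)
    have "\<bar>q + x\<^sup>2 * hderiv \<Phi>1 x\<bar> \<le> q + x\<^sup>2 * \<bar>hderiv \<Phi>1 x\<bar>"
      using q by (auto simp: abs_mult intro!: order_trans[OF abs_triangle_ineq])
    also have "q \<le> q * sqrt q" using q by simp
    finally have "\<bar>q + x\<^sup>2 * hderiv \<Phi>1 x\<bar> \<le> (1 + K') * (q * sqrt q)"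
      using h by (simp add: algebra_simps)
    also have "(1 + K') * (q * sqrt q) = 2 * ((1 + K') / 2) * (q * sqrt q)" by simp
    finally show "\<bar>curvature1 s\<bar> \<le>
       2 * ((1 + K') / 2) * (curvature s * sqrt (curvature s))"
      unfolding q_def a_def x_def .
  qed
qed

text \<open>The derivative of \<open>sqrt (curvature s)\<close> is at most
  \<open>C * curvature s\<close>, which is the derivative of \<open>C * \<Phi> (exp s)\<close>. This
  supplies the bound of the width of the peak by its position that
  \<open>moment_weights_variance\<close> asks for.\<close>

lemma sqrt_curvature_bound:
  assumes C: "C > 0" and sc: "\<And>s. s \<ge> \<tau> \<Longrightarrow>
     \<bar>curvature1 s\<bar> \<le>
       2 * C * (curvature s * sqrt (curvature s))"
  obtains G where "G \<ge> 0" "\<And>s. s \<ge> \<tau> \<Longrightarrow> sqrt (curvature s) \<le> C * \<Phi> (exp s) + G"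
proof -
  define q where "q s = curvature s" for s
  define r where "r s = curvature1 s" for s
  have q0: "q s > 0" for s using \<Phi>1_pos[of "exp s"] by (simp add: q_def)
  have dq: "(q has_real_derivative r s) (at s)" for s
    using derivs_log_scale(3)[of s] by (simp add: q_def[abs_def] r_def)
  define f where "f s = sqrt (q s) - C * \<Phi> (exp s)" for s
  have df: "(f has_real_derivative (r s / (2 * sqrt (q s)) - C * q s)) (at s)" for s
  proof -
    have "((\<lambda>s. sqrt (q s)) has_real_derivative inverse (sqrt (q s)) / 2 * r s) (at s)"
      by (rule DERIV_chain2[OF DERIV_real_sqrt[OF q0] dq])
    from DERIV_diff[OF this DERIV_cmult[OF derivs_log_scale(2), of C s]]
    have "(f has_real_derivative inverse (sqrt (q s)) / 2 * r s - C * (curvature s)) (at s)"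
      unfolding f_def[abs_def] .
    moreover have "curvature s = q s" by (simp only: q_def)
    moreover have "inverse (sqrt (q s)) / 2 * r s = r s / (2 * sqrt (q s))"
      by (simp only: divide_inverse inverse_mult_distrib mult_ac)
    ultimately show ?thesis by (simp only:)
  qed
  have mono: "f s \<le> f \<tau>" if "s \<ge> \<tau>" for s
  proof (rule DERIV_nonpos_imp_nonincreasing[OF that])
    fix u assume u: "\<tau> \<le> u" "u \<le> s"
    have "r u \<le> 2 * C * (q u * sqrt (q u))" using sc[OF u(1)] by (simp add: r_def q_def)
    then have "r u / (2 * sqrt (q u)) \<le> C * q u" using q0[of u]
      by (simp only: divide_le_eq mult_ac) simp
    then show "\<exists>y. DERIV f u :> y \<and> y \<le> 0" using df[of u] by (intro exI conjI) auto
  qed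
  show ?thesis
  proof (rule that[of "\<bar>f \<tau>\<bar>"])
    show "sqrt (curvature s) \<le> C * \<Phi> (exp s) + \<bar>f \<tau>\<bar>" if "s \<ge> \<tau>" for s
      using mono[OF that] abs_ge_self[of "f \<tau>"] unfolding f_def[of s] q_def by linarith
  qed simp
qed

end

context smooth_weight
begin

lemma moment_weights_variance_at_infinity:
  fixes e :: nat and s :: "nat \<Rightarrow> real"
  assumes S: "\<Phi> \<in> class_S" and s: "\<And>m. s m > 0" "\<And>m. halfline_moment \<Psi> m = ennreal (s m)"
  shows "\<exists>K1>0. \<exists>K2>0. \<exists>X>0. \<forall>x\<ge>X. 
    variance_comparable K1 K2 (x * \<Phi>1 x) (\<lambda>n. fact (n + e) / fact n / s (n + e) * x ^ n)"
proof -
  obtain C \<tau> where C: "C > 0" and sc: "\<And>s. s \<ge> \<tau> \<Longrightarrow>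
     \<bar>curvature1 s\<bar> \<le>
       2 * C * (curvature s * sqrt (curvature s))"
    using self_concordant[OF S] by blast
  obtain G where G: "G \<ge> 0" "\<And>s. s \<ge> \<tau> \<Longrightarrow> sqrt (curvature s) \<le> C * \<Phi> (exp s) + G"
    using sqrt_curvature_bound[OF C sc] by blast
  \<comment> \<open>The widest window that \<open>bregman_bounds\<close> permits; the constant
    \<open>c\<close> below is the slope found there.\<close>
  define \<delta> where "\<delta> = min 1 (1 / (2 * C))"
  have \<delta>: "0 < \<delta>" "\<delta> \<le> 1" "C * \<delta> \<le> 1 / 2" using C by (auto simp: \<delta>_def min_def field_simps)
  define c where "c = 4 / 9 * \<delta>"
  have c: "c > 0" using \<delta> by (simp add: c_def)
  \<comment> \<open>The additive constant \<open>G\<close> is absorbed because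
    \<open>\<Lambda> \<ge> 1\<close>.\<close>
  define B where "B = C + G"
  have B: "B > 0" using C G by (simp add: B_def)
  obtain K1 K2 \<sigma>0 where K: "K1 > 0" "K2 > 0" and main:
    "\<And>\<Psi> s x \<sigma> \<Lambda>. x > 0 \<Longrightarrow> \<sigma> \<ge> \<sigma>0 \<Longrightarrow> \<sigma> \<ge> 1 \<Longrightarrow> \<sigma> \<le> B * \<Lambda> \<Longrightarrow>
    \<Lambda> \<ge> 2 * (real e + 1) \<Longrightarrow> (\<forall>m. s m > 0 \<and> halfline_moment \<Psi> m = ennreal (s m)) \<Longrightarrow>
    (\<forall>u. \<bar>u\<bar> \<le> \<delta> / \<sigma> \<longrightarrow> \<Psi> (x * exp u) - \<Psi> x - \<Lambda> * u \<le> 2 * \<sigma>\<^sup>2 * u\<^sup>2) \<Longrightarrow>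
    (\<forall>u. \<Psi> (x * exp u) - \<Psi> x - \<Lambda> * u \<ge> c * (\<sigma> * \<bar>u\<bar> - \<delta>)) \<Longrightarrow>
    variance_comparable K1 K2 (\<sigma>\<^sup>2) (\<lambda>n. fact (n + e) / fact n / s (n + e) * x ^ n)"
    using moment_weights_variance[OF \<delta>(1,2) c B, of e] by (elim exE conjE) blast
  define \<mu> where "\<mu> = \<Psi>1 0"
  have \<mu>: "\<mu> > 0" using pos1[of 0] by (simp add: \<mu>_def)
  \<comment> \<open>The three thresholds ensure in turn \<open>t - 1 \<ge> \<tau>\<close>,
    \<open>\<sigma> \<ge> max \<sigma>0 1\<close> and \<open>\<Lambda> \<ge> 2 * (e + 1)\<close>;
    the last two use that \<open>\<Phi>1\<close> and \<open>\<Psi>1\<close> are at least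
    \<open>\<mu>\<close>.\<close>
  define X where "X = max (max (exp (\<tau> + 1)) ((max \<sigma>0 1)\<^sup>2 / \<mu>)) (2 * (real e + 1) / \<mu>)"
  have X0: "X > 0" by (auto simp: X_def less_max_iff_disj)
  have "variance_comparable K1 K2 (x * \<Phi>1 x) (\<lambda>n. fact (n + e) / fact n / s (n + e) * x ^ n)"
    if "x \<ge> X" for x
  proof -
    have x: "x > 0" "exp (\<tau> + 1) \<le> x" "(max \<sigma>0 1)\<^sup>2 / \<mu> \<le> x" "2 * (real e + 1) / \<mu> \<le> x"
      using that X0 by (auto simp: X_def)
    define t where "t = ln x"
    have xt: "x = exp t" using x by (simp add: t_def)
    have t: "t - 1 \<ge> \<tau>" using x(2) unfolding xt by simp
    define \<sigma> where "\<sigma> = sqrt (x * \<Phi>1 x)"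
    define \<Lambda> where "\<Lambda> = \<Phi> x"
    have "(max \<sigma>0 1)\<^sup>2 \<le> x * \<mu>" using x(3) \<mu> by (simp add: field_simps)
    also have "\<dots> \<le> x * \<Phi>1 x" using x \<Phi>1_lower[of x] by (intro mult_left_mono) (auto simp: \<mu>_def)
    finally have "max \<sigma>0 1 \<le> \<sigma>" unfolding \<sigma>_def by (rule real_le_rsqrt)
    then have \<sigma>: "\<sigma> \<ge> \<sigma>0" "\<sigma> \<ge> 1" by auto
    have \<sigma>2: "\<sigma>\<^sup>2 = x * \<Phi>1 x" using x \<Phi>1_pos[of x] by (simp add: \<sigma>_def)
    have "2 * (real e + 1) \<le> x * \<mu>" using x(4) \<mu> by (simp add: field_simps)
    also have "\<dots> \<le> \<Lambda>" unfolding \<Lambda>_def Phi_def using x \<Psi>1_lower[of x] by (intro mult_left_mono) (auto simp: \<mu>_def)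
    finally have \<Lambda>: "\<Lambda> \<ge> 2 * (real e + 1)" .
    have "\<sigma> \<le> C * \<Lambda> + G * 1" using G(2)[of t] t by (simp add: \<sigma>_def \<Lambda>_def xt)
    also have "\<dots> \<le> C * \<Lambda> + G * \<Lambda>" using \<Lambda> G by (intro add_left_mono mult_left_mono) auto
    finally have \<sigma>\<Lambda>: "\<sigma> \<le> B * \<Lambda>" by (simp add: B_def algebra_simps)
    have \<sigma>t: "\<sigma> = sqrt (curvature t)" by (simp add: \<sigma>_def xt)
    have qp: "curvature s > 0" for s using \<Phi>1_pos[of "exp s"] by simp
    note bb = bregman_bounds[where C = C and \<tau> = \<tau> and r = "\<lambda>s. curvature1 s",
      OF derivs_log_scale(1) derivs_log_scale(2) derivs_log_scale(3) qp _ t \<sigma>t \<sigma>(2) \<delta>]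
    have up: "\<forall>u. \<bar>u\<bar> \<le> \<delta> / \<sigma> \<longrightarrow> \<Psi> (x * exp u) - \<Psi> x - \<Lambda> * u \<le> 2 * \<sigma>\<^sup>2 * u\<^sup>2"
      using bb(1) sc C by (simp add: exp_add xt \<Lambda>_def)
    have low: "\<forall>u. \<Psi> (x * exp u) - \<Psi> x - \<Lambda> * u \<ge> c * (\<sigma> * \<bar>u\<bar> - \<delta>)"
      using bb(2) sc C by (simp add: exp_add xt \<Lambda>_def c_def)
    from main[OF x(1) \<sigma> \<sigma>\<Lambda> \<Lambda> _ up low, of s] s show ?thesis
      unfolding \<sigma>2 by blast
  qed
  with K X0 show ?thesis by blast
qed

end

section \<open>Power series with positive coefficients and their variance\<close>

locale entire_positive_series =
  fixes b :: "nat \<Rightarrow> real"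
  assumes b_pos: "\<And>n. b n > 0" and b_summable: "\<And>x. summable (\<lambda>n. b n * x ^ n)"
begin

definition "F x = (\<Sum>n. b n * x ^ n)"
definition "F1 x = (\<Sum>n. diffs b n * x ^ n)"
definition "F2 x = (\<Sum>n. diffs (diffs b) n * x ^ n)"
text \<open>\<open>L1\<close> and \<open>L2\<close> are the first two derivatives of
  \<open>ln (F x)\<close> and \<open>g1\<close> is that of \<open>x * L1 x\<close>, in closed form
  so that continuity can be read off.\<close>

definition "L1 x = F1 x / F x"
definition "L2 x = F2 x / F x - (F1 x / F x)\<^sup>2"
definition "g1 x = L1 x + x * L2 x"

lemma summable_diffs: "summable (\<lambda>n. diffs b n * x ^ n)" "summable (\<lambda>n. diffs (diffs b) n * x ^ n)" for x :: real
proof -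
  have *: "summable (\<lambda>n. diffs b n * x ^ n)" for x :: real
    by (rule termdiff_converges[of _ "\<bar>x\<bar> + 1"]) (auto intro: b_summable)
  then show "summable (\<lambda>n. diffs b n * x ^ n)" .
  show "summable (\<lambda>n. diffs (diffs b) n * x ^ n)"
    by (rule termdiff_converges[of _ "\<bar>x\<bar> + 1"]) (auto intro: *)
qed

lemma DERIV_F: "(F has_real_derivative F1 x) (at x)"
  unfolding F_def[abs_def] F1_def by (rule termdiffs_strong_converges_everywhere[OF b_summable])

lemma DERIV_F1: "(F1 has_real_derivative F2 x) (at x)"
  unfolding F1_def[abs_def] F2_def by (rule termdiffs_strong_converges_everywhere[OF summable_diffs(1)])

lemma F_pos: "x \<ge> 0 \<Longrightarrow> F x > 0"
proof -
  assume x: "x \<ge> 0"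
  have "F x \<ge> (\<Sum>n\<in>{0}. b n * x ^ n)"
    unfolding F_def using x b_pos by (intro sum_le_suminf b_summable) (auto simp: less_imp_le)
  then show ?thesis using b_pos[of 0] by simp
qed

lemma F1_pos: "x \<ge> 0 \<Longrightarrow> F1 x > 0"
proof -
  assume x: "x \<ge> 0"
  have "diffs b n * x ^ n \<ge> 0" for n using b_pos[of "Suc n"] x by (simp add: diffs_def)
  then have "F1 x \<ge> (\<Sum>n\<in>{0}. diffs b n * x ^ n)"
    unfolding F1_def by (intro sum_le_suminf summable_diffs) auto
  then show ?thesis using b_pos[of 1] by (simp add: diffs_def)
qed

lemma L1_pos: "x \<ge> 0 \<Longrightarrow> L1 x > 0"
  using F_pos F1_pos by (simp add: L1_def)

lemma DERIV_ln_F: "x \<ge> 0 \<Longrightarrow> ((\<lambda>x. ln (F x)) has_real_derivative L1 x) (at x)"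
  using F_pos[of x] DERIV_F[of x] by (auto intro!: derivative_eq_intros simp: L1_def)

lemma DERIV_L1: "x \<ge> 0 \<Longrightarrow> (L1 has_real_derivative L2 x) (at x)"
proof -
  assume x: "x \<ge> 0"
  note F = F_pos[OF x]
  from DERIV_divide[OF DERIV_F1[of x] DERIV_F[of x]] F
  have "((\<lambda>x. F1 x / F x) has_real_derivative (F2 x * F x - F1 x * F1 x) / (F x * F x)) (at x)" by simp
  also have "(F2 x * F x - F1 x * F1 x) / (F x * F x) = L2 x"
    using F by (simp add: L2_def field_simps power2_eq_square)
  finally show ?thesis unfolding L1_def[abs_def] .
qed

lemma DERIV_x_L1: "x \<ge> 0 \<Longrightarrow> ((\<lambda>x. x * L1 x) has_real_derivative g1 x) (at x)"
  using DERIV_mult[OF DERIV_ident DERIV_L1] by (simp add: g1_def add.commute mult.commute)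

lemma continuous_on_g1: "continuous_on {0..} g1"
proof -
  have cF: "continuous_on {0..} F" "continuous_on {0..} F1"
    using DERIV_F DERIV_F1 by (auto intro!: continuous_at_imp_continuous_on DERIV_isCont)
  have "continuous_on {0..} F2"
  proof -
    have "isCont (\<lambda>x. \<Sum>n. diffs (diffs b) n * x ^ n) y" for y
      by (rule isCont_powser_converges_everywhere[OF summable_diffs(2)])
    then show ?thesis unfolding F2_def[abs_def] by (auto intro: continuous_at_imp_continuous_on)
  qed
  moreover have "F x \<noteq> 0" if "x \<in> {0..}" for x using F_pos[of x] that by auto
  ultimately show ?thesis
    unfolding g1_def[abs_def] L1_def[abs_def] L2_def[abs_def] using cF
    by (intro continuous_intros) auto
qed

text \<open>Expansion in factorial moments, \<open>(n - \<mu>)\<^sup>2 = n * (n - 1) + n - 2 * \<mu>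
  * n + \<mu>\<^sup>2\<close>, since these are what the derivatives of a power series sum
  up.\<close>

lemma second_moment_sums:
  "(\<lambda>n. (real n - \<mu>)\<^sup>2 * (b n * x ^ n)) sums (x\<^sup>2 * F2 x + x * F1 x - 2 * \<mu> * (x * F1 x) + \<mu>\<^sup>2 * F x)"
proof -
  have 0: "(\<lambda>n. b n * x ^ n) sums F x" unfolding F_def using b_summable by (rule summable_sums)
  have 1: "(\<lambda>n. real n * (b n * x ^ n)) sums (x * F1 x)"
  proof -
    have "(\<lambda>n. x * (diffs b n * x ^ n)) sums (x * F1 x)"
      unfolding F1_def using summable_diffs(1) by (intro sums_mult summable_sums)
    then have "(\<lambda>n. real (Suc n) * (b (Suc n) * x ^ Suc n)) sums (x * F1 x)"
      by (simp add: diffs_def mult_ac)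
    \<comment> \<open>The index shift leaves out the term \<open>n = 0\<close>, which the factor
      \<open>n\<close> annihilates; below, \<open>n * (n - 1)\<close> does the same for two
      terms.\<close>
    from sums_Suc[OF this] show ?thesis by simp
  qed
  have 2: "(\<lambda>n. real n * (real n - 1) * (b n * x ^ n)) sums (x\<^sup>2 * F2 x)"
  proof -
    have "(\<lambda>n. x\<^sup>2 * (diffs (diffs b) n * x ^ n)) sums (x\<^sup>2 * F2 x)"
      unfolding F2_def using summable_diffs(2) by (intro sums_mult summable_sums)
    then have "(\<lambda>n. real (Suc (Suc n)) * (real (Suc (Suc n)) - 1) * (b (Suc (Suc n)) * x ^ Suc (Suc n))) sums (x\<^sup>2 * F2 x)"
      by (simp add: diffs_def mult_ac power2_eq_square)
    from sums_Suc[OF this] have "(\<lambda>n. real (Suc n) * (real (Suc n) - 1) * (b (Suc n) * x ^ Suc n)) sums (x\<^sup>2 * F2 x)"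
      by simp
    from sums_Suc[OF this] show ?thesis by simp
  qed
  have "(\<lambda>n. real n * (real n - 1) * (b n * x ^ n) + real n * (b n * x ^ n) - 2 * \<mu> * (real n * (b n * x ^ n)) + \<mu>\<^sup>2 * (b n * x ^ n))
    sums (x\<^sup>2 * F2 x + x * F1 x - 2 * \<mu> * (x * F1 x) + \<mu>\<^sup>2 * F x)"
    by (intro sums_add sums_diff sums_mult 0 1 2)
  then show ?thesis by (simp add: algebra_simps power2_eq_square)
qed

text \<open>Under the probability proportional to \<open>b n * x ^ n\<close> the mean is
  \<open>x * L1 x\<close> and the variance \<open>x * g1 x\<close>; a second moment is the variance
  plus the squared distance of \<open>\<mu>\<close> from the mean.\<close>

lemma second_moment:
  assumes "x \<ge> 0"
  shows "(\<Sum>n. (real n - \<mu>)\<^sup>2 * (b n * x ^ n)) = F x * (x * g1 x + (x * L1 x - \<mu>)\<^sup>2)"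
proof -
  have "(\<Sum>n. (real n - \<mu>)\<^sup>2 * (b n * x ^ n)) = x\<^sup>2 * F2 x + x * F1 x - 2 * \<mu> * (x * F1 x) + \<mu>\<^sup>2 * F x"
    using second_moment_sums by (rule sums_unique[symmetric])
  also have "\<dots> = F x * (x * g1 x + (x * L1 x - \<mu>)\<^sup>2)"
    using F_pos[OF assms] by (simp add: g1_def L1_def L2_def field_simps power2_eq_square)
  finally show ?thesis .
qed

text \<open>For \<open>x > 0\<close> a variance vanishes only for a point mass, but every natural
  number has positive weight, and one of them differs from the mean.\<close>

lemma g1_pos:
  assumes "x \<ge> 0" shows "g1 x > 0"
proof (cases "x = 0")
  case True
  then show ?thesis using L1_pos[of 0] by (simp add: g1_def)
next
  case False
  with assms have x: "x > 0" by simp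
  define \<mu> where "\<mu> = x * L1 x"
  obtain k where k: "real k \<noteq> \<mu>" by (metis of_nat_eq_iff zero_neq_one)
  have "0 < (\<Sum>n. (real n - \<mu>)\<^sup>2 * (b n * x ^ n))"
  proof (rule suminf_pos2[where i = k])
    show "summable (\<lambda>n. (real n - \<mu>)\<^sup>2 * (b n * x ^ n))"
      using second_moment_sums by (rule sums_summable)
    show "0 \<le> (real n - \<mu>)\<^sup>2 * (b n * x ^ n)" for n
      using b_pos[of n] x by simp
    show "0 < (real k - \<mu>)\<^sup>2 * (b k * x ^ k)"
      using b_pos[of k] x k by simp
  qed
  also have "\<dots> = F x * (x * g1 x)" using second_moment[OF assms, of \<mu>] by (simp add: \<mu>_def)
  finally show ?thesis using F_pos[OF assms] x by (simp add: zero_less_mult_iff)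
qed

end

section \<open>Comparison of the logarithmic derivatives of the series with the weight\<close>

lemma comparable_on_compact:
  fixes f g :: "real \<Rightarrow> real"
  assumes cont: "continuous_on {0..} f" "continuous_on {0..} g"
    and pos: "\<And>x. x \<ge> 0 \<Longrightarrow> f x > 0" "\<And>x. x \<ge> 0 \<Longrightarrow> g x > 0" and "X \<ge> 0"
  shows "\<exists>K>0. \<forall>x\<in>{0..X}. f x \<le> K * g x"
proof -
  have "continuous_on {0..X} (\<lambda>x. f x / g x)"
    using cont pos(2) by (intro continuous_on_divide) (force intro: continuous_on_subset)+
  then obtain y where y: "y \<in> {0..X}" "\<And>x. x \<in> {0..X} \<Longrightarrow> f x / g x \<le> f y / g y"
    using continuous_attains_sup[of "{0..X}" "\<lambda>x. f x / g x"] \<open>X \<ge> 0\<close> by auto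
  have "f x \<le> (f y / g y) * g x" if "x \<in> {0..X}" for x
    using y(2)[OF that] pos(2)[of x] that by (simp add: divide_le_eq)
  moreover have "f y / g y > 0" using y pos by simp
  ultimately show ?thesis by blast
qed

text \<open>In the application \<open>e\<close> is the dimension minus one and
  \<open>\<kappa>\<close> the reciprocal of a Gaussian mass, which disappears from logarithmic
  derivatives.\<close>

locale weight_series = smooth_weight \<Psi> + entire_positive_series b for \<Psi> b +
  fixes \<kappa> :: real and e :: nat and s :: "nat \<Rightarrow> real"
  assumes S: "\<Phi> \<in> class_S" and s: "\<And>m. s m > 0" "\<And>m. halfline_moment \<Psi> m = ennreal (s m)"
    and \<kappa>: "\<kappa> > 0" and b: "\<And>n. b n = \<kappa> * (fact (n + e) / fact n / s (n + e))"
begin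

text \<open>Class \<S> speaks of large arguments only; on \<open>{0..X}\<close> the two functions
  are comparable because both are continuous and positive.\<close>

lemma g1_comparable: "\<exists>k>0. \<exists>K>0. \<forall>x\<ge>0. k * \<Phi>1 x \<le> g1 x \<and> g1 x \<le> K * \<Phi>1 x"
proof -
  obtain K1 K2 X where K: "K1 > 0" "K2 > 0" "X > 0" and
    main: "\<And>x. x \<ge> X \<Longrightarrow> variance_comparable K1 K2 (x * \<Phi>1 x) (\<lambda>n. fact (n + e) / fact n / s (n + e) * x ^ n)"
    using moment_weights_variance_at_infinity[OF S s, of e] by (elim exE conjE) blast
  have large: "K2 * \<Phi>1 x \<le> g1 x \<and> g1 x \<le> K1 * \<Phi>1 x" if "x \<ge> X" for x
  proof -
    have x: "x > 0" using that K by simp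
    define P where "P n = fact (n + e) / fact n / s (n + e) * x ^ n" for n
    have bP: "b n * x ^ n = \<kappa> * P n" for n by (simp add: b P_def)
    have P: "P n = (1 / \<kappa>) * (b n * x ^ n)" for n using \<kappa> by (simp add: bP)
    obtain a where a: "(\<Sum>n. (real n - a)\<^sup>2 * P n) \<le> K1 * (x * \<Phi>1 x) * suminf P"
      "\<And>\<mu>. summable (\<lambda>n. (real n - \<mu>)\<^sup>2 * P n) \<Longrightarrow> K2 * (x * \<Phi>1 x) * suminf P \<le> (\<Sum>n. (real n - \<mu>)\<^sup>2 * P n)"
      using main[OF \<open>x \<ge> X\<close>] unfolding variance_comparable_def P_def[symmetric] P_def[symmetric, abs_def] by blast
    have sP: "suminf P = F x / \<kappa>"
      unfolding P[abs_def] F_def using b_summable[of x] by (subst suminf_mult) auto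
    have P2: "(\<lambda>n. (real n - \<mu>)\<^sup>2 * P n) sums (F x / \<kappa> * (x * g1 x + (x * L1 x - \<mu>)\<^sup>2))" for \<mu>
    proof -
      have "(\<lambda>n. (real n - \<mu>)\<^sup>2 * (b n * x ^ n)) sums (F x * (x * g1 x + (x * L1 x - \<mu>)\<^sup>2))"
        using second_moment[of x \<mu>] second_moment_sums[of \<mu> x] x by (auto simp: sums_iff)
      from sums_mult[OF this, of "1 / \<kappa>"] show ?thesis by (simp add: P mult_ac)
    qed
    define D where "D = F x / \<kappa> * x"
    have D: "D > 0" using F_pos[of x] x \<kappa> by (simp add: D_def)
    \<comment> \<open>The lower clause is used at the mean, where the squared term of
      \<open>second_moment\<close> vanishes; for the upper clause that term is simply
      dropped.\<close>
    have "D * (K2 * \<Phi>1 x) \<le> D * g1 x"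
      using a(2)[OF sums_summable[OF P2], of "x * L1 x"] sums_unique[OF P2, of "x * L1 x"]
      by (simp add: sP D_def mult_ac)
    moreover have "D * g1 x \<le> D * (K1 * \<Phi>1 x)"
    proof -
      have "D * g1 x \<le> F x / \<kappa> * (x * g1 x + (x * L1 x - a)\<^sup>2)"
        using F_pos[of x] x \<kappa> by (simp add: D_def field_simps)
      also have "\<dots> \<le> D * (K1 * \<Phi>1 x)" using a(1) sums_unique[OF P2, of a] by (simp add: sP D_def mult_ac)
      finally show ?thesis .
    qed
    ultimately show ?thesis using D by simp
  qed
  obtain M1 where M1: "M1 > 0" "\<And>x. x \<in> {0..X} \<Longrightarrow> g1 x \<le> M1 * \<Phi>1 x"
    using comparable_on_compact[OF continuous_on_g1 continuous_on_\<Phi>1 g1_pos \<Phi>1_pos, of X] K by auto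
  obtain M2 where M2: "M2 > 0" "\<And>x. x \<in> {0..X} \<Longrightarrow> \<Phi>1 x \<le> M2 * g1 x"
    using comparable_on_compact[OF continuous_on_\<Phi>1 continuous_on_g1 \<Phi>1_pos g1_pos, of X] K by auto
  have "min K2 (1 / M2) * \<Phi>1 x \<le> g1 x \<and> g1 x \<le> max K1 M1 * \<Phi>1 x" if "x \<ge> 0" for x
  proof -
    have \<Phi>0: "\<Phi>1 x \<ge> 0" using \<Phi>1_pos[OF that] by simp
    note m = mult_right_mono[OF min.cobounded1[of K2 "1 / M2"] \<Phi>0] mult_right_mono[OF min.cobounded2[of K2 "1 / M2"] \<Phi>0]
      mult_right_mono[OF max.cobounded1[of K1 M1] \<Phi>0] mult_right_mono[OF max.cobounded2[of M1 K1] \<Phi>0]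
    show ?thesis
    proof (cases "x \<le> X")
      case True
      then have "1 / M2 * \<Phi>1 x \<le> g1 x" using M2(2)[of x] M2(1) that by (simp add: field_simps)
      with m M1(2)[of x] True that show ?thesis by auto
    qed (use large[of x] m in auto)
  qed
  moreover have "min K2 (1 / M2) > 0" "max K1 M1 > 0" using K M1 M2 by auto
  ultimately show ?thesis by blast
qed

lemma derivatives_comparable:
  "\<exists>k>0. \<exists>K>0. \<forall>x\<ge>0. k * \<Phi>1 x \<le> g1 x \<and> g1 x \<le> K * \<Phi>1 x \<and> k * \<Psi>1 x \<le> L1 x \<and> L1 x \<le> K * \<Psi>1 x"
proof -
  obtain k K where kK: "k > 0" "K > 0" "\<And>x. x \<ge> 0 \<Longrightarrow> k * \<Phi>1 x \<le> g1 x" "\<And>x. x \<ge> 0 \<Longrightarrow> g1 x \<le> K * \<Phi>1 x"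
    using g1_comparable by blast
  have d: "((\<lambda>x. x * L1 x) has_real_derivative g1 x) (at x within {0..})" if "x \<ge> 0" for x
    using DERIV_x_L1[OF that] by (rule has_field_derivative_at_within)
  have d\<Phi>: "(\<Phi> has_real_derivative \<Phi>1 x) (at x within {0..})" if "x \<ge> 0" for x
    using deriv_\<Phi>[OF that] \<Phi>1_eq[OF that] by simp
  have lo: "x * (k * \<Psi>1 x) \<le> x * L1 x" if "x \<ge> 0" for x
  proof -
    have "(\<lambda>x. x * L1 x - k * \<Phi> x) 0 \<le> (\<lambda>x. x * L1 x - k * \<Phi> x) x"
    proof (rule halfline_nondecreasing[where f = "\<lambda>x. x * L1 x - k * \<Phi> x" and f' = "\<lambda>x. g1 x - k * \<Phi>1 x"])
      show "((\<lambda>x. x * L1 x - k * \<Phi> x) has_real_derivative g1 x - k * \<Phi>1 x) (at x within {0..})" if "x \<ge> 0" for x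
        by (intro DERIV_diff d DERIV_cmult d\<Phi> that)
    qed (use kK that in auto)
    then show ?thesis by (simp add: Phi_def mult_ac)
  qed
  have hi: "x * L1 x \<le> x * (K * \<Psi>1 x)" if "x \<ge> 0" for x
  proof -
    have "(\<lambda>x. K * \<Phi> x - x * L1 x) 0 \<le> (\<lambda>x. K * \<Phi> x - x * L1 x) x"
    proof (rule halfline_nondecreasing[where f = "\<lambda>x. K * \<Phi> x - x * L1 x" and f' = "\<lambda>x. K * \<Phi>1 x - g1 x"])
      show "((\<lambda>x. K * \<Phi> x - x * L1 x) has_real_derivative K * \<Phi>1 x - g1 x) (at x within {0..})" if "x \<ge> 0" for x
        by (intro DERIV_diff d DERIV_cmult d\<Phi> that)
    qed (use kK that in auto)
    then show ?thesis by (simp add: Phi_def mult_ac)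
  qed
  have "k * \<Psi>1 x \<le> L1 x \<and> L1 x \<le> K * \<Psi>1 x" if "x \<ge> 0" for x
  proof (cases "x = 0")
    case True
    \<comment> \<open>The integrated comparison carries a factor \<open>x\<close> and is void at 0,
      but there it coincides with the comparison of the derivatives.\<close>
    have "\<Phi>1 0 = \<Psi>1 0" "g1 0 = L1 0" by (simp_all add: \<Phi>1_eq g1_def)
    then show ?thesis using kK(3,4)[of 0] True by simp
  next
    case False
    then show ?thesis using lo[OF that] hi[OF that] that by simp
  qed
  with kK show ?thesis by blast
qed

end

subsection \<open>Adjoints and positive operators\<close>

lemma scaleC_one: "1 *\<^sub>C (x :: 'a :: complex_normed_vector) = x"
  using scaleR_scaleC[of 1 x] by simp

interpretation scaleC: vector_space "scaleC :: complex \<Rightarrow> 'a \<Rightarrow> 'a :: complex_normed_vector"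
  by standard (simp_all add: scaleC_add_right scaleC_add_left scaleC_scaleC scaleC_one)

lemma cinner_add_right: "cinner x (y + z) = cinner x y + cinner x z"
  by (metis cinner_add_left cinner_commute complex_cnj_add)

lemma cinner_scaleC_right: "cinner x (c *\<^sub>C y) = cnj c * cinner x y"
  by (metis cinner_commute cinner_scaleC_left complex_cnj_mult)

lemma cinner_scaleR_left: "cinner (r *\<^sub>R x) y = r * cinner x y"
  by (simp add: scaleR_scaleC cinner_scaleC_left)

lemma cinner_scaleR_right: "cinner x (r *\<^sub>R y) = r * cinner x y"
  by (simp add: scaleR_scaleC cinner_scaleC_right)

lemma cinner_minus_left: "cinner (- x) y = - cinner x y"
  using cinner_scaleR_left[of "-1" x y] by simp

lemma cinner_minus_right: "cinner x (- y) = - cinner x y"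
  using cinner_scaleR_right[of x "-1" y] by simp

lemma cinner_diff_left: "cinner (x - y) z = cinner x z - cinner y z"
  using cinner_add_left[of x "- y" z] by (simp add: cinner_minus_left)

lemma cinner_diff_right: "cinner x (y - z) = cinner x y - cinner x z"
  using cinner_add_right[of x y "- z"] by (simp add: cinner_minus_right)

lemma cinner_zero_left [simp]: "cinner 0 x = 0"
  using cinner_scaleR_left[of 0 0 x] by simp

lemma Re_cinner_commute: "Re (cinner x y) = Re (cinner y x)"
  by (subst cinner_commute) simp

lemma norm_add_sq: "(norm (x + y))\<^sup>2 = (norm x)\<^sup>2 + 2 * Re (cinner x y) + (norm (y :: 'h :: complex_hilbert_space))\<^sup>2"
proof -
  have "complex_of_real ((norm (x + y))\<^sup>2) = cinner x x + cinner x y + (cinner y x + cinner y y)"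
    by (simp only: cinner_self[symmetric] cinner_add_left cinner_add_right add_ac)
  then have "(norm (x + y))\<^sup>2 = Re (cinner x x + cinner x y + (cinner y x + cinner y y))"
    by (metis Re_complex_of_real)
  then show ?thesis by (simp add: cinner_self Re_cinner_commute[of y x])
qed

lemma Re_cinner_le: "Re (cinner x y) \<le> norm x * norm (y :: 'h :: complex_hilbert_space)"
proof (cases "x = 0 \<or> y = 0")
  case True
  then show ?thesis using Re_cinner_commute[of x y] by auto
next
  case False
  define a b where "a = norm x" and "b = norm y"
  have ab: "a > 0" "b > 0" using False by (auto simp: a_def b_def)
  have "0 \<le> (norm (b *\<^sub>R x + (- a) *\<^sub>R y))\<^sup>2" by simp
  also have "\<dots> = 2 * (a * b) * (a * b - Re (cinner x y))"
    unfolding norm_add_sq by (simp add: cinner_scaleR_left cinner_scaleR_right cinner_minus_left cinner_minus_right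
        a_def b_def power2_eq_square algebra_simps)
  finally show ?thesis using mult_pos_pos[OF ab] unfolding zero_le_mult_iff a_def b_def by simp
qed

section \<open>Riesz representation and existence of adjoints\<close>

text \<open>The representing vector minimises \<open>J x = (norm x)\<^sup>2 - 2 * f x\<close>. The
  parallelogram law makes a minimising sequence Cauchy, and the first variation at its limit yields
  the formula. Stating this for real functionals and real parts leaves the complex structure to
  \<open>adj_exists\<close>.\<close>

lemma real_riesz:
  fixes f :: "'h :: complex_hilbert_space \<Rightarrow> real"
  assumes "bounded_linear f"
  shows "\<exists>b. \<forall>v. f v = Re (cinner v b)"
proof -
  interpret f: bounded_linear f by fact
  define J where "J x = (norm x)\<^sup>2 - 2 * f x" for x
  obtain K where K: "\<And>x. norm (f x) \<le> norm x * K" using f.bounded by blast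
  have J_lower: "J x \<ge> - K\<^sup>2" for x
  proof -
    have "f x \<le> norm x * K" using K[of x] by simp
    moreover have "0 \<le> (norm x - K)\<^sup>2" by simp
    ultimately show ?thesis by (simp add: J_def power2_eq_square algebra_simps)
  qed
  define m where "m = Inf (range J)"
  have bdd: "bdd_below (range J)" using J_lower by (auto intro!: bdd_belowI)
  have m_le: "m \<le> J x" for x unfolding m_def using bdd by (intro cInf_lower) auto
  define h where "h n = 1 / real (Suc n)" for n
  have h: "h n > 0" "k \<ge> n \<Longrightarrow> h k \<le> h n" for n k
    by (auto simp: h_def intro!: divide_left_mono)
  have "\<exists>x. J x < m + h n" for n
  proof -
    have "Inf (range J) < m + h n" using h by (simp add: m_def)
    then show ?thesis using cInf_lessD[of "range J"] by blast
  qed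
  then obtain X where X: "\<And>n. J (X n) < m + h n" by metis
  \<comment> \<open>The midpoint of two near-minimisers cannot have a value below \<open>m\<close>,
    which bounds their distance.\<close>
  have par: "(norm (x - y))\<^sup>2 \<le> 2 * (J x - m) + 2 * (J y - m)" for x y
  proof -
    have "J ((1/2) *\<^sub>R (x + y)) = (1/4) * (norm (x + y))\<^sup>2 - (f x + f y)"
      by (simp add: J_def f.scaleR f.add power_mult_distrib power_divide) (simp add: field_simps)
    moreover have "(norm (x + y))\<^sup>2 + (norm (x - y))\<^sup>2 = 2 * (norm x)\<^sup>2 + 2 * (norm y)\<^sup>2"
      using norm_add_sq[of x y] norm_add_sq[of x "- y"] by (simp add: cinner_minus_right)
    ultimately show ?thesis using m_le[of "(1/2) *\<^sub>R (x + y)"] by (simp add: J_def)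
  qed
  have "Cauchy X"
  proof (rule metric_CauchyI)
    fix \<epsilon> :: real assume \<epsilon>: "\<epsilon> > 0"
    obtain N where N: "h N < \<epsilon>\<^sup>2 / 4"
      using \<epsilon> nat_approx_posE[of "\<epsilon>\<^sup>2 / 4"] by (auto simp: h_def)
    have "dist (X i) (X j) < \<epsilon>" if "i \<ge> N" "j \<ge> N" for i j
    proof -
      have "J (X i) - m < h N" "J (X j) - m < h N"
        using X[of i] X[of j] h(2)[OF that(1)] h(2)[OF that(2)] by simp_all
      then have "2 * (J (X i) - m) + 2 * (J (X j) - m) < 4 * h N" by simp
      also have "\<dots> < \<epsilon>\<^sup>2" using N by simp
      finally have "(norm (X i - X j))\<^sup>2 < \<epsilon>\<^sup>2"
        by (rule le_less_trans[OF par])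
      then show ?thesis using \<epsilon> by (simp add: dist_norm power2_less_imp_less)
    qed
    then show "\<exists>M. \<forall>m\<ge>M. \<forall>n\<ge>M. dist (X m) (X n) < \<epsilon>" by blast
  qed
  then obtain b where b: "X \<longlonglongrightarrow> b" using Cauchy_convergent convergent_def by blast
  have "(\<lambda>n. J (X n)) \<longlonglongrightarrow> J b" unfolding J_def using b by (intro tendsto_intros f.tendsto)
  moreover have "(\<lambda>n. m + h n) \<longlonglongrightarrow> m + 0"
    unfolding h_def by (intro tendsto_add tendsto_const LIMSEQ_Suc[OF lim_1_over_n])
  ultimately have "J b \<le> m"
    using X by (intro LIMSEQ_le[of "\<lambda>n. J (X n)" _ "\<lambda>n. m + h n"]) (auto intro!: exI[of _ 0] less_imp_le)
  then have min: "J b \<le> J x" for x using m_le[of x] by simp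
  have "f v = Re (cinner v b)" for v
  proof -
    define d where "d = Re (cinner v b) - f v"
    have quad: "0 \<le> 2 * t * d + t\<^sup>2 * (norm v)\<^sup>2" for t
      using min[of "b + t *\<^sub>R v"] norm_add_sq[of b "t *\<^sub>R v"] Re_cinner_commute[of b v]
      by (simp add: J_def f.add f.scaleR d_def cinner_scaleR_right power_mult_distrib algebra_simps)
    have "d = 0"
    proof (rule ccontr)
      assume "d \<noteq> 0"
      \<comment> \<open>Adding 1 avoids a separate case for \<open>v = 0\<close>; at
        \<open>t = - d / w\<close> the quadratic is negative unless \<open>d = 0\<close>.\<close>
      define w where "w = (norm v)\<^sup>2 + 1"
      have w: "w > 0" "(norm v)\<^sup>2 < w" by (auto simp: w_def add_nonneg_pos)
      have "0 \<le> 2 * (- d / w) * d + (- d / w)\<^sup>2 * (norm v)\<^sup>2" by (rule quad)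
      also have "\<dots> \<le> 2 * (- d / w) * d + (- d / w)\<^sup>2 * w" using w by (intro add_left_mono mult_left_mono) auto
      also have "\<dots> = - (d\<^sup>2 / w)" using w by (simp add: power2_eq_square field_simps)
      also have "\<dots> < 0" using \<open>d \<noteq> 0\<close> w by simp
      finally show False by simp
    qed
    then show ?thesis by (simp add: d_def)
  qed
  then show ?thesis by blast
qed

lemma bounded_operatorsD: "A \<in> bounded_operators \<Longrightarrow> blinfun_apply A (c *\<^sub>C x) = c *\<^sub>C blinfun_apply A x"
  by (simp add: bounded_operators_def)

lemma cinner_eqI: "(\<And>v. cinner v x = cinner v y) \<Longrightarrow> x = (y :: 'h :: complex_hilbert_space)"
proof -
  assume "\<And>v. cinner v x = cinner v y"
  then have "cinner (x - y) (x - y) = 0" by (simp add: cinner_diff_right)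
  then show "x = y" by (simp add: cinner_self)
qed

lemma adj_exists:
  fixes A :: "'h :: complex_hilbert_space \<Rightarrow>\<^sub>L 'h"
  assumes A: "A \<in> bounded_operators"
  shows "\<exists>B. \<forall>x y. cinner (blinfun_apply A x) y = cinner x (blinfun_apply B y)"
proof -
  have "\<exists>b. \<forall>x. cinner (blinfun_apply A x) y = cinner x b" for y
  proof -
    have "bounded_linear (\<lambda>x. Re (cinner (blinfun_apply A x) y))"
    proof (rule bounded_linear_intro)
      fix x
      have "\<bar>Re (cinner (blinfun_apply A x) y)\<bar> \<le> norm (blinfun_apply A x) * norm y"
        using Re_cinner_le[of "blinfun_apply A x" y] Re_cinner_le[of "- blinfun_apply A x" y]
        by (simp add: cinner_minus_left)
      also have "\<dots> \<le> (norm A * norm x) * norm y" by (intro mult_right_mono norm_blinfun) auto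
      finally show "norm (Re (cinner (blinfun_apply A x) y)) \<le> norm x * (norm A * norm y)" by (simp add: mult_ac)
    qed (simp_all add: blinfun.add_right blinfun.scaleR_right cinner_add_left cinner_scaleR_left)
    then obtain b where b: "\<And>v. Re (cinner (blinfun_apply A v) y) = Re (cinner v b)" using real_riesz by blast
    have "cinner (blinfun_apply A x) y = cinner x b" for x
    proof (rule complex_eqI)
      show "Re (cinner (blinfun_apply A x) y) = Re (cinner x b)" by (rule b)
      \<comment> \<open>The imaginary part at \<open>x\<close> is the real part at
        \<open>(- \<i>) *\<^sub>C x\<close>; this is where complex linearity of \<open>A\<close>
        enters.\<close>
      show "Im (cinner (blinfun_apply A x) y) = Im (cinner x b)"
        using b[of "(- \<i>) *\<^sub>C x"] by (simp add: bounded_operatorsD[OF A] blinfun.minus_right cinner_minus_left cinner_scaleC_left)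
    qed
    then show ?thesis by blast
  qed
  then obtain B where B: "\<And>x y. cinner (blinfun_apply A x) y = cinner x (B y)" by metis
  have "bounded_linear B"
  proof (rule bounded_linear_intro)
    show "B (x + y) = B x + B y" for x y
      by (rule cinner_eqI) (simp add: B[symmetric] cinner_add_right)
    show "B (r *\<^sub>R x) = r *\<^sub>R B x" for r x
      by (rule cinner_eqI) (simp add: B[symmetric] cinner_scaleR_right)
    fix y
    have "(norm (B y))\<^sup>2 = Re (cinner (blinfun_apply A (B y)) y)" by (simp add: B cinner_self)
    also have "\<dots> \<le> norm (blinfun_apply A (B y)) * norm y" by (rule Re_cinner_le)
    also have "\<dots> \<le> (norm A * norm (B y)) * norm y" by (intro mult_right_mono norm_blinfun) auto
    finally have "norm (B y) * norm (B y) \<le> norm (B y) * (norm y * norm A)"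
      by (simp add: power2_eq_square mult_ac)
    then show "norm (B y) \<le> norm y * norm A" 
      by (cases "norm (B y) = 0") (auto simp: mult_le_cancel_left)
  qed
  then show ?thesis using B by (intro exI[of _ "Blinfun B"]) (simp add: bounded_linear_Blinfun_apply)
qed

text \<open>\<open>adj\<close> is a definite description, so this property has to be earned by
  existence and uniqueness.\<close>

lemma cinner_adj:
  assumes "A \<in> bounded_operators"
  shows "cinner (blinfun_apply A x) y = cinner x (blinfun_apply (adj A) y)"
proof -
  have "\<exists>!B. \<forall>x y. cinner (blinfun_apply A x) y = cinner x (blinfun_apply B y)"
  proof (rule ex_ex1I[OF adj_exists[OF assms]])
    fix B C
    assume "\<forall>x y. cinner (blinfun_apply A x) y = cinner x (blinfun_apply B y)"
      "\<forall>x y. cinner (blinfun_apply A x) y = cinner x (blinfun_apply C y)"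
    then show "B = C" by (intro blinfun_eqI cinner_eqI) metis
  qed
  from theI'[OF this] show ?thesis unfolding adj_def by blast
qed

lemma adj_eqI:
  assumes "A \<in> bounded_operators" "\<And>x y. cinner (blinfun_apply A x) y = cinner x (blinfun_apply B y)"
  shows "adj A = B"
  using assms by (intro blinfun_eqI cinner_eqI) (simp flip: cinner_adj)

lemma bounded_operators_add: "A \<in> bounded_operators \<Longrightarrow> B \<in> bounded_operators \<Longrightarrow> A + B \<in> bounded_operators"
  by (simp add: bounded_operators_def blinfun.add_left scaleC_add_right)

lemma bounded_operators_diff: "A \<in> bounded_operators \<Longrightarrow> B \<in> bounded_operators \<Longrightarrow> A - B \<in> bounded_operators"
  by (simp add: bounded_operators_def blinfun.diff_left scaleC.scale_right_diff_distrib)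

lemma bounded_operators_scaleC: "A \<in> bounded_operators \<Longrightarrow> c *\<^sub>C A \<in> bounded_operators"
  by (simp add: bounded_operators_def scaleC_blinfun_apply scaleC.scale_left_commute)

lemma bounded_operators_zero: "0 \<in> bounded_operators"
  by (simp add: bounded_operators_def)

lemma bounded_operators_sum: "(\<And>i. i \<in> I \<Longrightarrow> A i \<in> bounded_operators) \<Longrightarrow> (\<Sum>i\<in>I. A i) \<in> bounded_operators"
  by (induction I rule: infinite_finite_induct)
     (auto intro!: bounded_operators_add bounded_operators_zero)

lemma adj_add: "A \<in> bounded_operators \<Longrightarrow> B \<in> bounded_operators \<Longrightarrow> adj (A + B) = adj A + adj B"
  by (rule adj_eqI) (simp_all add: bounded_operators_add blinfun.add_left cinner_add_left cinner_add_right cinner_adj)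

lemma adj_diff: "A \<in> bounded_operators \<Longrightarrow> B \<in> bounded_operators \<Longrightarrow> adj (A - B) = adj A - adj B"
  by (rule adj_eqI) (simp_all add: bounded_operators_diff blinfun.diff_left cinner_diff_left cinner_diff_right cinner_adj)

lemma adj_scaleC: "A \<in> bounded_operators \<Longrightarrow> adj (c *\<^sub>C A) = cnj c *\<^sub>C adj A"
  by (rule adj_eqI) (simp_all add: bounded_operators_scaleC scaleC_blinfun_apply cinner_scaleC_left cinner_scaleC_right cinner_adj)

lemma adj_zero: "adj 0 = 0"
  by (rule adj_eqI) (auto simp: bounded_operators_def cinner_scaleR_right[of _ 0 0, simplified])

lemma adj_sum: "(\<And>i. i \<in> I \<Longrightarrow> A i \<in> bounded_operators) \<Longrightarrow> adj (\<Sum>i\<in>I. A i) = (\<Sum>i\<in>I. adj (A i))"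
  by (induction I rule: infinite_finite_induct) (auto simp: adj_zero adj_add bounded_operators_sum)

lemma norm_adj_apply_le:
  assumes "A \<in> bounded_operators" shows "norm (blinfun_apply (adj A) y) \<le> norm A * norm y"
proof -
  let ?B = "blinfun_apply (adj A) y"
  have "(norm ?B)\<^sup>2 = Re (cinner (blinfun_apply A ?B) y)" by (simp add: cinner_adj[OF assms] cinner_self)
  also have "\<dots> \<le> norm (blinfun_apply A ?B) * norm y" by (rule Re_cinner_le)
  also have "\<dots> \<le> (norm A * norm ?B) * norm y" by (intro mult_right_mono norm_blinfun) auto
  finally have "norm ?B * norm ?B \<le> norm ?B * (norm A * norm y)"
    by (simp add: power2_eq_square mult_ac)
  then show ?thesis by (cases "norm ?B = 0") (auto simp: mult_le_cancel_left)
qed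

lemma norm_adj:
  assumes "A \<in> bounded_operators" shows "norm (adj A) = norm A"
proof (rule antisym)
  show "norm (adj A) \<le> norm A" using norm_adj_apply_le[OF assms] by (rule norm_blinfun_bound[rotated]) simp
  show "norm A \<le> norm (adj A)"
  proof (rule norm_blinfun_bound)
    fix x
    let ?B = "blinfun_apply A x"
    have "(norm ?B)\<^sup>2 = Re (cinner x (blinfun_apply (adj A) ?B))" by (simp add: cinner_adj[OF assms, symmetric] cinner_self)
    also have "\<dots> \<le> norm x * norm (blinfun_apply (adj A) ?B)" by (rule Re_cinner_le)
    also have "\<dots> \<le> norm x * (norm (adj A) * norm ?B)" by (intro mult_left_mono norm_blinfun) auto
    finally have "norm ?B * norm ?B \<le> norm ?B * (norm (adj A) * norm x)"
      by (simp add: power2_eq_square mult_ac)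
    then show "norm ?B \<le> norm (adj A) * norm x" by (cases "norm ?B = 0") (auto simp: mult_le_cancel_left)
  qed simp
qed

section \<open>Sums of positive operators and the Lagrange identity\<close>

text \<open>Each \<open>A i o\<^sub>L adj (A i)\<close> is positive, so nothing cancels: a single
  term of the quadratic form is at most the whole form. The resulting bound on
  \<open>adj (A k)\<close> passes to \<open>A k\<close> because both have the same norm.\<close>

lemma norm_square_sum_bounds:
  fixes A :: "'i \<Rightarrow> ('h :: complex_hilbert_space \<Rightarrow>\<^sub>L 'h)" and \<alpha> :: "'i \<Rightarrow> real"
  assumes "finite I" and A: "\<And>i. i \<in> I \<Longrightarrow> A i \<in> bounded_operators" and \<alpha>: "\<And>i. i \<in> I \<Longrightarrow> \<alpha> i \<ge> 0"
  shows "norm (\<Sum>i\<in>I. \<alpha> i *\<^sub>R (A i o\<^sub>L adj (A i))) \<le> (\<Sum>i\<in>I. \<alpha> i * (norm (A i))\<^sup>2)"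
    and "k \<in> I \<Longrightarrow> \<alpha> k * (norm (A k))\<^sup>2 \<le> norm (\<Sum>i\<in>I. \<alpha> i *\<^sub>R (A i o\<^sub>L adj (A i)))"
proof -
  define S where "S = (\<Sum>i\<in>I. \<alpha> i *\<^sub>R (A i o\<^sub>L adj (A i)))"
  show "norm (\<Sum>i\<in>I. \<alpha> i *\<^sub>R (A i o\<^sub>L adj (A i))) \<le> (\<Sum>i\<in>I. \<alpha> i * (norm (A i))\<^sup>2)"
  proof (rule sum_norm_le)
    fix i assume "i \<in> I"
    then show "norm (\<alpha> i *\<^sub>R (A i o\<^sub>L adj (A i))) \<le> \<alpha> i * (norm (A i))\<^sup>2"
      using \<alpha>[of i] norm_blinfun_compose[of "A i" "adj (A i)"] norm_adj[OF A, of i]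
      by (simp add: power2_eq_square mult_left_mono)
  qed
  assume k: "k \<in> I"
  show "\<alpha> k * (norm (A k))\<^sup>2 \<le> norm (\<Sum>i\<in>I. \<alpha> i *\<^sub>R (A i o\<^sub>L adj (A i)))"
  proof (cases "\<alpha> k = 0")
    case False
    then have \<alpha>k: "\<alpha> k > 0" using \<alpha>[OF k] by simp
    have quad: "\<alpha> k * (norm (blinfun_apply (adj (A k)) x))\<^sup>2 \<le> norm S * (norm x)\<^sup>2" for x
    proof -
      have "\<alpha> k * (norm (blinfun_apply (adj (A k)) x))\<^sup>2 \<le> (\<Sum>i\<in>I. \<alpha> i * (norm (blinfun_apply (adj (A i)) x))\<^sup>2)"
        using \<open>finite I\<close> k \<alpha> by (intro member_le_sum) auto
      also have "\<dots> = (\<Sum>i\<in>I. Re (cinner (\<alpha> i *\<^sub>R blinfun_apply (A i) (blinfun_apply (adj (A i)) x)) x))"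
        by (intro sum.cong refl) (simp add: cinner_scaleR_left cinner_adj[OF A] cinner_self)
      also have "\<dots> = Re (cinner (blinfun_apply S x) x)"
      proof -
        have "Re (cinner (\<Sum>i\<in>J. f i) x) = (\<Sum>i\<in>J. Re (cinner (f i) x))" for J :: "'i set" and f
          by (induction J rule: infinite_finite_induct) (auto simp: cinner_add_left)
        then show ?thesis by (simp add: S_def blinfun.sum_left blinfun.scaleR_left)
      qed
      also have "\<dots> \<le> norm (blinfun_apply S x) * norm x" by (rule Re_cinner_le)
      also have "\<dots> \<le> (norm S * norm x) * norm x" by (intro mult_right_mono norm_blinfun) auto
      finally show ?thesis by (simp add: power2_eq_square mult_ac)
    qed
    have "norm (adj (A k)) \<le> sqrt (norm S / \<alpha> k)"
    proof (rule norm_blinfun_bound)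
      fix x
      have "(norm (blinfun_apply (adj (A k)) x))\<^sup>2 \<le> (norm S / \<alpha> k) * (norm x)\<^sup>2"
        using quad[of x] \<alpha>k by (simp add: field_simps)
      then have "norm (blinfun_apply (adj (A k)) x) \<le> sqrt ((norm S / \<alpha> k) * (norm x)\<^sup>2)"
        by (rule real_le_rsqrt)
      then show "norm (blinfun_apply (adj (A k)) x) \<le> sqrt (norm S / \<alpha> k) * norm x"
        by (simp only: real_sqrt_mult real_sqrt_abs abs_norm_cancel)
    qed (use \<alpha>k in simp)
    then have "(norm (A k))\<^sup>2 \<le> (sqrt (norm S / \<alpha> k))\<^sup>2"
      unfolding norm_adj[OF A[OF k]] by (intro power_mono) auto
    then show ?thesis using \<alpha>k by (simp add: S_def field_simps)
  qed simp
qed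

lemma scaleC_compose_left: "(c *\<^sub>C A) o\<^sub>L B = c *\<^sub>C (A o\<^sub>L B)"
  by (rule blinfun_eqI) (simp add: scaleC_blinfun_apply)

lemma scaleC_compose_right: "A \<in> bounded_operators \<Longrightarrow> A o\<^sub>L (c *\<^sub>C B) = c *\<^sub>C (A o\<^sub>L B)"
  by (rule blinfun_eqI) (simp add: scaleC_blinfun_apply bounded_operatorsD)

text \<open>The operator form of the identity behind the Cauchy-Schwarz inequality:
  \<open>T i j o\<^sub>L adj (T i j)\<close> expands to two diagonal and two mixed terms, and the
  mixed ones sum up to \<open>R o\<^sub>L adj R\<close>. The factors 2 arise because both
  \<open>(i, j)\<close> and \<open>(j, i)\<close> are counted. Complex linearity of \<open>D\<close>
  lets scalars pass through a composition.\<close>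

lemma lagrange_identity:
  fixes D :: "'d :: finite \<Rightarrow> ('h :: complex_hilbert_space \<Rightarrow>\<^sub>L 'h)" and u :: "'d \<Rightarrow> complex"
  assumes D: "\<And>i. D i \<in> bounded_operators"
  defines "R \<equiv> \<Sum>k\<in>UNIV. u k *\<^sub>C D k" and "T i j \<equiv> cnj (u i) *\<^sub>C D j - cnj (u j) *\<^sub>C D i"
  shows "R o\<^sub>L adj R = (\<Sum>j\<in>UNIV. \<Sum>i\<in>UNIV. (u j * cnj (u i)) *\<^sub>C (D j o\<^sub>L adj (D i)))"
    and "(\<Sum>i\<in>UNIV. \<Sum>j\<in>UNIV. T i j o\<^sub>L adj (T i j)) =
       (2 * (\<Sum>i\<in>UNIV. (cmod (u i))\<^sup>2)) *\<^sub>R (\<Sum>i\<in>UNIV. D i o\<^sub>L adj (D i)) - 2 *\<^sub>R (R o\<^sub>L adj R)"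
proof -
  define M where "M i j = D i o\<^sub>L adj (D j)" for i j
  have adjR: "adj R = (\<Sum>k\<in>UNIV. cnj (u k) *\<^sub>C adj (D k))"
    unfolding R_def by (simp add: adj_sum adj_scaleC D bounded_operators_scaleC)
  show RR: "R o\<^sub>L adj R = (\<Sum>j\<in>UNIV. \<Sum>i\<in>UNIV. (u j * cnj (u i)) *\<^sub>C (D j o\<^sub>L adj (D i)))"
    unfolding adjR unfolding R_def
    by (simp add: bounded_bilinear.sum_left[OF bounded_bilinear_blinfun_compose]
        bounded_bilinear.sum_right[OF bounded_bilinear_blinfun_compose] scaleC_compose_left
        scaleC_compose_right D) (rule sum.swap)
  have TT: "T i j o\<^sub>L adj (T i j) = (cmod (u i))\<^sup>2 *\<^sub>R M j j - (u j * cnj (u i)) *\<^sub>C M j i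
      - (u i * cnj (u j)) *\<^sub>C M i j + (cmod (u j))\<^sup>2 *\<^sub>R M i i" for i j
  proof -
    have adjT: "adj (T i j) = u i *\<^sub>C adj (D j) - u j *\<^sub>C adj (D i)"
      unfolding T_def by (simp add: adj_diff adj_scaleC D bounded_operators_scaleC)
    have sq: "(cmod (u k))\<^sup>2 *\<^sub>R X = (cnj (u k) * u k) *\<^sub>C X" for k and X :: "'h \<Rightarrow>\<^sub>L 'h"
      unfolding scaleR_scaleC complex_norm_square by (simp only: mult.commute)
    show ?thesis
      unfolding adjT sq unfolding T_def M_def
      by (simp add: bounded_bilinear.diff_left[OF bounded_bilinear_blinfun_compose]
        bounded_bilinear.diff_right[OF bounded_bilinear_blinfun_compose] scaleC_compose_left
        scaleC_compose_right D scaleC.scale_right_diff_distrib mult.commute algebra_simps)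
  qed
  define N where "N = (\<Sum>i\<in>UNIV. (cmod (u i))\<^sup>2)"
  have s1: "(\<Sum>i\<in>UNIV. \<Sum>j\<in>UNIV. (cmod (u i))\<^sup>2 *\<^sub>R M j j) = N *\<^sub>R (\<Sum>i\<in>UNIV. M i i)"
    by (simp add: N_def scaleR_sum_left scaleR_sum_right) (rule sum.swap)
  have s2: "(\<Sum>i\<in>UNIV. \<Sum>j\<in>UNIV. (cmod (u j))\<^sup>2 *\<^sub>R M i i) = N *\<^sub>R (\<Sum>i\<in>UNIV. M i i)"
    by (simp add: N_def scaleR_sum_left scaleR_sum_right)
  have s3: "(\<Sum>i\<in>UNIV. \<Sum>j\<in>UNIV. (u j * cnj (u i)) *\<^sub>C M j i) = R o\<^sub>L adj R"
    unfolding RR M_def by (rule sum.swap)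
  have s4: "(\<Sum>i\<in>UNIV. \<Sum>j\<in>UNIV. (u i * cnj (u j)) *\<^sub>C M i j) = R o\<^sub>L adj R"
    unfolding RR M_def ..
  have "(\<Sum>i\<in>UNIV. \<Sum>j\<in>UNIV. T i j o\<^sub>L adj (T i j)) = 
     N *\<^sub>R (\<Sum>i\<in>UNIV. M i i) - (R o\<^sub>L adj R) - (R o\<^sub>L adj R) + N *\<^sub>R (\<Sum>i\<in>UNIV. M i i)"
    unfolding TT sum.distrib sum_subtractf s1 s2 s3 s4 ..
  then show "(\<Sum>i\<in>UNIV. \<Sum>j\<in>UNIV. T i j o\<^sub>L adj (T i j)) =
       (2 * (\<Sum>i\<in>UNIV. (cmod (u i))\<^sup>2)) *\<^sub>R (\<Sum>i\<in>UNIV. D i o\<^sub>L adj (D i)) - 2 *\<^sub>R (R o\<^sub>L adj R)"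
    by (simp add: M_def N_def scaleR_2 flip: scaleR_scaleR)
qed

subsection \<open>Wirtinger derivatives and the Bergman matrix\<close>

lemma dir_deriv_eq:
  assumes "(f has_derivative D) (at z)"
  shows "dir_deriv v f z = D v"
proof -
  interpret D: bounded_linear D using assms by (rule has_derivative_bounded_linear)
  have "((\<lambda>t::real. f (z + t *\<^sub>R v)) has_derivative (\<lambda>t. D (t *\<^sub>R v))) (at 0)"
  proof (rule has_derivative_compose[of "\<lambda>t. z + t *\<^sub>R v" "\<lambda>t. t *\<^sub>R v" 0 UNIV f D])
    show "((\<lambda>t. z + t *\<^sub>R v) has_derivative (\<lambda>t. t *\<^sub>R v)) (at 0)"
      by (auto intro!: derivative_eq_intros)
  qed (use assms in simp)
  then have "((\<lambda>t::real. f (z + t *\<^sub>R v)) has_vector_derivative D v) (at 0)"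
    by (simp add: has_vector_derivative_def D.scaleR)
  then show ?thesis unfolding dir_deriv_def by (rule vector_derivative_at)
qed

lemma dz_eq:
  assumes "(f has_derivative D) (at z)"
  shows "dz k f z = (1 / 2) *\<^sub>R (D (axis k 1) - \<i> *\<^sub>C D (axis k \<i>))"
    and "dzbar k f z = (1 / 2) *\<^sub>R (D (axis k 1) + \<i> *\<^sub>C D (axis k \<i>))"
  by (simp_all add: dz_def dzbar_def dir_deriv_eq[OF assms])

lemma axis_ii: "axis k \<i> = \<i> *s axis k (1 :: complex)"
  by (simp add: vec_eq_iff axis_def)

lemma dz_entire:
  assumes D: "(f has_derivative D) (at z)" and lin: "\<And>c v. D (c *s v) = c *\<^sub>C D v"
  shows "dz k f z = D (axis k 1)"
proof -
  have "\<i> *\<^sub>C \<i> *\<^sub>C D (axis k 1) = - D (axis k 1)"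
    using scaleC.scale_minus_left[of 1 "D (axis k 1)"] by (simp add: scaleC_scaleC scaleC_one)
  then show ?thesis
    unfolding dz_eq(1)[OF D] axis_ii lin by (simp add: scaleR_2[symmetric])
qed

text \<open>The type contains all bounded real-linear maps; the complex-linear ones are the common
  kernel of the bounded linear maps \<open>l\<close>. Each \<open>l\<close> vanishes along
  \<open>T\<close>, hence on its derivative.\<close>

lemma dz_bounded_operators:
  assumes T: "T \<in> holomorphic_operator_functions"
  shows "dz k T z \<in> bounded_operators"
proof -
  obtain D where D: "(T has_derivative D) (at z)" "\<And>c v. D (c *s v) = c *\<^sub>C D v"
    using T unfolding holomorphic_operator_functions_def entire_def by blast
  have TB: "T w \<in> bounded_operators" for w using T by (simp add: holomorphic_operator_functions_def)
  have "D v \<in> bounded_operators" for v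
    unfolding bounded_operators_def mem_Collect_eq
  proof (intro allI)
    fix c x
    define l where "l = (\<lambda>E::'b \<Rightarrow>\<^sub>L 'b. blinfun_apply E (c *\<^sub>C x) - c *\<^sub>C blinfun_apply E x)"
    have l: "bounded_linear l"
      unfolding l_def
      by (intro bounded_linear_sub blinfun.bounded_linear_left bounded_linear_compose[OF bounded_linear_scaleC])
    have "((\<lambda>w. l (T w)) has_derivative (\<lambda>v. l (D v))) (at z)"
      by (rule bounded_linear.has_derivative[OF l D(1)])
    moreover have "(\<lambda>w. l (T w)) = (\<lambda>w. 0)" using TB by (simp add: l_def bounded_operatorsD)
    ultimately have "(\<lambda>v. l (D v)) = (\<lambda>v. 0)"
      using has_derivative_unique has_derivative_const by metis
    then have "l (D v) = 0" by meson
    then show "blinfun_apply (D v) (c *\<^sub>C x) = c *\<^sub>C blinfun_apply (D v) x" by (simp add: l_def)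
  qed
  then show ?thesis unfolding dz_entire[OF D] .
qed

lemma norm_square_vec: "(norm (z :: complex ^ 'd))\<^sup>2 = (\<Sum>i\<in>UNIV. (cmod (z $ i))\<^sup>2)"
  by (simp add: norm_vec_def L2_set_def sum_nonneg)

lemma norm_square_vec_complex:
  "complex_of_real ((norm (z :: complex ^ 'd))\<^sup>2) = (\<Sum>i\<in>UNIV. cnj (z $ i) * z $ i)"
  unfolding norm_square_vec of_real_sum complex_norm_square by (simp add: mult.commute)

lemma has_derivative_norm_square:
  "((\<lambda>u. (norm u)\<^sup>2) has_derivative (\<lambda>v. 2 * (z \<bullet> v))) (at (z :: 'a :: real_inner))"
  unfolding power2_norm_eq_inner by (auto intro!: derivative_eq_intros simp: inner_commute)

lemma has_derivative_radial:
  fixes z :: "complex ^ 'd"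
  assumes "(G has_real_derivative G') (at ((norm z)\<^sup>2))"
  shows "((\<lambda>u. complex_of_real (G ((norm u)\<^sup>2))) has_derivative
     (\<lambda>v. complex_of_real (G' * (2 * (z \<bullet> v))))) (at z)"
proof -
  have "(G has_derivative (\<lambda>h. G' * h)) (at ((norm z)\<^sup>2))"
    using assms by (simp add: has_field_derivative_def)
  from has_derivative_compose[OF has_derivative_norm_square this]
  show ?thesis by (rule has_derivative_of_real)
qed

lemma inner_axis_complex: "(z :: complex ^ 'd) \<bullet> axis k 1 = Re (z $ k)" "z \<bullet> axis k \<i> = Im (z $ k)"
  by (simp_all add: inner_axis inner_complex_def)

lemma dz_radial:
  fixes z :: "complex ^ 'd"
  assumes "(G has_real_derivative G') (at ((norm z)\<^sup>2))"
  shows "dz k (\<lambda>u. complex_of_real (G ((norm u)\<^sup>2))) z = complex_of_real G' * cnj (z $ k)"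
  unfolding dz_eq(1)[OF has_derivative_radial[OF assms]]
  by (simp add: inner_axis_complex scaleC_complex_def complex_eq_iff scaleR_conv_of_real)

text \<open>As a matrix in \<open>j\<close> and \<open>k\<close> this is a multiple of the identity
  plus a rank one term with \<open>z\<close> as an eigenvector, which is what makes the Bergman
  matrix invertible in closed form.\<close>

lemma dzbar_dz_radial:
  fixes z :: "complex ^ 'd"
  assumes G: "\<And>x. x \<ge> 0 \<Longrightarrow> (G has_real_derivative G1 x) (at x)"
    and G1: "\<And>x. x \<ge> 0 \<Longrightarrow> (G1 has_real_derivative G2 x) (at x)"
  shows "dzbar j (dz k (\<lambda>u. complex_of_real (G ((norm u)\<^sup>2)))) z =
    complex_of_real (G2 ((norm z)\<^sup>2)) * (z $ j * cnj (z $ k)) +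
    (if j = k then complex_of_real (G1 ((norm z)\<^sup>2)) else 0)"
proof -
  have eq: "dz k (\<lambda>u. complex_of_real (G ((norm u)\<^sup>2))) = (\<lambda>u. complex_of_real (G1 ((norm u)\<^sup>2)) * cnj (u $ k))"
    using dz_radial[OF G] by (intro ext) simp
  have "bounded_linear (\<lambda>v. cnj ((v :: complex ^ 'd) $ k))"
    by (intro bounded_linear_compose[OF bounded_linear_cnj] bounded_linear_vec_nth)
  then have nth: "((\<lambda>v. cnj ((v :: complex ^ 'd) $ k)) has_derivative (\<lambda>v. cnj (v $ k))) (at z)"
    by (rule bounded_linear_imp_has_derivative)
  have ax: "axis j c $ k = (if j = k then c else 0)" for c :: complex
    by (simp add: axis_def)
  show ?thesis
    unfolding eq dz_eq(2)[OF has_derivative_mult[OF has_derivative_radial[OF G1[OF zero_le_power2]] nth]]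
    by (simp add: inner_axis_complex scaleC_complex_def ax complex_eq_iff scaleR_conv_of_real algebra_simps)
qed

section \<open>The inverse Bergman matrix and the operator Q\<close>

lemma matrix_inv_eqI:
  fixes A B :: "complex ^ 'd ^ 'd"
  assumes "A ** B = mat 1"
  shows "matrix_inv A = B"
proof -
  have BA: "B ** A = mat 1" using assms by (simp add: matrix_left_right_inverse)
  have "A ** matrix_inv A = mat 1 \<and> matrix_inv A ** A = mat 1"
    unfolding matrix_inv_def by (rule someI[of _ B]) (use assms BA in auto)
  then have "B ** (A ** matrix_inv A) = B" by (simp add: matrix_mul_rid)
  then show ?thesis by (simp add: matrix_mul_assoc BA matrix_mul_lid)
qed

text \<open>The Sherman-Morrison formula; the denominator is the eigenvalue in the direction of
  \<open>u\<close>.\<close>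

lemma rank_one_perturbation_inverse:
  fixes u :: "complex ^ 'd" and l m :: complex
  assumes l: "l \<noteq> 0" and g: "l + (\<Sum>i\<in>UNIV. cnj (u $ i) * u $ i) * m \<noteq> 0"
  shows "matrix_inv (\<chi> j k. m * (u $ j * cnj (u $ k)) + (if j = k then l else 0)) =
     (\<chi> i j. ((if i = j then 1 else 0) - m / (l + (\<Sum>i\<in>UNIV. cnj (u $ i) * u $ i) * m) * (u $ i * cnj (u $ j))) / l)"
proof (rule matrix_inv_eqI)
  define N where "N = (\<Sum>i\<in>UNIV. cnj (u $ i) * u $ i)"
  define c where "c = m / (l + N * m)"
  have "(\<Sum>k\<in>UNIV. (m * (u $ i * cnj (u $ k)) + (if i = k then l else 0)) *
        (((if k = j then 1 else 0) - c * (u $ k * cnj (u $ j))) / l)) = (if i = j then 1 else 0)" for i j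
  proof -
    \<comment> \<open>Each piece is either supported at one index or a fixed multiple of a summand
      of \<open>N\<close>, so the sum over \<open>k\<close> is immediate.\<close>
    have t: "(m * (u $ i * cnj (u $ k)) + (if i = k then l else 0)) *
        (((if k = j then 1 else 0) - c * (u $ k * cnj (u $ j))) / l) =
      (if k = j then m / l * (u $ i * cnj (u $ j)) else 0) - m * c / l * (u $ i * cnj (u $ j)) * (cnj (u $ k) * u $ k)
       + (if k = i then (if i = j then 1 else 0) - c * (u $ i * cnj (u $ j)) else 0)" for k
      using l by (auto simp: field_simps)
    have "(\<Sum>k\<in>UNIV. (m * (u $ i * cnj (u $ k)) + (if i = k then l else 0)) *
        (((if k = j then 1 else 0) - c * (u $ k * cnj (u $ j))) / l)) =
      m / l * (u $ i * cnj (u $ j)) - m * c / l * (u $ i * cnj (u $ j)) * N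
       + ((if i = j then 1 else 0) - c * (u $ i * cnj (u $ j)))"
      unfolding t by (simp add: sum.distrib sum_subtractf N_def sum_distrib_left)
    also have "\<dots> = (if i = j then 1 else 0) + (m / l - m * c / l * N - c) * (u $ i * cnj (u $ j))"
      by (simp add: algebra_simps)
    also have "m / l - m * c / l * N - c = 0"
    proof -
      define G where "G = l + N * m"
      have G: "G \<noteq> 0" "l = G - N * m" using g by (auto simp: G_def N_def)
      have "m / l - m * (m / G) / l * N - m / G = m * ((G - N * m) - l) / (G * l)"
        using G(1) l by (simp add: field_simps)
      then show ?thesis using G(2) unfolding c_def G_def[symmetric] by simp
    qed
    finally show ?thesis by simp
  qed
  then show "(\<chi> j k. m * (u $ j * cnj (u $ k)) + (if j = k then l else 0)) **
     (\<chi> i j. ((if i = j then 1 else 0) - m / (l + (\<Sum>i\<in>UNIV. cnj (u $ i) * u $ i) * m) * (u $ i * cnj (u $ j))) / l) = mat 1"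
    unfolding matrix_matrix_mult_def mat_def N_def[symmetric] c_def[symmetric] by (simp add: vec_eq_iff)
qed

text \<open>By the inverse matrix, \<open>Q\<close> is \<open>1 / l\<close> times the sum
  \<open>S\<close> of all \<open>D i o\<^sub>L adj (D i)\<close> minus \<open>c / l\<close> times
  \<open>R o\<^sub>L adj R\<close>. After multiplication by the squared norm of \<open>z\<close>,
  the Lagrange identity trades \<open>S\<close> for the tangential sum and another multiple of
  \<open>R o\<^sub>L adj R\<close>; the total coefficient of the latter collapses to the inverse of
  the radial eigenvalue.\<close>

lemma Q_decomposition:
  fixes T :: "complex ^ 'd \<Rightarrow> ('h :: complex_hilbert_space \<Rightarrow>\<^sub>L 'h)" and z :: "complex ^ 'd" and l m :: real
  assumes T: "T \<in> holomorphic_operator_functions"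
    and B: "bergman_matrix \<Psi> z = (\<chi> j k. complex_of_real m * (z $ j * cnj (z $ k)) + (if j = k then complex_of_real l else 0))"
    and l: "l > 0" and g: "l + (norm z)\<^sup>2 * m > 0"
  shows "(norm z)\<^sup>2 *\<^sub>R Q \<Psi> T z =
    (1 / (l + (norm z)\<^sup>2 * m)) *\<^sub>R (radial_deriv T z o\<^sub>L adj (radial_deriv T z)) +
    (1 / (2 * l)) *\<^sub>R (\<Sum>i\<in>UNIV. \<Sum>j\<in>UNIV. tangential_deriv i j T z o\<^sub>L adj (tangential_deriv i j T z))"
proof -
  define D where "D i = dz i T z" for i
  have D: "D i \<in> bounded_operators" for i using dz_bounded_operators[OF T] by (simp add: D_def)
  define x where "x = (norm z)\<^sup>2"
  define R where "R = radial_deriv T z"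
  have R: "R = (\<Sum>k\<in>UNIV. z $ k *\<^sub>C D k)" by (simp add: R_def D_def radial_deriv_def)
  define c where "c = m / (l + x * m)"
  define S where "S = (\<Sum>i\<in>UNIV. D i o\<^sub>L adj (D i))"
  have tang: "tangential_deriv i j T z = cnj (z $ i) *\<^sub>C D j - cnj (z $ j) *\<^sub>C D i" for i j
    by (simp add: tangential_deriv_def D_def)
  have xc: "(\<Sum>i\<in>UNIV. cnj (z $ i) * z $ i) = complex_of_real x" 
    unfolding x_def norm_square_vec_complex ..
  have nz: "complex_of_real l + complex_of_real x * complex_of_real m \<noteq> 0"
    using g unfolding x_def[symmetric] by (metis of_real_add of_real_mult of_real_eq_0_iff less_irrefl)
  have inv: "matrix_inv (bergman_matrix \<Psi> z) $ i $ j =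
      ((if i = j then 1 else 0) - complex_of_real c * (z $ i * cnj (z $ j))) / complex_of_real l" for i j
    unfolding B using rank_one_perturbation_inverse[of "complex_of_real l" z "complex_of_real m"] l nz
    by (simp add: xc c_def)
  \<comment> \<open>Conjugation transposes the Hermitian inverse, which matches the order of the
    factors in \<open>D j o\<^sub>L adj (D i)\<close>.\<close>
  have cn: "cnj (matrix_inv (bergman_matrix \<Psi> z) $ i $ j) =
      (if j = i then complex_of_real (1 / l) else 0) - complex_of_real (c / l) * (z $ j * cnj (z $ i))" for i j
    unfolding inv using l by (simp add: field_simps)
  have "Q \<Psi> T z = (\<Sum>i\<in>UNIV. \<Sum>j\<in>UNIV. 
      (if j = i then complex_of_real (1 / l) *\<^sub>C (D j o\<^sub>L adj (D i)) else 0) -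
      complex_of_real (c / l) *\<^sub>C (z $ j * cnj (z $ i)) *\<^sub>C (D j o\<^sub>L adj (D i)))"
    unfolding Q_def cn D_def[symmetric] scaleC.scale_left_diff_distrib
    by (intro sum.cong refl) (simp add: scaleC_scaleC)
  also have "\<dots> = (1 / l) *\<^sub>R S - (c / l) *\<^sub>R (R o\<^sub>L adj R)"
  proof -
    have "(\<Sum>i\<in>UNIV. \<Sum>j\<in>UNIV. complex_of_real (c / l) *\<^sub>C (z $ j * cnj (z $ i)) *\<^sub>C (D j o\<^sub>L adj (D i)))
      = complex_of_real (c / l) *\<^sub>C (R o\<^sub>L adj R)"
      unfolding lagrange_identity(1)[of D "\<lambda>i. z $ i", OF D, folded R] scaleC.scale_sum_right
      by (rule sum.swap)
    then show ?thesis
      by (simp add: sum_subtractf S_def scaleR_scaleC scaleC.scale_sum_right)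
  qed
  finally have Qe: "Q \<Psi> T z = (1 / l) *\<^sub>R S - (c / l) *\<^sub>R (R o\<^sub>L adj R)" .
  have lag: "(\<Sum>i\<in>UNIV. \<Sum>j\<in>UNIV. tangential_deriv i j T z o\<^sub>L adj (tangential_deriv i j T z)) =
      (2 * x) *\<^sub>R S - 2 *\<^sub>R (R o\<^sub>L adj R)"
    unfolding tang S_def R x_def norm_square_vec by (rule lagrange_identity(2)[of D "\<lambda>i. z $ i", OF D])
  have coeff: "1 / (l + x * m) = 1 / l - x * (c / l)"
  proof -
    define G where "G = l + x * m"
    have G: "G > 0" "l = G - x * m" using g by (auto simp: G_def x_def)
    have "1 / l - x * (m / G / l) = (G - x * m) / (G * l)" using G(1) l by (simp add: field_simps)
    then show ?thesis using G l unfolding c_def G_def[symmetric] by simp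
  qed
  show ?thesis
    unfolding lag Qe x_def[symmetric] R_def[symmetric] coeff using l
    by (simp add: scaleR_diff_right scaleR_diff_left)
qed

lemma Q_bounds:
  fixes T :: "complex ^ 'd \<Rightarrow> ('h :: complex_hilbert_space \<Rightarrow>\<^sub>L 'h)" and z :: "complex ^ 'd" and l m :: real
  assumes T: "T \<in> holomorphic_operator_functions"
    and B: "bergman_matrix \<Psi> z = (\<chi> j k. complex_of_real m * (z $ j * cnj (z $ k)) + (if j = k then complex_of_real l else 0))"
    and l: "l > 0" and g: "g = l + (norm z)\<^sup>2 * m" "g > 0"
  shows "(norm z)\<^sup>2 * norm (Q \<Psi> T z) \<le> (norm (radial_deriv T z))\<^sup>2 / g +
      (\<Sum>i\<in>UNIV. \<Sum>j\<in>UNIV. (norm (tangential_deriv i j T z))\<^sup>2) / (2 * l)"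
    and "(norm (radial_deriv T z))\<^sup>2 / g \<le> (norm z)\<^sup>2 * norm (Q \<Psi> T z)"
    and "(norm (tangential_deriv i j T z))\<^sup>2 / (2 * l) \<le> (norm z)\<^sup>2 * norm (Q \<Psi> T z)"
proof -
  \<comment> \<open>Radial and tangential derivatives are indexed by one type, \<open>None\<close>
    for the radial one, so that the bounds for sums of positive operators treat them
    together.\<close>
  define A where "A = case_option (radial_deriv T z) (\<lambda>(i, j). tangential_deriv i j T z)"
  define \<alpha> where "\<alpha> = case_option (1 / g) (\<lambda>_::'d\<times>'d. 1 / (2 * l))"
  have bo: "radial_deriv T z \<in> bounded_operators" "tangential_deriv i j T z \<in> bounded_operators" for i j
    unfolding radial_deriv_def tangential_deriv_def
    by (intro bounded_operators_sum bounded_operators_scaleC bounded_operators_diff dz_bounded_operators[OF T])+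
  have A: "A i \<in> bounded_operators" for i using bo by (cases i) (auto simp: A_def)
  have \<alpha>: "\<alpha> i \<ge> 0" for i using l g by (cases i) (auto simp: \<alpha>_def)
  have sum_opt: "(\<Sum>i\<in>UNIV. f i) = f None + (\<Sum>i\<in>UNIV. \<Sum>j\<in>UNIV. f (Some (i, j)))"
    for f :: "('d \<times> 'd) option \<Rightarrow> 'b :: ab_group_add"
    by (simp add: UNIV_option_conv sum.reindex sum.cartesian_product)
  have Qe: "(norm z)\<^sup>2 *\<^sub>R Q \<Psi> T z = (\<Sum>i\<in>UNIV. \<alpha> i *\<^sub>R (A i o\<^sub>L adj (A i)))"
    unfolding sum_opt using Q_decomposition[OF T B l] g by (simp add: A_def \<alpha>_def scaleR_sum_right)
  have nQ: "(norm z)\<^sup>2 * norm (Q \<Psi> T z) = norm (\<Sum>i\<in>UNIV. \<alpha> i *\<^sub>R (A i o\<^sub>L adj (A i)))"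
    unfolding Qe[symmetric] by simp
  note nb = norm_square_sum_bounds[of UNIV A \<alpha>, OF finite A \<alpha>]
  show "(norm z)\<^sup>2 * norm (Q \<Psi> T z) \<le> (norm (radial_deriv T z))\<^sup>2 / g +
      (\<Sum>i\<in>UNIV. \<Sum>j\<in>UNIV. (norm (tangential_deriv i j T z))\<^sup>2) / (2 * l)"
    using nb(1) unfolding nQ sum_opt by (simp add: A_def \<alpha>_def sum_divide_distrib)
  show "(norm (radial_deriv T z))\<^sup>2 / g \<le> (norm z)\<^sup>2 * norm (Q \<Psi> T z)"
    using nb(2)[of None] unfolding nQ by (simp add: A_def \<alpha>_def)
  show "(norm (tangential_deriv i j T z))\<^sup>2 / (2 * l) \<le> (norm z)\<^sup>2 * norm (Q \<Psi> T z)"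
    using nb(2)[of "Some (i, j)"] unfolding nQ by (simp add: A_def \<alpha>_def)
qed

subsection \<open>Isometries and circle actions\<close>

lemma nn_integral_lborel_translate:
  fixes f :: "'a::euclidean_space \<Rightarrow> ennreal"
  assumes [measurable]: "f \<in> borel_measurable borel"
  shows "(\<integral>\<^sup>+x. f (a + x) \<partial>lborel) = (\<integral>\<^sup>+x. f x \<partial>lborel)"
proof -
  have "(\<integral>\<^sup>+x. f x \<partial>lborel) = (\<integral>\<^sup>+x. f x \<partial>distr lborel borel ((+) a))" by (simp add: lborel_distr_plus)
  also have "\<dots> = (\<integral>\<^sup>+x. f (a + x) \<partial>lborel)" by (rule nn_integral_distr) auto
  finally show ?thesis ..
qed

text \<open>The push-forward of Lebesgue measure is translation invariant, hence a multiple of it by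
  Fubini, and it gives the unit ball the same mass.\<close>

lemma lborel_distr_isometry:
  fixes R R' :: "'a::euclidean_space \<Rightarrow> 'a"
  assumes R: "linear R" and norm: "\<And>x. norm (R x) = norm x" and inv: "\<And>x. R (R' x) = x"
  shows "distr lborel borel R = lborel"
proof (rule measure_eqI)
  interpret R: linear R by fact
  have cont: "continuous_on UNIV R" using R by (simp add: linear_continuous_on linear_conv_bounded_linear)
  then have [measurable]: "R \<in> borel_measurable borel" by (rule borel_measurable_continuous_onI)
  fix A assume "A \<in> sets (distr lborel borel R)"
  then have [measurable]: "A \<in> sets borel" by simp
  define B where "B = ball (0::'a) 1"
  have [measurable]: "B \<in> sets borel" by (simp add: B_def)
  have B: "R y \<in> B \<longleftrightarrow> y \<in> B" for y by (simp add: B_def norm)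
  have "emeasure lborel A * emeasure lborel B = (\<integral>\<^sup>+y. \<integral>\<^sup>+x. indicator A x * indicator B (R y) \<partial>lborel \<partial>lborel)"
  proof -
    have "(\<integral>\<^sup>+x. indicator A x * indicator B (R y) \<partial>lborel) = emeasure lborel A * indicator B y" for y
      by (subst nn_integral_multc) (auto simp: indicator_def B)
    then show ?thesis by (simp add: nn_integral_cmult_indicator)
  qed
  also have "\<dots> = (\<integral>\<^sup>+y. \<integral>\<^sup>+x. indicator A (R y + x) * indicator B (R y) \<partial>lborel \<partial>lborel)"
    by (intro nn_integral_cong nn_integral_lborel_translate[symmetric]) measurable
  also have "\<dots> = (\<integral>\<^sup>+x. \<integral>\<^sup>+y. indicator A (R y + x) * indicator B (R y) \<partial>lborel \<partial>lborel)"
    by (rule lborel_pair.Fubini') measurable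
  also have "\<dots> = (\<integral>\<^sup>+x. \<integral>\<^sup>+y. indicator A (R y) * indicator B (R y - x) \<partial>lborel \<partial>lborel)"
  proof (rule nn_integral_cong)
    fix x
    \<comment> \<open>Translating the inner variable by \<open>- R' x\<close> moves the dependence
      on \<open>x\<close> from \<open>A\<close> to the ball, after which the integral over
      \<open>x\<close> gives the volume of the ball.\<close>
    have "R (- R' x + y) = R y - x" for y using R.add[of "- R' x" y] by (simp add: R.neg inv)
    then show "(\<integral>\<^sup>+y. indicator A (R y + x) * indicator B (R y) \<partial>lborel) = (\<integral>\<^sup>+y. indicator A (R y) * indicator B (R y - x) \<partial>lborel)"
      using nn_integral_lborel_translate[of "\<lambda>y. indicator A (R y + x) * indicator B (R y)" "- R' x"] by simp
  qed
  also have "\<dots> = (\<integral>\<^sup>+y. \<integral>\<^sup>+x. indicator A (R y) * indicator B (R y - x) \<partial>lborel \<partial>lborel)"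
    by (rule lborel_pair.Fubini') measurable
  also have "\<dots> = (\<integral>\<^sup>+y. indicator A (R y) * emeasure lborel B \<partial>lborel)"
  proof (rule nn_integral_cong)
    fix y
    have "(\<integral>\<^sup>+x. indicator A (R y) * indicator B (R y - x) \<partial>lborel) = indicator A (R y) * (\<integral>\<^sup>+x. indicator B (R y - x) \<partial>lborel)"
      by (rule nn_integral_cmult) measurable
    also have "(\<integral>\<^sup>+x. indicator B (R y - x) \<partial>lborel) = (\<integral>\<^sup>+x. indicator B (R y - (R y + x)) \<partial>lborel)"
      by (rule nn_integral_lborel_translate[symmetric]) measurable
    also have "\<dots> = (\<integral>\<^sup>+x. indicator B x \<partial>lborel)" by (simp add: B_def indicator_def)
    finally show "(\<integral>\<^sup>+x. indicator A (R y) * indicator B (R y - x) \<partial>lborel) = indicator A (R y) * emeasure lborel B"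
      by simp
  qed
  also have "\<dots> = emeasure (distr lborel borel R) A * emeasure lborel B"
  proof -
    have "(\<integral>\<^sup>+y. indicator A (R y) \<partial>lborel) = (\<integral>\<^sup>+y. indicator A y \<partial>distr lborel borel R)"
      by (rule nn_integral_distr[symmetric]) auto
    then show ?thesis by (simp add: nn_integral_multc)
  qed
  finally have eq: "emeasure lborel A * emeasure lborel B = emeasure (distr lborel borel R) A * emeasure lborel B" .
  have "emeasure lborel B \<noteq> \<infinity>" unfolding B_def using emeasure_lborel_ball_finite by (simp add: less_top[symmetric])
  moreover have "emeasure lborel B \<noteq> 0"
    using content_ball_pos[of 1 "0::'a"] by (auto simp: B_def measure_def)
  ultimately show "emeasure (distr lborel borel R) A = emeasure lborel A"
    using eq unfolding mult.commute[of _ "emeasure lborel B"] ennreal_mult_cancel_left by auto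
qed simp

lemma continuous_on_radial:
  assumes "continuous_on {0..} \<Psi>"
  shows "continuous_on UNIV (\<lambda>z :: 'a :: real_normed_vector. \<Psi> ((norm z)\<^sup>2))"
  by (rule continuous_on_compose2[OF assms]) (auto intro!: continuous_intros)

lemma radial_measurable:
  assumes "continuous_on {0..} \<Psi>"
  shows "(\<lambda>z :: 'a :: euclidean_space. \<Psi> ((norm z)\<^sup>2)) \<in> borel_measurable borel"
  using continuous_on_radial[OF assms] by (rule borel_measurable_continuous_onI)

lemma sets_fock_measure [measurable_cong]: "sets (fock_measure \<Psi>) = sets borel"
  by (simp add: fock_measure_def)

lemma space_fock_measure [simp]: "space (fock_measure \<Psi>) = UNIV"
  by (simp add: fock_measure_def)

lemma nn_integral_fock_measure:
  assumes "continuous_on {0..} \<Psi>" and [measurable]: "f \<in> borel_measurable borel"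
  shows "(\<integral>\<^sup>+z. f z \<partial>fock_measure \<Psi>) = (\<integral>\<^sup>+z. ennreal (exp (- \<Psi> ((norm z)\<^sup>2))) * f z \<partial>lborel)"
proof -
  note [measurable] = radial_measurable[OF assms(1)]
  show ?thesis unfolding fock_measure_def by (rule nn_integral_density) measurable
qed

lemma fock_measure_isometry:
  fixes R R' :: "complex ^ 'd \<Rightarrow> complex ^ 'd"
  assumes \<Psi>: "continuous_on {0..} \<Psi>"
    and R: "linear R" and norm: "\<And>x. norm (R x) = norm x" and inv: "\<And>x. R (R' x) = x"
  shows "distr (fock_measure \<Psi>) borel R = fock_measure \<Psi>"
proof (rule measure_eqI)
  note [measurable] = radial_measurable[OF \<Psi>]
  have cont: "continuous_on UNIV R" using R by (simp add: linear_continuous_on linear_conv_bounded_linear)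
  then have [measurable]: "R \<in> borel_measurable borel" by (rule borel_measurable_continuous_onI)
  fix A assume "A \<in> sets (distr (fock_measure \<Psi>) borel R)"
  then have A[measurable]: "A \<in> sets borel" by simp
  have "emeasure (distr (fock_measure \<Psi>) borel R) A = (\<integral>\<^sup>+z. indicator A z \<partial>distr (fock_measure \<Psi>) borel R)"
    by simp
  also have "\<dots> = (\<integral>\<^sup>+z. indicator A (R z) \<partial>fock_measure \<Psi>)"
    by (rule nn_integral_distr) measurable
  also have "\<dots> = (\<integral>\<^sup>+z. ennreal (exp (- \<Psi> ((norm (R z))\<^sup>2))) * indicator A (R z) \<partial>lborel)"
    by (subst nn_integral_fock_measure[OF \<Psi>]) (auto simp: norm)
  also have "\<dots> = (\<integral>\<^sup>+z. ennreal (exp (- \<Psi> ((norm z)\<^sup>2))) * indicator A z \<partial>distr lborel borel R)"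
    by (rule nn_integral_distr[symmetric]) measurable
  also have "\<dots> = (\<integral>\<^sup>+z. ennreal (exp (- \<Psi> ((norm z)\<^sup>2))) * indicator A z \<partial>lborel)"
    by (simp add: lborel_distr_isometry[OF R norm inv])
  also have "\<dots> = emeasure (fock_measure \<Psi>) A"
    using nn_integral_fock_measure[OF \<Psi>, of "indicator A"] by simp
  finally show "emeasure (distr (fock_measure \<Psi>) borel R) A = emeasure (fock_measure \<Psi>) A" .
qed (simp add: sets_fock_measure)

section \<open>Averages over circle actions\<close>

text \<open>All rotated versions of \<open>F\<close> have the same integral, and Fubini replaces
  \<open>F\<close> by its average along the orbits. The measure \<open>\<nu>\<close> is left with
  mass \<open>2 * pi\<close> to match contour integrals.\<close>

lemma circle_average:
  fixes U :: "real \<Rightarrow> 'a :: euclidean_space \<Rightarrow> 'a" and F :: "'a \<Rightarrow> complex"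
  assumes sM: "sets M = sets borel" and fin: "finite_measure M"
    and inv: "\<And>\<theta>. distr M borel (U \<theta>) = M"
    and U: "continuous_on UNIV (\<lambda>(\<theta>, z). U \<theta> z)" and F: "integrable M F"
  defines "\<nu> \<equiv> density lborel (indicator {0..2*pi})"
  shows "integrable M (\<lambda>z. \<integral>\<theta>. F (U \<theta> z) \<partial>\<nu>)"
    and "(\<integral>z. (\<integral>\<theta>. F (U \<theta> z) \<partial>\<nu>) \<partial>M) = 2 * pi * (\<integral>z. F z \<partial>M)"
proof -
  have spM: "space M = UNIV" using sM by (metis sets_eq_imp_space_eq space_borel)
  note sM[measurable_cong]
  have Fm[measurable]: "F \<in> borel_measurable borel" using F sM by (metis borel_measurable_integrable measurable_cong_sets)
  have Um: "(\<lambda>p. U (fst p) (snd p)) \<in> borel_measurable (borel \<Otimes>\<^sub>M borel)"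
    using borel_measurable_continuous_onI[OF U] by (simp add: borel_prod case_prod_beta')
  have [measurable_cong]: "sets \<nu> = sets borel" by (simp add: \<nu>_def)
  have sp\<nu>: "space \<nu> = UNIV" by (simp add: \<nu>_def)
  have e\<nu>: "emeasure \<nu> UNIV = 2 * pi"
  proof -
    have "emeasure \<nu> UNIV = (\<integral>\<^sup>+x. indicator {0..2*pi} x \<partial>(lborel :: real measure))"
      unfolding \<nu>_def by (simp add: emeasure_density)
    also have "\<dots> = emeasure lborel {0..2*pi}" by (rule nn_integral_indicator) simp
    finally show ?thesis by simp
  qed
  interpret M: finite_measure M by fact
  interpret \<nu>: finite_measure \<nu> by (rule finite_measureI) (simp add: sp\<nu> e\<nu>)
  interpret P: pair_sigma_finite \<nu> M ..
  have [measurable]: "(\<lambda>p. U (fst p) (snd p)) \<in> measurable (\<nu> \<Otimes>\<^sub>M M) borel"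
  proof -
    have "sets (\<nu> \<Otimes>\<^sub>M M) = sets (borel \<Otimes>\<^sub>M borel)"
      by (rule sets_pair_measure_cong) (simp_all add: sM \<nu>_def)
    then show ?thesis using Um measurable_cong_sets by blast
  qed
  have U1[measurable]: "U \<theta> \<in> measurable M borel" for \<theta>
  proof -
    have "continuous_on UNIV (\<lambda>z. (\<lambda>(\<theta>, z). U \<theta> z) (\<theta>, z))"
      by (rule continuous_on_compose2[OF U]) (auto intro!: continuous_intros)
    then show ?thesis using borel_measurable_continuous_onI sM measurable_cong_sets by fastforce
  qed
  have FU: "integrable M (\<lambda>z. F (U \<theta> z))" "(\<integral>z. F (U \<theta> z) \<partial>M) = (\<integral>z. F z \<partial>M)"
     "(\<integral>z. norm (F (U \<theta> z)) \<partial>M) = (\<integral>z. norm (F z) \<partial>M)" for \<theta>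
  proof -
    have "integrable (distr M borel (U \<theta>)) F" using F by (simp add: inv)
    then show "integrable M (\<lambda>z. F (U \<theta> z))" by (rule integrable_distr[OF U1])
    show "(\<integral>z. F (U \<theta> z) \<partial>M) = (\<integral>z. F z \<partial>M)"
      using integral_distr[OF U1, of F \<theta>] by (simp add: inv)
    show "(\<integral>z. norm (F (U \<theta> z)) \<partial>M) = (\<integral>z. norm (F z) \<partial>M)"
      using integral_distr[OF U1, of "\<lambda>z. norm (F z)" \<theta>] by (simp add: inv)
  qed
  have int: "integrable (\<nu> \<Otimes>\<^sub>M M) (\<lambda>(\<theta>, z). F (U \<theta> z))"
  proof (rule P.Fubini_integrable)
    show "(\<lambda>(\<theta>, z). F (U \<theta> z)) \<in> borel_measurable (\<nu> \<Otimes>\<^sub>M M)"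
      unfolding case_prod_beta' by measurable
    show "integrable \<nu> (\<lambda>\<theta>. \<integral>z. norm (case (\<theta>, z) of (\<theta>, z) \<Rightarrow> F (U \<theta> z)) \<partial>M)"
      by (simp add: FU)
  qed (simp add: FU)
  show "integrable M (\<lambda>z. \<integral>\<theta>. F (U \<theta> z) \<partial>\<nu>)"
    using P.integrable_snd[OF int] .
  have "(\<integral>z. (\<integral>\<theta>. F (U \<theta> z) \<partial>\<nu>) \<partial>M) = (\<integral>\<theta>. (\<integral>z. F (U \<theta> z) \<partial>M) \<partial>\<nu>)"
    by (rule P.Fubini_integral[OF int])
  also have "\<dots> = 2 * pi * (\<integral>z. F z \<partial>M)"
    using e\<nu> by (simp add: FU \<nu>_def measure_def scaleR_conv_of_real)
  finally show "(\<integral>z. (\<integral>\<theta>. F (U \<theta> z) \<partial>\<nu>) \<partial>M) = 2 * pi * (\<integral>z. F z \<partial>M)" .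
qed

text \<open>Cauchy's formula for the \<open>n\<close>-th derivative: on the unit circle
  \<open>du / u ^ Suc n\<close> is \<open>\<i> * cis (- (n * \<theta>))\<close> times
  \<open>d\<theta>\<close>.\<close>

lemma circle_fourier_coefficient:
  fixes g :: "complex \<Rightarrow> complex"
  assumes g: "g holomorphic_on UNIV"
  shows "(\<integral>\<theta>. g (cis \<theta>) * cis (- (real n * \<theta>)) \<partial>density lborel (indicator {0..2*pi})) =
    2 * pi * ((deriv ^^ n) g 0 / fact n)"
proof -
  have "((\<lambda>u. g u / (u - 0) ^ (Suc n)) has_contour_integral ((2 * pi * \<i>) / (fact n) * (deriv ^^ n) g 0)) (circlepath 0 1)"
    by (rule Cauchy_has_contour_integral_higher_derivative_circlepath)
       (use g in \<open>auto intro: holomorphic_on_imp_continuous_on holomorphic_on_subset\<close>)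
  then have "((\<lambda>t. g (cis t) / cis t ^ Suc n * \<i> * cis t) has_integral ((2 * pi * \<i>) / (fact n) * (deriv ^^ n) g 0)) {0..2*pi}"
    unfolding circlepath_def by (subst (asm) has_contour_integral_part_circlepath_iff) auto
  then have "((\<lambda>t. (- \<i>) * (g (cis t) / cis t ^ Suc n * \<i> * cis t)) has_integral ((- \<i>) * ((2 * pi * \<i>) / (fact n) * (deriv ^^ n) g 0))) {0..2*pi}"
    by (rule has_integral_mult_right)
  also have "(\<lambda>t. (- \<i>) * (g (cis t) / cis t ^ Suc n * \<i> * cis t)) = (\<lambda>t. g (cis t) * cis (- (real n * t)))"
  proof
    fix t
    have "cis t ^ n = cis (real n * t)" by (rule Complex.DeMoivre)
    then have "cis (- (real n * t)) = 1 / cis t ^ n"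
      by (metis cis_inverse inverse_eq_divide)
    then show "(- \<i>) * (g (cis t) / cis t ^ Suc n * \<i> * cis t) = g (cis t) * cis (- (real n * t))"
      by (simp add: field_simps)
  qed
  also have "(- \<i>) * ((2 * pi * \<i>) / (fact n) * (deriv ^^ n) g 0) = 2 * pi * ((deriv ^^ n) g 0 / fact n)"
    by (simp add: field_simps)
  finally have hi: "((\<lambda>t. g (cis t) * cis (- (real n * t))) has_integral 2 * pi * ((deriv ^^ n) g 0 / fact n)) {0..2*pi}" .
  have cg: "continuous_on UNIV g" using g by (rule holomorphic_on_imp_continuous_on)
  have cont: "continuous_on UNIV (\<lambda>t. g (cis t) * cis (- (real n * t)))"
    by (intro continuous_intros continuous_on_compose2[OF cg]) auto
  have si: "set_integrable lborel {0..2*pi} (\<lambda>t. g (cis t) * cis (- (real n * t)))"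
    by (rule borel_integrable_atLeastAtMost') (use cont continuous_on_subset in blast)
  have "(\<integral>\<theta>. g (cis \<theta>) * cis (- (real n * \<theta>)) \<partial>density lborel (indicator {0..2*pi})) =
      (LINT \<theta>:{0..2*pi}|lborel. g (cis \<theta>) * cis (- (real n * \<theta>)))"
  proof -
    have m: "(\<lambda>t. g (cis t) * cis (- (real n * t))) \<in> borel_measurable lborel"
      using borel_measurable_continuous_onI[OF cont] by simp
    have "(\<integral>\<theta>. g (cis \<theta>) * cis (- (real n * \<theta>)) \<partial>density lborel (\<lambda>x. ennreal (indicator {0..2*pi} x))) =
      (LINT \<theta>|lborel. indicator {0..2*pi} \<theta> *\<^sub>R (g (cis \<theta>) * cis (- (real n * \<theta>))))"
      by (rule integral_density[OF m]) auto
    then show ?thesis unfolding set_lebesgue_integral_def by (simp add: ennreal_indicator)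
  qed
  also have "\<dots> = integral {0..2*pi} (\<lambda>t. g (cis t) * cis (- (real n * t)))"
    by (rule set_borel_integral_eq_integral(2)[OF si])
  also have "\<dots> = 2 * pi * ((deriv ^^ n) g 0 / fact n)" using hi by (rule integral_unique)
  finally show ?thesis .
qed

section \<open>The Hermitian product and rotations around a line\<close>

definition ip :: "complex ^ 'd \<Rightarrow> complex ^ 'd \<Rightarrow> complex" where
  "ip z w = (\<Sum>i\<in>UNIV. z $ i * cnj (w $ i))"

lemma ip_self: "ip z z = complex_of_real ((norm z)\<^sup>2)"
  unfolding norm_square_vec_complex ip_def by (simp add: mult.commute)

lemma ip_add_left: "ip (x + y) w = ip x w + ip y w"
  by (simp add: ip_def algebra_simps sum.distrib)

lemma ip_diff_left: "ip (x - y) w = ip x w - ip y w"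
  by (simp add: ip_def algebra_simps sum_subtractf)

lemma ip_smult_left: "ip (c *s x) w = c * ip x w"
  by (simp add: ip_def sum_distrib_left mult_ac)

lemma ip_smult_right: "ip x (c *s w) = cnj c * ip x w"
  by (simp add: ip_def sum_distrib_left mult_ac)

lemma cnj_ip: "cnj (ip x y) = ip y x"
  by (simp add: ip_def mult.commute)

lemma ip_add_right: "ip w (x + y) = ip w x + ip w y"
  by (metis cnj_ip complex_cnj_add ip_add_left)

lemma smult_scaleR: "r *\<^sub>R (x :: complex ^ 'd) = complex_of_real r *s x"
  unfolding vec_eq_iff vector_scaleR_component vector_smult_component by (simp add: scaleR_conv_of_real)

lemma norm_smult: "norm (c *s (x :: complex ^ 'd)) = cmod c * norm x"
proof (rule power2_eq_imp_eq)
  show "(norm (c *s x))\<^sup>2 = (cmod c * norm x)\<^sup>2"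
    unfolding power_mult_distrib norm_square_vec
    by (simp add: norm_mult power_mult_distrib sum_distrib_left)
qed simp_all

lemma bounded_linear_ip: "bounded_linear (\<lambda>z. ip z w)"
  unfolding ip_def
  by (intro bounded_linear_sum bounded_linear_compose[OF bounded_linear_mult_left] bounded_linear_vec_nth)

lemma continuous_on_ip [continuous_intros]:
  "continuous_on S f \<Longrightarrow> continuous_on S (\<lambda>x. ip (f x) w)"
  by (rule bounded_linear.continuous_on[OF bounded_linear_ip])

lemma ip_measurable [measurable]: "(\<lambda>z. ip z w) \<in> borel_measurable borel"
  by (intro borel_measurable_continuous_onI continuous_intros)

lemma cmod_ip_le: "cmod (ip z w) \<le> norm z * norm w"
proof -
  have "cmod (ip z w) \<le> (\<Sum>i\<in>UNIV. \<bar>cmod (z $ i)\<bar> * \<bar>cmod (w $ i)\<bar>)"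
    unfolding ip_def by (rule sum_norm_le) (simp add: norm_mult)
  also have "\<dots> \<le> L2_set (\<lambda>i. cmod (z $ i)) UNIV * L2_set (\<lambda>i. cmod (w $ i)) UNIV"
    by (rule L2_set_mult_ineq)
  finally show ?thesis by (simp add: norm_vec_def)
qed

lemma continuous_on_smult [continuous_intros]:
  fixes f :: "'a :: topological_space \<Rightarrow> complex" and g :: "'a \<Rightarrow> complex ^ 'd"
  assumes "continuous_on S f" "continuous_on S g"
  shows "continuous_on S (\<lambda>x. f x *s g x)"
  unfolding vector_scalar_mult_def by (intro continuous_intros assms)

lemma entire_line_holomorphic:
  fixes f :: "complex ^ 'd \<Rightarrow> complex"
  assumes "entire f"
  shows "(\<lambda>\<zeta>. f (p + \<zeta> *s q)) holomorphic_on UNIV"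
proof -
  have "(\<lambda>\<zeta>. f (p + \<zeta> *s q)) field_differentiable at \<zeta>" for \<zeta>
  proof -
    obtain D where D: "(f has_derivative D) (at (p + \<zeta> *s q))" "\<And>c v. D (c *s v) = c * D v"
      using assms unfolding entire_def scaleC_complex_def by blast
    have "bounded_linear (\<lambda>\<zeta>. \<zeta> *s q)"
    proof (rule bounded_linear_intro)
      show "norm (x *s q) \<le> norm x * norm q" for x by (simp add: norm_smult)
    qed (simp_all add: vec_eq_iff algebra_simps)
    then have "((\<lambda>\<zeta>. p + \<zeta> *s q) has_derivative (\<lambda>h. h *s q)) (at \<zeta>)"
      by (auto intro!: derivative_eq_intros bounded_linear_imp_has_derivative)
    from has_derivative_compose[OF this D(1)]
    have "((\<lambda>\<zeta>. f (p + \<zeta> *s q)) has_derivative (\<lambda>h. D q * h)) (at \<zeta>)"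
      by (simp add: D(2) mult.commute)
    then have "((\<lambda>\<zeta>. f (p + \<zeta> *s q)) has_field_derivative D q) (at \<zeta>)"
      by (simp add: has_field_derivative_def)
    then show ?thesis by (auto simp: field_differentiable_def)
  qed
  then show ?thesis by (simp add: holomorphic_on_def)
qed

lemma entire_continuous: "entire f \<Longrightarrow> continuous_on UNIV f"
  unfolding entire_def continuous_on_eq_continuous_at[OF open_UNIV]
  by (metis has_derivative_continuous)

text \<open>For a unit vector \<open>w\<close> this is the unitary map that fixes \<open>w\<close>
  and multiplies its orthogonal complement by \<open>cis \<theta>\<close>. By the mean value
  property, averaging an entire function over \<open>\<theta>\<close> leaves its value at the
  projection of \<open>z\<close> to the line through \<open>w\<close>.\<close>

definition rotate_complement :: "complex ^ 'd \<Rightarrow> real \<Rightarrow> complex ^ 'd \<Rightarrow> complex ^ 'd" where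
  "rotate_complement w \<theta> z = (ip z w) *s w + cis \<theta> *s (z - (ip z w) *s w)"

lemma ip_rotate_complement:
  assumes "norm w = 1"
  shows "ip (rotate_complement w \<theta> z) w = ip z w"
  using assms unfolding rotate_complement_def ip_add_left ip_smult_left ip_diff_left
  by (simp add: ip_self)

lemma norm_rotate_complement:
  assumes "norm w = 1"
  shows "norm (rotate_complement w \<theta> z) = norm z"
proof -
  define p where "p = ip z w"
  define y where "y = z - p *s w"
  have ww: "ip w w = 1" using assms by (simp add: ip_self)
  have yw: "ip y w = 0"
    unfolding y_def ip_diff_left ip_smult_left ww by (simp add: p_def)
  have wy: "ip w y = 0" using cnj_ip[of y w] yw by simp
  have exp: "ip (p *s w + c *s y) (p *s w + c *s y) = p * cnj p + c * cnj c * ip y y" for c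
    by (simp add: ip_add_left ip_add_right ip_smult_left ip_smult_right ww yw wy)
  have z: "z = p *s w + 1 *s y" by (simp add: y_def)
  have "complex_of_real ((norm (rotate_complement w \<theta> z))\<^sup>2) = p * cnj p + cis \<theta> * cnj (cis \<theta>) * ip y y"
    unfolding rotate_complement_def p_def[symmetric] y_def[symmetric] ip_self[symmetric] exp ..
  also have "cis \<theta> * cnj (cis \<theta>) = 1" by (simp add: cis_cnj cis_mult)
  also have "p * cnj p + 1 * ip y y = complex_of_real ((norm z)\<^sup>2)"
    using exp[of 1] unfolding z[symmetric] by (simp add: ip_self)
  finally show ?thesis by (simp only: of_real_eq_iff) simp
qed

lemma rotate_complement_inverse:
  assumes "norm w = 1"
  shows "rotate_complement w \<theta> (rotate_complement w (- \<theta>) z) = z"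
proof -
  have "cis \<theta> * cis (- \<theta>) = 1" by (simp add: cis_mult)
  then show ?thesis
    by (simp add: rotate_complement_def[of w \<theta>] ip_rotate_complement[OF assms])
       (simp add: rotate_complement_def vec_eq_iff mult.assoc[symmetric])
qed

lemma linear_rotate_complement: "linear (rotate_complement w \<theta>)"
  by (rule linearI)
     (simp_all add: rotate_complement_def ip_add_left ip_smult_left smult_scaleR vec_eq_iff algebra_simps)

lemma linear_smult: "linear (\<lambda>z :: complex ^ 'd. c *s z)"
  by (rule linearI) (simp_all add: vec_eq_iff algebra_simps)

section \<open>Integrals against powers of the Hermitian product\<close>

definition taylor_coefficient :: "(complex ^ 'd \<Rightarrow> complex) \<Rightarrow> complex ^ 'd \<Rightarrow> nat \<Rightarrow> complex" where
  "taylor_coefficient f w n = (deriv ^^ n) (\<lambda>\<zeta>. f (\<zeta> *s w)) 0 / fact n"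

text \<open>Rotating the complement of \<open>w\<close> does not affect \<open>ip z w\<close> and
  replaces \<open>f z\<close> by the value of \<open>f\<close> at the projection of \<open>z\<close>
  to the line through \<open>w\<close>. Rotating the whole space then selects the term of degree
  \<open>n\<close>, since \<open>cnj (ip z w) ^ n\<close> picks up the phase
  \<open>cis (- (n * \<theta>))\<close>. Both actions preserve the measure.\<close>

lemma integral_against_power:
  fixes f :: "complex ^ 'd \<Rightarrow> complex"
  assumes \<Psi>: "continuous_on {0..} \<Psi>" and fin: "finite_measure (fock_measure \<Psi> :: (complex ^ 'd) measure)"
    and f: "entire f" and w: "norm w = 1"
    and int: "integrable (fock_measure \<Psi>) (\<lambda>z. f z * cnj (ip z w) ^ n)"
  shows "(\<integral>z. f z * cnj (ip z w) ^ n \<partial>fock_measure \<Psi>) =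
    taylor_coefficient f w n * complex_of_real (\<integral>z. cmod (ip z w) ^ (2 * n) \<partial>fock_measure \<Psi>)"
proof -
  define \<nu> where "\<nu> = density lborel (indicator {0..2*pi} :: real \<Rightarrow> ennreal)"
  have cf: "continuous_on UNIV f" by (rule entire_continuous[OF f])
  have inv1: "distr (fock_measure \<Psi>) borel (rotate_complement w \<theta>) = fock_measure \<Psi>" for \<theta>
    by (rule fock_measure_isometry[OF \<Psi> linear_rotate_complement norm_rotate_complement[OF w] rotate_complement_inverse[OF w]])
  have c1: "continuous_on UNIV (\<lambda>(\<theta>, z). rotate_complement w \<theta> z)"
    unfolding case_prod_beta' rotate_complement_def by (intro continuous_intros)
  define G where "G z = f (ip z w *s w) * cnj (ip z w) ^ n" for z
  have in1: "(\<integral>\<theta>. f (rotate_complement w \<theta> z) * cnj (ip (rotate_complement w \<theta> z) w) ^ n \<partial>\<nu>) = 2 * pi * G z" for z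
  proof -
    \<comment> \<open>The factor with \<open>real 0\<close> is 1; it gives the integrand the form of
      the Fourier coefficient of index 0.\<close>
    have "(\<integral>\<theta>. f (rotate_complement w \<theta> z) * cnj (ip (rotate_complement w \<theta> z) w) ^ n \<partial>\<nu>) =
      (\<integral>\<theta>. f (ip z w *s w + cis \<theta> *s (z - ip z w *s w)) * cis (- (real 0 * \<theta>)) * cnj (ip z w) ^ n \<partial>\<nu>)"
      unfolding ip_rotate_complement[OF w] unfolding rotate_complement_def by simp
    also have "\<dots> = (\<integral>\<theta>. f (ip z w *s w + cis \<theta> *s (z - ip z w *s w)) * cis (- (real 0 * \<theta>)) \<partial>\<nu>) * cnj (ip z w) ^ n"
      by (rule integral_mult_left_zero)
    also have "(\<integral>\<theta>. f (ip z w *s w + cis \<theta> *s (z - ip z w *s w)) * cis (- (real 0 * \<theta>)) \<partial>\<nu>)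
      = 2 * pi * ((deriv ^^ 0) (\<lambda>\<zeta>. f (ip z w *s w + \<zeta> *s (z - ip z w *s w))) 0 / fact 0)"
      unfolding \<nu>_def by (rule circle_fourier_coefficient[OF entire_line_holomorphic[OF f]])
    finally show ?thesis by (simp add: G_def)
  qed
  note ca1 = circle_average[OF sets_fock_measure fin inv1 c1 int, folded \<nu>_def, unfolded in1]
  have intG: "integrable (fock_measure \<Psi>) G"
  proof -
    have "integrable (fock_measure \<Psi>) (\<lambda>z. (1 / (2 * complex_of_real pi)) * (2 * complex_of_real pi * G z))"
      by (rule integrable_mult_right) (use ca1(1) in simp)
    moreover have "(\<lambda>z. (1 / (2 * complex_of_real pi)) * (2 * complex_of_real pi * G z)) = G"
      by (simp add: fun_eq_iff)
    ultimately show ?thesis by metis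
  qed
  have eq1: "(\<integral>z. f z * cnj (ip z w) ^ n \<partial>fock_measure \<Psi>) = (\<integral>z. G z \<partial>fock_measure \<Psi>)"
    using ca1(2) by simp
  have inv2: "distr (fock_measure \<Psi>) borel ((*s) (cis \<theta>)) = (fock_measure \<Psi> :: (complex ^ 'd) measure)" for \<theta>
    by (rule fock_measure_isometry[OF \<Psi> linear_smult, where R' = "(*s) (cis (- \<theta>))"])
       (simp_all add: norm_smult cis_mult vec_eq_iff mult.assoc[symmetric])
  have c2: "continuous_on UNIV (\<lambda>(\<theta>, z :: complex ^ 'd). cis \<theta> *s z)"
    unfolding case_prod_beta' by (intro continuous_intros)
  have hol: "(\<lambda>\<zeta>. f (\<zeta> *s w)) holomorphic_on UNIV"
    using entire_line_holomorphic[OF f, of 0 w] by simp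
  have in2: "(\<integral>\<theta>. G (cis \<theta> *s z) \<partial>\<nu>) = 2 * pi * (taylor_coefficient f w n * complex_of_real (cmod (ip z w) ^ (2 * n)))" for z
  proof -
    define p where "p = ip z w"
    have "(\<integral>\<theta>. G (cis \<theta> *s z) \<partial>\<nu>) = (\<integral>\<theta>. (f (p * cis \<theta> *s w) * cis (- (real n * \<theta>))) * cnj p ^ n \<partial>\<nu>)"
    proof (rule Bochner_Integration.integral_cong[OF refl])
      fix \<theta>
      have "cnj (cis \<theta>) ^ n = cis (- (real n * \<theta>))" by (simp add: cis_cnj Complex.DeMoivre)
      then show "G (cis \<theta> *s z) = (f (p * cis \<theta> *s w) * cis (- (real n * \<theta>))) * cnj p ^ n"
        by (simp add: G_def ip_smult_left p_def power_mult_distrib mult_ac)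
    qed
    also have "\<dots> = (\<integral>\<theta>. f (p * cis \<theta> *s w) * cis (- (real n * \<theta>)) \<partial>\<nu>) * cnj p ^ n"
      by simp
    also have "(\<integral>\<theta>. f (p * cis \<theta> *s w) * cis (- (real n * \<theta>)) \<partial>\<nu>) = 2 * pi * ((deriv ^^ n) (\<lambda>\<zeta>. f (p * \<zeta> *s w)) 0 / fact n)"
      unfolding \<nu>_def
      using entire_line_holomorphic[OF f, of 0 "p *s w"]
      by (intro circle_fourier_coefficient[of "\<lambda>\<zeta>. f (p * \<zeta> *s w)"]) (simp add: mult.commute)
    \<comment> \<open>The factor \<open>p ^ n\<close> from the inner dilation meets
      \<open>cnj p ^ n\<close> and leaves a power of the modulus.\<close>
    also have "(deriv ^^ n) (\<lambda>\<zeta>. f (p * \<zeta> *s w)) 0 = p ^ n * (deriv ^^ n) (\<lambda>\<zeta>. f (\<zeta> *s w)) (p * 0)"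
      by (rule higher_deriv_compose_linear[OF hol open_UNIV open_UNIV UNIV_I UNIV_I])
    also have "2 * pi * (p ^ n * (deriv ^^ n) (\<lambda>\<zeta>. f (\<zeta> *s w)) (p * 0) / fact n) * cnj p ^ n =
      2 * pi * (taylor_coefficient f w n * (p * cnj p) ^ n)"
      by (simp add: taylor_coefficient_def power_mult_distrib)
    also have "(p * cnj p) ^ n = complex_of_real (cmod p ^ (2 * n))"
      by (simp add: complex_norm_square[symmetric] power_mult)
    finally show ?thesis by (simp add: p_def)
  qed
  have "2 * pi * (\<integral>z. G z \<partial>fock_measure \<Psi>) = (\<integral>z. 2 * pi * (taylor_coefficient f w n * complex_of_real (cmod (ip z w) ^ (2 * n))) \<partial>fock_measure \<Psi>)"
    using circle_average(2)[OF sets_fock_measure fin inv2 c2 intG, folded \<nu>_def, unfolded in2] by simp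
  also have "\<dots> = 2 * pi * (taylor_coefficient f w n * complex_of_real (\<integral>z. cmod (ip z w) ^ (2 * n) \<partial>fock_measure \<Psi>))"
    by (simp del: of_real_power)
  finally show ?thesis unfolding eq1 by simp
qed

text \<open>Serves twice: with the exponential series for the Gaussian moments, and with the kernel
  series for the reproducing property.\<close>

lemma integral_against_power_series:
  fixes f :: "complex ^ 'd \<Rightarrow> complex"
  assumes \<Psi>: "continuous_on {0..} \<Psi>" and fin: "finite_measure (fock_measure \<Psi> :: (complex ^ 'd) measure)"
    and f: "entire f" and w: "norm w = 1"
    and int: "\<And>n. integrable (fock_measure \<Psi>) (\<lambda>z. f z * cnj (ip z w) ^ n)"
    and b: "\<And>\<zeta>::complex. summable (\<lambda>n. complex_of_real (b n) * \<zeta> ^ n)"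
    and sm: "summable (\<lambda>n. \<bar>b n\<bar> * (\<integral>z. cmod (f z * cnj (ip z w) ^ n) \<partial>fock_measure \<Psi>))"
  shows "(\<lambda>n. b n * (taylor_coefficient f w n * complex_of_real (\<integral>z. cmod (ip z w) ^ (2 * n) \<partial>fock_measure \<Psi>)))
     sums (\<integral>z. f z * (\<Sum>n. b n * cnj (ip z w) ^ n) \<partial>fock_measure \<Psi>)"
proof -
  define h where "h n z = complex_of_real (b n) * (f z * cnj (ip z w) ^ n)" for n z
  have ih: "integrable (fock_measure \<Psi>) (h n)" for n
    unfolding h_def by (intro integrable_mult_right int)
  have ab: "summable (\<lambda>n. norm (complex_of_real (b n) * \<zeta> ^ n))" for \<zeta> :: complex
    using powser_insidea[OF b, of \<zeta> "of_real (cmod \<zeta> + 1)"] by simp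
  have sums: "(\<lambda>n. \<integral>z. h n z \<partial>fock_measure \<Psi>) sums (\<integral>z. (\<Sum>n. h n z) \<partial>fock_measure \<Psi>)"
  proof (rule sums_integral[OF ih])
    show "AE z in fock_measure \<Psi>. summable (\<lambda>n. norm (h n z))"
    proof (rule AE_I2)
      fix z
      have "summable (\<lambda>n. cmod (f z) * norm (complex_of_real (b n) * cnj (ip z w) ^ n))"
        by (intro summable_mult ab)
      then show "summable (\<lambda>n. norm (h n z))" by (simp add: h_def norm_mult mult_ac)
    qed
    show "summable (\<lambda>n. \<integral>z. norm (h n z) \<partial>fock_measure \<Psi>)"
      using sm by (simp add: h_def norm_mult)
  qed
  have "(\<Sum>n. h n z) = f z * (\<Sum>n. b n * cnj (ip z w) ^ n)" for z
    unfolding h_def by (subst suminf_mult[symmetric, OF b]) (simp add: mult_ac)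
  moreover have "(\<integral>z. h n z \<partial>fock_measure \<Psi>) = b n * (taylor_coefficient f w n * complex_of_real (\<integral>z. cmod (ip z w) ^ (2 * n) \<partial>fock_measure \<Psi>))" for n
    unfolding h_def by (simp add: integral_against_power[OF \<Psi> fin f w int])
  ultimately show ?thesis using sums by simp
qed

subsection \<open>Moments of the Fock measure\<close>

lemma nn_integral_lborel_dilate:
  fixes f :: "'a::euclidean_space \<Rightarrow> ennreal"
  assumes [measurable]: "f \<in> borel_measurable borel" and c: "c > 0"
  shows "(\<integral>\<^sup>+x. f x \<partial>lborel) = ennreal (c ^ DIM('a)) * (\<integral>\<^sup>+x. f (c *\<^sub>R x) \<partial>lborel)"
proof -
  have "(\<integral>\<^sup>+x. f x \<partial>lborel) = (\<integral>\<^sup>+x. f x \<partial>density (distr lborel borel (\<lambda>x. 0 + c *\<^sub>R x)) (\<lambda>_. ennreal (\<bar>c\<bar> ^ DIM('a))))"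
    using lborel_affine[of c "0::'a"] c by simp
  also have "\<dots> = ennreal (c ^ DIM('a)) * (\<integral>\<^sup>+x. f x \<partial>distr lborel borel (\<lambda>x. 0 + c *\<^sub>R x))"
    using c by (subst nn_integral_density) (auto simp: nn_integral_cmult)
  also have "(\<integral>\<^sup>+x. f x \<partial>distr lborel borel (\<lambda>x. 0 + c *\<^sub>R x)) = (\<integral>\<^sup>+x. f (c *\<^sub>R x) \<partial>lborel)"
    by (subst nn_integral_distr) auto
  finally show ?thesis .
qed

text \<open>Polar coordinates for the homogeneous function \<open>z \<mapsto> \<bar>ip z w\<bar>\<^sup>2\<^sup>n\<close>: scaling determines its
  integrals over balls up to one constant.\<close>

lemma homogeneous_radial_integral:
  fixes w :: "complex ^ 'd" and n :: nat
  defines "m \<equiv> n + CARD('d) - 1"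
  obtains \<kappa> where "\<kappa> \<ge> 0" "\<And>h :: real \<Rightarrow> ennreal. h \<in> borel_measurable borel \<Longrightarrow>
    (\<integral>\<^sup>+z. ennreal (cmod (ip z w) ^ (2 * n)) * h ((norm z)\<^sup>2) \<partial>lborel) =
     ennreal \<kappa> * (\<integral>\<^sup>+r. ennreal (r ^ m) * indicator {0..} r * h r \<partial>lborel)"
proof -
  have d1: "CARD('d) \<ge> 1" by (simp add: Suc_leI)
  define G :: "complex ^ 'd \<Rightarrow> ennreal" where "G z = ennreal (cmod (ip z w) ^ (2 * n))" for z
  have [measurable]: "G \<in> borel_measurable borel" unfolding G_def[abs_def] by measurable
  define J where "J s = (\<integral>\<^sup>+z. G z * indicator {..s} ((norm z)\<^sup>2) \<partial>lborel)" for s :: real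
  \<comment> \<open>With \<open>c = sqrt s\<close>, volume contributes the exponent
    \<open>2 * CARD('d)\<close> and homogeneity \<open>2 * n\<close>; together they give
    \<open>s ^ Suc m\<close>.\<close>
  have scale: "J s = ennreal (s ^ Suc m) * J 1" if "s > 0" for s
  proof -
    define c where "c = sqrt s"
    have c: "c > 0" "c\<^sup>2 = s" using that by (auto simp: c_def)
    have "J s = ennreal (c ^ DIM(complex ^ 'd)) * (\<integral>\<^sup>+z. G (c *\<^sub>R z) * indicator {..s} ((norm (c *\<^sub>R z))\<^sup>2) \<partial>lborel)"
      unfolding J_def by (rule nn_integral_lborel_dilate) (use c in measurable)
    also have "(\<integral>\<^sup>+z. G (c *\<^sub>R z) * indicator {..s} ((norm (c *\<^sub>R z))\<^sup>2) \<partial>lborel) =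
        (\<integral>\<^sup>+z. ennreal (c ^ (2 * n)) * (G z * indicator {..1} ((norm z)\<^sup>2)) \<partial>lborel)"
    proof (rule nn_integral_cong)
      fix z :: "complex ^ 'd"
      have "G (c *\<^sub>R z) = ennreal (c ^ (2 * n)) * G z"
        using c by (simp add: G_def smult_scaleR ip_smult_left norm_mult power_mult_distrib ennreal_mult)
      moreover have "((norm (c *\<^sub>R z))\<^sup>2 \<le> s) = ((norm z)\<^sup>2 \<le> 1)"
        using c that by (simp add: power_mult_distrib)
      ultimately show "G (c *\<^sub>R z) * indicator {..s} ((norm (c *\<^sub>R z))\<^sup>2) = ennreal (c ^ (2 * n)) * (G z * indicator {..1} ((norm z)\<^sup>2))"
        by (simp add: indicator_def mult.assoc)
    qed
    also have "\<dots> = ennreal (c ^ (2 * n)) * J 1"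
      unfolding J_def by (rule nn_integral_cmult) measurable
    also have "ennreal (c ^ DIM(complex ^ 'd)) * (ennreal (c ^ (2 * n)) * J 1) = ennreal (c ^ DIM(complex ^ 'd) * c ^ (2 * n)) * J 1"
      using c by (simp add: ennreal_mult mult.assoc)
    also have "c ^ DIM(complex ^ 'd) * c ^ (2 * n) = c ^ (2 * Suc m)"
      using d1 by (simp add: m_def power_add[symmetric] mult.commute)
    also have "c ^ (2 * Suc m) = s ^ Suc m" by (simp only: power_mult c)
    finally show ?thesis .
  qed
  have J1: "J 1 < \<infinity>"
  proof -
    have "J 1 \<le> (\<integral>\<^sup>+z. ennreal (norm w ^ (2 * n)) * indicator (cball (0 :: complex ^ 'd) 1) z \<partial>lborel)"
      unfolding J_def
    proof (rule nn_integral_mono)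
      fix z :: "complex ^ 'd"
      have "cmod (ip z w) ^ (2 * n) \<le> norm w ^ (2 * n)" if "norm z \<le> 1"
        using cmod_ip_le[of z w] mult_right_mono[OF that, of "norm w"] by (intro power_mono) auto
      then show "G z * indicator {..1} ((norm z)\<^sup>2) \<le> ennreal (norm w ^ (2 * n)) * indicator (cball 0 1) z"
        by (auto simp: G_def indicator_def abs_square_le_1 intro!: ennreal_leI)
    qed
    also have "\<dots> = ennreal (norm w ^ (2 * n)) * emeasure lborel (cball (0 :: complex ^ 'd) 1)"
      by (rule nn_integral_cmult_indicator) simp
    also have "\<dots> < \<infinity>" using emeasure_lborel_cball_finite[of "0 :: complex ^ 'd" 1] by (simp add: ennreal_mult_less_top)
    finally show ?thesis .
  qed
  \<comment> \<open>Chosen so that the density \<open>\<kappa> * r ^ m\<close> integrates to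
    \<open>J s\<close> over \<open>{0..s}\<close>. The measures \<open>M\<close> and
    \<open>N\<close> below then agree on all half-lines \<open>{..s}\<close>, hence are
    equal.\<close>
  define \<kappa> where "\<kappa> = real (Suc m) * enn2real (J 1)"
  have \<kappa>0: "\<kappa> \<ge> 0" by (simp add: \<kappa>_def)
  have J1e: "J 1 = ennreal (\<kappa> / real (Suc m))" using J1 by (simp add: \<kappa>_def)
  define M where "M = distr (density lborel G) borel (\<lambda>z. (norm z)\<^sup>2)"
  define N where "N = density lborel (\<lambda>r::real. ennreal (\<kappa> * r ^ m) * indicator {0..} r)"
  have M: "emeasure M {..s} = J s" for s
  proof -
    have "emeasure M {..s} = (\<integral>\<^sup>+r. indicator {..s} r \<partial>M)" by (simp add: M_def)
    also have "\<dots> = (\<integral>\<^sup>+z. indicator {..s} ((norm z)\<^sup>2) \<partial>density lborel G)"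
      unfolding M_def by (rule nn_integral_distr) auto
    also have "\<dots> = J s" unfolding J_def by (rule nn_integral_density) auto
    finally show ?thesis .
  qed
  have Jneg: "J s = 0" if "s \<le> 0" for s
  proof -
    have "AE z in lborel. z \<noteq> (0 :: complex ^ 'd)" by (rule AE_lborel_singleton)
    then have "AE z in lborel. G z * indicator {..s} ((norm z)\<^sup>2) = 0"
    proof eventually_elim
      case (elim z)
      then have "0 < (norm z)\<^sup>2" by simp
      then have "\<not> (norm z)\<^sup>2 \<le> s" using that by linarith
      then show ?case by simp
    qed
    then show ?thesis unfolding J_def by (subst nn_integral_0_iff_AE) auto
  qed
  have N: "emeasure N {..s} = J s" for s
  proof -
    have "emeasure N {..s} = (\<integral>\<^sup>+r. ennreal (\<kappa> * r ^ m) * indicator {0..} r * indicator {..s} r \<partial>lborel)"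
      unfolding N_def by (rule emeasure_density) auto
    also have "\<dots> = (\<integral>\<^sup>+r. ennreal (\<kappa> * r ^ m) * indicator {0..s} r \<partial>lborel)"
      by (intro nn_integral_cong) (auto simp: indicator_def)
    also have "\<dots> = J s"
    proof (cases "s > 0")
      case True
      have "(\<integral>\<^sup>+r. ennreal (\<kappa> * r ^ m) * indicator {0..s} r \<partial>lborel) = ennreal (\<kappa> / real (Suc m) * s ^ Suc m - \<kappa> / real (Suc m) * 0 ^ Suc m)"
      proof (rule nn_integral_FTC_Icc)
        show "DERIV (\<lambda>r. \<kappa> / real (Suc m) * r ^ Suc m) x :> \<kappa> * x ^ m" for x
          using DERIV_cmult[OF DERIV_pow[of "Suc m" x], of "\<kappa> / real (Suc m)"] by (simp del: of_nat_Suc)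
      qed (use True \<kappa>0 in auto)
      also have "\<dots> = J s" unfolding scale[OF True] J1e using True \<kappa>0
        by (simp add: ennreal_mult[symmetric] mult.commute)
      finally show ?thesis .
    next
      case False
      have "AE r in lborel. r \<noteq> (0 :: real)" by (rule AE_lborel_singleton)
      then have "AE r in lborel. ennreal (\<kappa> * r ^ m) * indicator {0..s} r = 0"
        by eventually_elim (use False in \<open>auto simp: indicator_def\<close>)
      then have "(\<integral>\<^sup>+r. ennreal (\<kappa> * r ^ m) * indicator {0..s} r \<partial>lborel) = 0"
        by (subst nn_integral_0_iff_AE) auto
      then show ?thesis using Jneg[of s] False by simp
    qed
    finally show ?thesis .
  qed
  have "M = N"
  proof (rule measure_eqI_generator_eq[where E = "range (\<lambda>s::real. {..s})" and \<Omega> = UNIV and A = "\<lambda>i. {..real i}"])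
    show "Int_stable (range (\<lambda>s::real. {..s}))"
      by (auto simp: Int_stable_def Int_atMost)
    show "sets M = sigma_sets UNIV (range (\<lambda>s::real. {..s}))" "sets N = sigma_sets UNIV (range (\<lambda>s::real. {..s}))"
      by (simp_all add: M_def N_def borel_eq_atMost)
    show "(\<Union>i. {..real i}) = UNIV" by (auto intro: real_arch_simple)
    show "emeasure M {..real i} \<noteq> \<infinity>" for i
      unfolding M using J1 scale[of "real i"] Jneg[of "real i"]
      by (cases "real i > 0") (auto simp: ennreal_mult_eq_top_iff)
  qed (auto simp: M N)
  show ?thesis
  proof (rule that[OF \<kappa>0])
    fix h :: "real \<Rightarrow> ennreal" assume [measurable]: "h \<in> borel_measurable borel"
    have "(\<integral>\<^sup>+z. G z * h ((norm z)\<^sup>2) \<partial>lborel) = (\<integral>\<^sup>+z. h ((norm z)\<^sup>2) \<partial>density lborel G)"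
      by (rule nn_integral_density[symmetric]) auto
    also have "\<dots> = (\<integral>\<^sup>+r. h r \<partial>M)" unfolding M_def by (rule nn_integral_distr[symmetric]) auto
    also have "\<dots> = (\<integral>\<^sup>+r. ennreal (\<kappa> * r ^ m) * indicator {0..} r * h r \<partial>lborel)"
      unfolding \<open>M = N\<close> N_def by (rule nn_integral_density) auto
    also have "\<dots> = (\<integral>\<^sup>+r. ennreal \<kappa> * (ennreal (r ^ m) * indicator {0..} r * h r) \<partial>lborel)"
      using \<kappa>0 by (intro nn_integral_cong) (auto simp: indicator_def ennreal_mult mult.assoc)
    also have "\<dots> = ennreal \<kappa> * (\<integral>\<^sup>+r. ennreal (r ^ m) * indicator {0..} r * h r \<partial>lborel)"
      by (rule nn_integral_cmult) measurable
    finally show "(\<integral>\<^sup>+z. ennreal (cmod (ip z w) ^ (2 * n)) * h ((norm z)\<^sup>2) \<partial>lborel) =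
     ennreal \<kappa> * (\<integral>\<^sup>+r. ennreal (r ^ m) * indicator {0..} r * h r \<partial>lborel)"
      unfolding G_def .
  qed
qed

section \<open>Size of the moments on the half-line\<close>

lemma halfline_moment_fact: "halfline_moment (\<lambda>x. x) m = ennreal (fact m)"
proof -
  have "((\<lambda>t. t powr (real (Suc m) - 1) / exp t) has_integral Gamma (real (Suc m))) {0..}"
    by (rule Gamma_integral_real) simp
  also have "Gamma (real (Suc m)) = fact m" using Gamma_fact[of m, where 'a = real] by (simp add: add.commute)
  finally have "((\<lambda>t. if t \<in> {0..} then t powr (real (Suc m) - 1) / exp t else 0) has_integral fact m) UNIV"
    unfolding has_integral_restrict_UNIV .
  then have "(\<integral>\<^sup>+t. ennreal (if t \<in> {0..} then t powr (real (Suc m) - 1) / exp t else 0) \<partial>lborel) = ennreal (fact m)"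
    by (intro nn_integral_has_integral_lborel) auto
  moreover have "halfline_moment (\<lambda>x. x) m = (\<integral>\<^sup>+t. ennreal (if t \<in> {0..} then t powr (real (Suc m) - 1) / exp t else 0) \<partial>lborel)"
    unfolding halfline_moment_def
  proof (rule nn_integral_cong_AE)
    have "AE r in lborel. r \<noteq> (0 :: real)" by (rule AE_lborel_singleton)
    then show "AE y in lborel. ennreal (y ^ m * exp (- y)) * indicator {0..} y = ennreal (if y \<in> {0..} then y powr (real (Suc m) - 1) / exp y else 0)"
      by eventually_elim (auto simp: powr_realpow exp_minus divide_inverse)
  qed
  ultimately show ?thesis by simp
qed

lemma halfline_moment_finite:
  assumes \<Psi>: "continuous_on {0..} \<Psi>" and lower: "\<And>x. x \<ge> 0 \<Longrightarrow> \<Psi> x \<ge> a + \<mu> * x" and \<mu>: "\<mu> > 0"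
  shows "halfline_moment \<Psi> m < \<infinity>"
proof -
  define C where "C = exp (- a) * ((2 / \<mu>) ^ m * fact m)"
  have C: "C \<ge> 0" using \<mu> by (simp add: C_def)
  have "((\<lambda>x::real. exp (- (\<mu> / 2) * x)) has_integral exp (- (\<mu> / 2) * 0) / (\<mu> / 2)) {0..}"
    by (rule has_integral_exp_minus_to_infinity) (use \<mu> in simp)
  then have "((\<lambda>x. if x \<in> {0..} then exp (- (\<mu> / 2) * x) else 0) has_integral 2 / \<mu>) UNIV"
    unfolding has_integral_restrict_UNIV by simp
  then have I: "(\<integral>\<^sup>+x. ennreal (if x \<in> {0..} then exp (- (\<mu> / 2) * x) else 0) \<partial>lborel) = ennreal (2 / \<mu>)"
    by (intro nn_integral_has_integral_lborel) auto
  have "halfline_moment \<Psi> m \<le> (\<integral>\<^sup>+x. ennreal C * ennreal (if x \<in> {0..} then exp (- (\<mu> / 2) * x) else 0) \<partial>lborel)"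
    unfolding halfline_moment_def
  proof (rule nn_integral_mono)
    fix x :: real
    show "ennreal (x ^ m * exp (- \<Psi> x)) * indicator {0..} x \<le> ennreal C * ennreal (if x \<in> {0..} then exp (- (\<mu> / 2) * x) else 0)"
    proof (cases "x \<ge> 0")
      case True
      have "x ^ m = (2 / \<mu>) ^ m * (\<mu> / 2 * x) ^ m" using \<mu> by (simp flip: power_mult_distrib)
      also have "\<dots> \<le> (2 / \<mu>) ^ m * (fact m * exp (\<mu> / 2 * x))"
        using \<mu> True by (intro mult_left_mono power_le_exp) auto
      finally have "x ^ m * exp (- \<Psi> x) \<le> ((2 / \<mu>) ^ m * (fact m * exp (\<mu> / 2 * x))) * exp (- a - \<mu> * x)"
        using lower[OF True] True \<mu> by (intro mult_mono) auto
      also have "\<dots> = C * (exp (\<mu> / 2 * x) * exp (- (\<mu> * x)))"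
        by (simp add: C_def exp_diff exp_minus field_simps)
      also have "exp (\<mu> / 2 * x) * exp (- (\<mu> * x)) = exp (- (\<mu> / 2) * x)"
        by (simp flip: exp_add)
      finally show ?thesis using True C by (simp add: ennreal_mult'[symmetric] ennreal_leI)
    qed auto
  qed
  also have "\<dots> = ennreal C * ennreal (2 / \<mu>)" unfolding I[symmetric] by (rule nn_integral_cmult) auto
  also have "\<dots> < \<infinity>" by (simp add: ennreal_mult_less_top)
  finally show ?thesis .
qed

text \<open>\<open>R\<close> is arbitrary: the moments outgrow every geometric sequence, which gives
  the kernel series an infinite radius of convergence.\<close>

lemma halfline_moment_lower:
  assumes \<Psi>: "continuous_on {0..} \<Psi>" and R: "R \<ge> 0"
  obtains c where "c > 0" "\<And>m. halfline_moment \<Psi> m \<ge> ennreal (c * R ^ m)"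
proof -
  have "continuous_on {R..R+1} \<Psi>" using \<Psi> by (rule continuous_on_subset) (use R in auto)
  then have "\<exists>y\<in>{R..R+1}. \<forall>x\<in>{R..R+1}. \<Psi> x \<le> \<Psi> y"
    by (intro continuous_attains_sup) auto
  then obtain y where y: "\<And>x. x \<in> {R..R+1} \<Longrightarrow> \<Psi> x \<le> \<Psi> y" by blast
  show ?thesis
  proof (rule that[of "exp (- \<Psi> y)"])
    fix m
    have "ennreal (exp (- \<Psi> y) * R ^ m) = (\<integral>\<^sup>+x. ennreal (exp (- \<Psi> y) * R ^ m) * indicator {R..R+1} x \<partial>lborel)"
      by (simp add: nn_integral_cmult_indicator)
    also have "\<dots> \<le> halfline_moment \<Psi> m"
      unfolding halfline_moment_def
    proof (rule nn_integral_mono)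
      fix x
      show "ennreal (exp (- \<Psi> y) * R ^ m) * indicator {R..R+1} x \<le> ennreal (x ^ m * exp (- \<Psi> x)) * indicator {0..} x"
      proof (cases "x \<in> {R..R+1}")
        case True
        have "exp (- \<Psi> y) * R ^ m \<le> exp (- \<Psi> x) * x ^ m"
          using True y[OF True] R by (intro mult_mono power_mono) auto
        then show ?thesis using True R by (simp add: ennreal_leI mult.commute)
      qed auto
    qed
    finally show "ennreal (exp (- \<Psi> y) * R ^ m) \<le> halfline_moment \<Psi> m" .
  qed simp
qed

text \<open>The Gaussian identity is an expansion in the square of a positive parameter, so only
  positive \<open>t\<close> are at hand. The coefficients vanish one after the other: divide by
  \<open>t ^ n\<close> and let \<open>t\<close> tend to 0 from the right.\<close>

lemma power_series_eq_zero_of_positive: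
  fixes a :: "nat \<Rightarrow> real"
  assumes "\<And>t. t > 0 \<Longrightarrow> (\<lambda>n. a n * t ^ n) sums 0"
  shows "a n = 0"
proof (induction n rule: less_induct)
  case (less n)
  have s: "(\<lambda>k. a (k + n) * t ^ k) sums 0" if "t > 0" for t
  proof -
    have "(\<lambda>k. a (k + n) * t ^ (k + n)) sums (0 - (\<Sum>k<n. a k * t ^ k))"
      using assms[OF that] by (subst sums_iff_shift') simp
    then have "(\<lambda>k. inverse (t ^ n) * (a (k + n) * t ^ (k + n))) sums (inverse (t ^ n) * 0)"
      using less by (intro sums_mult) simp
    moreover have "inverse (t ^ n) * (a (k + n) * t ^ (k + n)) = a (k + n) * t ^ k" for k
      using that by (simp add: power_add)
    ultimately show ?thesis by simp
  qed
  have sm: "summable (\<lambda>k. a (k + n) * t ^ k)" for t :: real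
    by (rule powser_inside[OF sums_summable[OF s[of "\<bar>t\<bar> + 1"]]]) simp_all
  have "isCont (\<lambda>t. \<Sum>k. a (k + n) * t ^ k) 0"
    by (rule isCont_powser_converges_everywhere) (rule sm)
  then have "((\<lambda>t. \<Sum>k. a (k + n) * t ^ k) \<longlongrightarrow> a n) (at_right 0)"
    by (simp add: isCont_def filterlim_at_split)
  moreover have "((\<lambda>t. \<Sum>k. a (k + n) * t ^ k) \<longlongrightarrow> 0) (at_right 0)"
  proof (rule tendsto_eventually)
    show "\<forall>\<^sub>F t in at_right 0. (\<Sum>k. a (k + n) * t ^ k) = 0"
      using eventually_at_right_less[of "0 :: real"] by eventually_elim (rule sums_unique[OF s, symmetric])
  qed
  ultimately show "a n = 0" by (rule tendsto_unique[rotated]) simp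
qed

lemma cnj_ip_measurable [measurable]: "(\<lambda>z. cnj (ip z w)) \<in> borel_measurable borel"
  by (intro borel_measurable_continuous_onI continuous_intros)

text \<open>The constant precedes the weight: the same \<open>\<kappa>\<close> serves all
  \<open>\<Psi>\<close>, so it can be determined from one weight for which both sides are
  known.\<close>

lemma nn_integral_ip_power:
  fixes w :: "complex ^ 'd" and n :: nat
  obtains \<kappa> where "\<kappa> \<ge> 0" "\<And>\<Psi>. continuous_on {0..} \<Psi> \<Longrightarrow>
    (\<integral>\<^sup>+z. ennreal (cmod (ip z w) ^ (2 * n)) \<partial>fock_measure \<Psi>) = ennreal \<kappa> * halfline_moment \<Psi> (n + CARD('d) - 1)"
proof -
  obtain \<kappa> where \<kappa>: "\<kappa> \<ge> 0" and h: "\<And>h :: real \<Rightarrow> ennreal. h \<in> borel_measurable borel \<Longrightarrow>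
    (\<integral>\<^sup>+z. ennreal (cmod (ip z w) ^ (2 * n)) * h ((norm z)\<^sup>2) \<partial>lborel) =
     ennreal \<kappa> * (\<integral>\<^sup>+r. ennreal (r ^ (n + CARD('d) - 1)) * indicator {0..} r * h r \<partial>lborel)"
    using homogeneous_radial_integral[of w n] by blast
  show ?thesis
  proof (rule that[OF \<kappa>])
    fix \<Psi> :: "real \<Rightarrow> real" assume \<Psi>: "continuous_on {0..} \<Psi>"
    \<comment> \<open>The indicator makes \<open>h\<close> measurable although nothing is known of
      \<open>\<Psi>\<close> at negative arguments.\<close>
    define h where "h r = ennreal (exp (- \<Psi> r)) * indicator {0..} r" for r
    have hm: "h \<in> borel_measurable borel"
    proof -
      have "(\<lambda>r. indicator {0..} r *\<^sub>R exp (- \<Psi> r)) \<in> borel_measurable borel"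
        by (intro borel_measurable_continuous_on_indicator continuous_intros \<Psi>) auto
      then have "(\<lambda>r. ennreal (indicator {0..} r *\<^sub>R exp (- \<Psi> r))) \<in> borel_measurable borel" by measurable
      also have "(\<lambda>r. ennreal (indicator {0..} r *\<^sub>R exp (- \<Psi> r))) = h"
        by (auto simp: h_def indicator_def fun_eq_iff)
      finally show ?thesis .
    qed
    have "(\<integral>\<^sup>+z. ennreal (cmod (ip z w) ^ (2 * n)) \<partial>fock_measure \<Psi>) =
      (\<integral>\<^sup>+z. ennreal (cmod (ip z w) ^ (2 * n)) * h ((norm z)\<^sup>2) \<partial>lborel)"
      by (subst nn_integral_fock_measure[OF \<Psi>]) (auto simp: h_def mult.commute)
    also have "\<dots> = ennreal \<kappa> * (\<integral>\<^sup>+r. ennreal (r ^ (n + CARD('d) - 1)) * indicator {0..} r * h r \<partial>lborel)"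
      by (rule h[OF hm])
    also have "(\<integral>\<^sup>+r. ennreal (r ^ (n + CARD('d) - 1)) * indicator {0..} r * h r \<partial>lborel) = halfline_moment \<Psi> (n + CARD('d) - 1)"
      unfolding halfline_moment_def by (intro nn_integral_cong) (auto simp: h_def indicator_def ennreal_mult)
    finally show "(\<integral>\<^sup>+z. ennreal (cmod (ip z w) ^ (2 * n)) \<partial>fock_measure \<Psi>) = ennreal \<kappa> * halfline_moment \<Psi> (n + CARD('d) - 1)" .
  qed
qed

lemma finite_fock_measure:
  assumes \<Psi>: "continuous_on {0..} \<Psi>" and lower: "\<And>x. x \<ge> 0 \<Longrightarrow> \<Psi> x \<ge> a + \<mu> * x" and \<mu>: "\<mu> > 0"
  shows "finite_measure (fock_measure \<Psi> :: (complex ^ 'd) measure)"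
proof (rule finite_measureI)
  \<comment> \<open>With \<open>n = 0\<close> and \<open>w = 0\<close> the integrand is
    \<open>0 ^ 0 = 1\<close>, so the integral is the total mass.\<close>
  obtain \<kappa> where "\<And>\<Psi>. continuous_on {0..} \<Psi> \<Longrightarrow>
    (\<integral>\<^sup>+z. ennreal (cmod (ip z (0 :: complex ^ 'd)) ^ (2 * 0)) \<partial>fock_measure \<Psi>) = ennreal \<kappa> * halfline_moment \<Psi> (0 + CARD('d) - 1)"
    using nn_integral_ip_power[of "0 :: complex ^ 'd" 0] by blast
  from this[OF \<Psi>] have "emeasure (fock_measure \<Psi> :: (complex ^ 'd) measure) UNIV = ennreal \<kappa> * halfline_moment \<Psi> (CARD('d) - 1)"
    by simp
  then show "emeasure (fock_measure \<Psi> :: (complex ^ 'd) measure) (space (fock_measure \<Psi>)) \<noteq> \<infinity>"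
    using halfline_moment_finite[OF \<Psi> lower \<mu>, of "CARD('d) - 1"] by (simp add: ennreal_mult_eq_top_iff less_top)
qed

lemma entire_of_ip:
  assumes "\<And>\<zeta>. (g has_field_derivative g' \<zeta>) (at \<zeta>)"
  shows "entire (\<lambda>z. g (ip z w))"
  unfolding entire_def
proof
  fix z
  have "(g has_derivative (*) (g' (ip z w))) (at (ip z w))"
    using assms by (simp add: has_field_derivative_def)
  moreover have "((\<lambda>z. ip z w) has_derivative (\<lambda>v. ip v w)) (at z)"
    by (rule bounded_linear_imp_has_derivative[OF bounded_linear_ip])
  ultimately have "((\<lambda>z. g (ip z w)) has_derivative (\<lambda>v. g' (ip z w) * ip v w)) (at z)"
    using has_derivative_compose by blast
  then show "\<exists>D. ((\<lambda>z. g (ip z w)) has_derivative D) (at z) \<and> (\<forall>c v. D (c *s v) = c *\<^sub>C D v)"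
    by (intro exI conjI) (auto simp: scaleC_complex_def ip_smult_left)
qed

section \<open>The Gaussian weight as normalisation\<close>

text \<open>Not normalised: the mass enters the kernel only as a factor common to all coefficients,
  and its finiteness and positivity suffice.\<close>

abbreviation "gaussian \<equiv> fock_measure (\<lambda>x. x)"

lemma gaussian_exp_integrable:
  fixes c :: real
  shows "integrable (gaussian :: (complex ^ 'd) measure) (\<lambda>z. exp (c * norm z))"
proof (rule integrableI_bounded)
  let ?\<Psi> = "\<lambda>x::real. x" let ?\<Psi>2 = "\<lambda>x::real. 0 + 1 / 2 * x"
  have c1: "continuous_on {0..} ?\<Psi>" and c2: "continuous_on {0..} ?\<Psi>2" by (intro continuous_intros)+
  show "(\<lambda>z. exp (c * norm z)) \<in> borel_measurable (fock_measure ?\<Psi> :: (complex ^ 'd) measure)"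
    by measurable
  interpret finite_measure "fock_measure ?\<Psi>2 :: (complex ^ 'd) measure"
    by (rule finite_fock_measure[OF c2, of 0 "1 / 2"]) auto
  have "(\<integral>\<^sup>+z. ennreal (norm (exp (c * norm z))) \<partial>(fock_measure ?\<Psi> :: (complex ^ 'd) measure)) =
     (\<integral>\<^sup>+z. ennreal (exp (- ((norm (z :: complex ^ 'd))\<^sup>2))) * ennreal (exp (c * norm z)) \<partial>lborel)"
    by (subst nn_integral_fock_measure[OF c1]) auto
  also have "\<dots> \<le> (\<integral>\<^sup>+z. ennreal (exp (- (0 + 1 / 2 * (norm (z :: complex ^ 'd))\<^sup>2))) * ennreal (exp (c\<^sup>2 / 2)) \<partial>lborel)"
  proof (rule nn_integral_mono)
    fix z :: "complex ^ 'd"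
    have "0 \<le> (norm z - c)\<^sup>2" by simp
    then have "- ((norm z)\<^sup>2) + c * norm z \<le> - (0 + 1 / 2 * (norm z)\<^sup>2) + c\<^sup>2 / 2"
      by (simp add: power2_eq_square algebra_simps)
    then show "ennreal (exp (- ((norm z)\<^sup>2))) * ennreal (exp (c * norm z)) \<le> ennreal (exp (- (0 + 1 / 2 * (norm z)\<^sup>2))) * ennreal (exp (c\<^sup>2 / 2))"
      by (simp add: ennreal_mult[symmetric] ennreal_leI flip: exp_add)
  qed
  also have "\<dots> = (\<integral>\<^sup>+z. ennreal (exp (c\<^sup>2 / 2)) \<partial>(fock_measure ?\<Psi>2 :: (complex ^ 'd) measure))"
    by (rule nn_integral_fock_measure[OF c2, symmetric]) simp
  also have "\<dots> < \<infinity>" using emeasure_finite[of UNIV] by (simp add: ennreal_mult_less_top less_top)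
  finally show "(\<integral>\<^sup>+z. ennreal (norm (exp (c * norm z))) \<partial>(fock_measure ?\<Psi> :: (complex ^ 'd) measure)) < \<infinity>" .
qed

text \<open>Completing the square makes the exponent \<open>\<rho>\<^sup>2\<close> minus the squared
  distance of \<open>z\<close> from \<open>\<rho> *s w\<close>, and Lebesgue measure is translation
  invariant.\<close>

lemma gaussian_shift:
  fixes w :: "complex ^ 'd"
  assumes w: "norm w = 1"
  shows "(\<integral>z. exp (2 * \<rho> * Re (ip z w)) \<partial>gaussian) =
     exp (\<rho>\<^sup>2) * measure (gaussian :: (complex ^ 'd) measure) UNIV"
proof -
  let ?\<gamma> = "gaussian :: (complex ^ 'd) measure"
  have c: "continuous_on {0..} (\<lambda>x::real. x)" by (intro continuous_intros)
  interpret finite_measure ?\<gamma> by (rule finite_fock_measure[OF c, of 0 1]) auto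
  have dist: "(norm (- (of_real \<rho> *s w) + z))\<^sup>2 = (norm z)\<^sup>2 - 2 * \<rho> * Re (ip z w) + \<rho>\<^sup>2" for z
  proof -
    have m: "- (of_real \<rho> *s w) = (- of_real \<rho>) *s w" by (simp add: vec_eq_iff)
    have "complex_of_real ((norm (- (of_real \<rho> *s w) + z))\<^sup>2) = ip z z - of_real \<rho> * (ip z w + cnj (ip z w)) + (of_real \<rho>)\<^sup>2 * ip w w"
      unfolding ip_self[symmetric] m ip_add_left ip_add_right ip_smult_left ip_smult_right cnj_ip
      by (simp add: algebra_simps power2_eq_square)
    also have "\<dots> = complex_of_real ((norm z)\<^sup>2 - 2 * \<rho> * Re (ip z w) + \<rho>\<^sup>2)"
      by (simp add: ip_self w complex_add_cnj)
    finally show ?thesis by (simp only: of_real_eq_iff)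
  qed
  have "(\<integral>\<^sup>+z. ennreal (exp (2 * \<rho> * Re (ip z w))) \<partial>?\<gamma>) = ennreal (exp (\<rho>\<^sup>2)) * emeasure ?\<gamma> UNIV"
  proof -
    have "emeasure ?\<gamma> UNIV = (\<integral>\<^sup>+z. 1 \<partial>?\<gamma>)" by simp
    also have "\<dots> = (\<integral>\<^sup>+z. ennreal (exp (- ((norm (z :: complex ^ 'd))\<^sup>2))) \<partial>lborel)"
      by (subst nn_integral_fock_measure[OF c]) auto
    also have "\<dots> = (\<integral>\<^sup>+z. ennreal (exp (- ((norm (- (of_real \<rho> *s w) + z))\<^sup>2))) \<partial>lborel)"
      by (rule nn_integral_lborel_translate[symmetric]) measurable
    also have "ennreal (exp (\<rho>\<^sup>2)) * \<dots> = (\<integral>\<^sup>+z. ennreal (exp (\<rho>\<^sup>2)) * ennreal (exp (- ((norm (- (of_real \<rho> *s w) + z))\<^sup>2))) \<partial>lborel)"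
      by (rule nn_integral_cmult[symmetric]) measurable
    also have "\<dots> = (\<integral>\<^sup>+z. ennreal (exp (- ((norm z)\<^sup>2))) * ennreal (exp (2 * \<rho> * Re (ip z w))) \<partial>lborel)"
      unfolding dist by (intro nn_integral_cong) (simp add: ennreal_mult[symmetric] flip: exp_add)
    also have "\<dots> = (\<integral>\<^sup>+z. ennreal (exp (2 * \<rho> * Re (ip z w))) \<partial>?\<gamma>)"
      by (rule nn_integral_fock_measure[OF c, symmetric]) measurable
    finally show ?thesis by simp
  qed
  also have "\<dots> = ennreal (exp (\<rho>\<^sup>2) * measure ?\<gamma> UNIV)"
    using emeasure_eq_measure[of UNIV] by (simp add: ennreal_mult)
  finally show ?thesis
    by (subst (asm) nn_integral_eq_integrable) auto
qed

lemma higher_deriv_exp_linear: "(deriv ^^ n) (\<lambda>\<zeta>. exp (u * \<zeta>)) 0 = (u :: complex) ^ n"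
proof -
  have "(deriv ^^ n) exp = (exp :: complex \<Rightarrow> complex)"
  proof (induction n)
    case (Suc n)
    have "deriv exp = (exp :: complex \<Rightarrow> complex)" by (intro ext DERIV_imp_deriv DERIV_exp)
    then show ?case using Suc by simp
  qed simp
  moreover have "(deriv ^^ n) (\<lambda>\<zeta>. exp (u * \<zeta>)) 0 = u ^ n * (deriv ^^ n) exp (u * 0)"
    by (rule higher_deriv_compose_linear[OF holomorphic_on_exp open_UNIV open_UNIV UNIV_I UNIV_I])
  ultimately show ?thesis by simp
qed

text \<open>For \<open>f z = exp (\<rho> * ip z w)\<close> the integral of
  \<open>f z * cnj (f z)\<close> is known from the shift, and expanding the conjugate factor turns
  it into the sum of \<open>(\<rho>\<^sup>2) ^ n * (A n / (fact n)\<^sup>2)\<close>. Comparing with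
  the series of \<open>exp (\<rho>\<^sup>2)\<close> isolates \<open>A n\<close>.\<close>

lemma gaussian_ip_power:
  fixes w :: "complex ^ 'd"
  assumes w: "norm w = 1"
  shows "(\<integral>z. cmod (ip z w) ^ (2 * n) \<partial>gaussian) =
    fact n * measure (gaussian :: (complex ^ 'd) measure) UNIV"
proof -
  let ?\<gamma> = "gaussian :: (complex ^ 'd) measure"
  have c: "continuous_on {0..} (\<lambda>x::real. x)" by (intro continuous_intros)
  have fin: "finite_measure ?\<gamma>" by (rule finite_fock_measure[OF c, of 0 1]) auto
  define A where "A n = (\<integral>z. cmod (ip z w) ^ (2 * n) \<partial>?\<gamma>)" for n
  define c0 where "c0 = measure ?\<gamma> UNIV"
  have ipb: "cmod (ip z w) \<le> norm z" for z using cmod_ip_le[of z w] w by simp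
  have key: "(\<lambda>n. (\<rho>\<^sup>2) ^ n * (A n / (fact n)\<^sup>2)) sums (exp (\<rho>\<^sup>2) * c0)" if \<rho>: "\<rho> > 0" for \<rho> :: real
  proof -
    define f where "f z = exp (of_real \<rho> * ip z w)" for z
    have ef: "entire f" unfolding f_def[abs_def]
      by (rule entire_of_ip[where g = "\<lambda>\<zeta>. exp (of_real \<rho> * \<zeta>)" and g' = "\<lambda>\<zeta>. of_real \<rho> * exp (of_real \<rho> * \<zeta>)"])
         (auto intro!: derivative_eq_intros)
    have [measurable]: "f \<in> borel_measurable borel"
      using entire_continuous[OF ef] by (rule borel_measurable_continuous_onI)
    have fb: "cmod (f z) \<le> exp (\<rho> * norm z)" for z
    proof -
      have "Re (ip z w) \<le> norm z" using complex_Re_le_cmod[of "ip z w"] ipb[of z] by linarith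
      then show ?thesis using \<rho> by (simp add: f_def)
    qed
    \<comment> \<open>Spending \<open>exp (2 * \<rho> * norm z)\<close> instead of
      \<open>exp (\<rho> * norm z)\<close> produces the factor \<open>(1/2) ^ n\<close>, which makes
      the expansion integrable term by term.\<close>
    have pb: "(cmod (ip z w)) ^ n * (\<rho> ^ n / fact n) \<le> (1/2) ^ n * exp (2 * \<rho> * norm z)" for z n
    proof -
      have "(2 * \<rho> * cmod (ip z w)) ^ n \<le> (2 * \<rho> * norm z) ^ n"
        using \<rho> ipb by (intro power_mono mult_left_mono) auto
      also have "\<dots> \<le> fact n * exp (2 * \<rho> * norm z)" using \<rho> by (intro power_le_exp) auto
      finally show ?thesis by (simp add: power_mult_distrib field_simps)
    qed
    have bound: "cmod (f z * cnj (ip z w) ^ n) * (\<rho> ^ n / fact n) \<le> (1/2) ^ n * exp (3 * \<rho> * norm z)" for z n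
    proof -
      have "cmod (f z * cnj (ip z w) ^ n) * (\<rho> ^ n / fact n) = cmod (f z) * ((cmod (ip z w)) ^ n * (\<rho> ^ n / fact n))"
        by (simp add: norm_mult norm_power)
      also have "\<dots> \<le> exp (\<rho> * norm z) * ((1/2) ^ n * exp (2 * \<rho> * norm z))"
        using \<rho> by (intro mult_mono fb pb) auto
      also have "\<dots> = (1/2) ^ n * exp (3 * \<rho> * norm z)" by (simp add: mult.left_commute flip: exp_add)
      finally show ?thesis .
    qed
    have int: "integrable ?\<gamma> (\<lambda>z. f z * cnj (ip z w) ^ n)" for n
    proof (rule Bochner_Integration.integrable_bound)
      show "integrable ?\<gamma> (\<lambda>z. (fact n / \<rho> ^ n) * ((1/2) ^ n * exp (3 * \<rho> * norm z)))"
        by (intro integrable_mult_right gaussian_exp_integrable)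
      show "AE z in ?\<gamma>. norm (f z * cnj (ip z w) ^ n) \<le> norm ((fact n / \<rho> ^ n) * ((1/2) ^ n * exp (3 * \<rho> * norm z)))"
      proof (rule AE_I2)
        fix z
        have "norm (f z * cnj (ip z w) ^ n) \<le> (fact n / \<rho> ^ n) * ((1/2) ^ n * exp (3 * \<rho> * norm z))"
          using bound[of z n] \<rho> by (simp add: field_simps)
        then show "norm (f z * cnj (ip z w) ^ n) \<le> norm ((fact n / \<rho> ^ n) * ((1/2) ^ n * exp (3 * \<rho> * norm z)))"
          using \<rho> by (simp add: abs_mult)
      qed
    qed measurable
    define b where "b n = \<rho> ^ n / fact n" for n
    have bexp: "(\<lambda>n. complex_of_real (b n) * \<zeta> ^ n) sums exp (of_real \<rho> * \<zeta>)" for \<zeta> :: complex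
      using exp_converges[of "of_real \<rho> * \<zeta>"] by (simp add: b_def scaleR_conv_of_real power_mult_distrib field_simps)
    have sm: "summable (\<lambda>n. \<bar>b n\<bar> * (\<integral>z. cmod (f z * cnj (ip z w) ^ n) \<partial>?\<gamma>))"
    proof (rule summable_comparison_test')
      define E where "E = (\<integral>z. exp (3 * \<rho> * norm z) \<partial>?\<gamma>)"
      show "summable (\<lambda>n. (1/2) ^ n * E)" by (intro summable_mult2 summable_geometric) auto
      fix n :: nat
      have "\<bar>b n\<bar> * (\<integral>z. cmod (f z * cnj (ip z w) ^ n) \<partial>?\<gamma>) = (\<integral>z. cmod (f z * cnj (ip z w) ^ n) * (\<rho> ^ n / fact n) \<partial>?\<gamma>)"
        using \<rho> by (simp add: b_def)
      also have "\<dots> \<le> (\<integral>z. (1/2) ^ n * exp (3 * \<rho> * norm z) \<partial>?\<gamma>)"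
        by (intro integral_mono bound integrable_mult_left integrable_norm int integrable_mult_right gaussian_exp_integrable)
      also have "\<dots> = (1/2) ^ n * E" by (simp add: E_def)
      finally show "norm (\<bar>b n\<bar> * (\<integral>z. cmod (f z * cnj (ip z w) ^ n) \<partial>?\<gamma>)) \<le> (1/2) ^ n * E" by simp
    qed
    have tc: "taylor_coefficient f w n = of_real (b n)" for n
    proof -
      have "(\<lambda>\<zeta>. f (\<zeta> *s w)) = (\<lambda>\<zeta>. exp (of_real \<rho> * \<zeta>))" by (simp add: f_def ip_smult_left ip_self w fun_eq_iff)
      then show ?thesis by (simp add: taylor_coefficient_def higher_deriv_exp_linear b_def)
    qed
    have "(\<lambda>n. b n * (taylor_coefficient f w n * complex_of_real (A n))) sums (\<integral>z. f z * (\<Sum>n. b n * cnj (ip z w) ^ n) \<partial>?\<gamma>)"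
      unfolding A_def by (rule integral_against_power_series[OF c fin ef w int sums_summable[OF bexp] sm])
    also have "(\<integral>z. f z * (\<Sum>n. b n * cnj (ip z w) ^ n) \<partial>?\<gamma>) = (\<integral>z. complex_of_real (exp (2 * \<rho> * Re (ip z w))) \<partial>?\<gamma>)"
    proof (rule Bochner_Integration.integral_cong[OF refl])
      fix z
      have "f z * (\<Sum>n. b n * cnj (ip z w) ^ n) = exp (of_real \<rho> * (ip z w + cnj (ip z w)))"
        unfolding f_def sums_unique[OF bexp, symmetric] by (simp only: exp_add[symmetric] distrib_left)
      also have "\<dots> = exp (complex_of_real (2 * \<rho> * Re (ip z w)))" unfolding complex_add_cnj by (simp add: mult_ac)
      finally show "f z * (\<Sum>n. b n * cnj (ip z w) ^ n) = complex_of_real (exp (2 * \<rho> * Re (ip z w)))"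
        by (simp only: exp_of_real)
    qed
    also have "\<dots> = complex_of_real (exp (\<rho>\<^sup>2) * c0)"
      unfolding integral_complex_of_real gaussian_shift[OF w] c0_def ..
    also have "(\<lambda>n. b n * (taylor_coefficient f w n * complex_of_real (A n))) = (\<lambda>n. complex_of_real (b n * (b n * A n)))"
      by (simp add: tc)
    finally have "(\<lambda>n. b n * (b n * A n)) sums (exp (\<rho>\<^sup>2) * c0)" by (simp only: sums_of_real_iff)
    moreover have "b n * (b n * A n) = (\<rho>\<^sup>2) ^ n * (A n / (fact n)\<^sup>2)" for n
      by (simp add: b_def power2_eq_square power_mult_distrib)
    ultimately show ?thesis by simp
  qed
  define a where "a n = A n / (fact n)\<^sup>2 - c0 / fact n" for n
  have "a n = 0"
  proof (rule power_series_eq_zero_of_positive)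
    fix t :: real assume t: "t > 0"
    have "(\<lambda>n. t ^ n * (A n / (fact n)\<^sup>2)) sums (exp t * c0)" using key[of "sqrt t"] t by simp
    moreover have "(\<lambda>n. (t ^ n /\<^sub>R fact n) * c0) sums (exp t * c0)" by (intro sums_mult2 exp_converges)
    ultimately have "(\<lambda>n. t ^ n * (A n / (fact n)\<^sup>2) - (t ^ n /\<^sub>R fact n) * c0) sums (exp t * c0 - exp t * c0)"
      by (rule sums_diff)
    then show "(\<lambda>n. a n * t ^ n) sums 0" by (simp add: a_def field_simps)
  qed
  then show ?thesis by (simp add: a_def A_def c0_def power2_eq_square field_simps)
qed

lemma gaussian_mass_pos: "measure (gaussian :: (complex ^ 'd) measure) UNIV > 0"
proof -
  let ?\<gamma> = "gaussian :: (complex ^ 'd) measure"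
  have c: "continuous_on {0..} (\<lambda>x::real. x)" by (intro continuous_intros)
  interpret finite_measure ?\<gamma> by (rule finite_fock_measure[OF c, of 0 1]) auto
  have "emeasure ?\<gamma> UNIV \<noteq> 0"
  proof
    assume "emeasure ?\<gamma> UNIV = 0"
    moreover have "emeasure ?\<gamma> UNIV = (\<integral>\<^sup>+z. 1 \<partial>?\<gamma>)" by simp
    moreover have "(\<integral>\<^sup>+z. 1 \<partial>?\<gamma>) = (\<integral>\<^sup>+z. ennreal (exp (- ((norm (z :: complex ^ 'd))\<^sup>2))) \<partial>lborel)"
      by (subst nn_integral_fock_measure[OF c]) auto
    ultimately have "(\<integral>\<^sup>+z. ennreal (exp (- ((norm (z :: complex ^ 'd))\<^sup>2))) \<partial>lborel) = 0" by metis
    then have "AE z in lborel. ennreal (exp (- ((norm (z :: complex ^ 'd))\<^sup>2))) = 0"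
      by (subst (asm) nn_integral_0_iff_AE) auto
    then have "AE z in (lborel :: (complex ^ 'd) measure). False" by simp
    then show False by (simp add: eventually_False ae_filter_eq_bot_iff emeasure_lborel_UNIV)
  qed
  then show ?thesis using emeasure_eq_measure[of UNIV] by (simp add: zero_less_measure_iff)
qed

text \<open>The half-line moments of the Gaussian weight are factorials, so
  \<open>\<kappa> * fact (n + (CARD('d) - 1))\<close> equals \<open>fact n\<close> times the
  Gaussian mass. This eliminates \<open>\<kappa>\<close> for every other weight.\<close>

lemma fock_ip_power:
  fixes w :: "complex ^ 'd"
  assumes \<Psi>: "continuous_on {0..} \<Psi>" and w: "norm w = 1" and s: "\<And>m. s m > 0" "\<And>m. halfline_moment \<Psi> m = ennreal (s m)"
  shows "integrable (fock_measure \<Psi>) (\<lambda>z. cmod (ip z w) ^ (2 * n))"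
    and "(\<integral>z. cmod (ip z w) ^ (2 * n) \<partial>fock_measure \<Psi>) =
      measure (gaussian :: (complex ^ 'd) measure) UNIV * (fact n / fact (n + (CARD('d) - 1)) * s (n + (CARD('d) - 1)))"
proof -
  have d1: "n + CARD('d) - 1 = n + (CARD('d) - 1)" by simp
  obtain \<kappa> where \<kappa>: "\<kappa> \<ge> 0" and nn: "\<And>\<Psi>. continuous_on {0..} \<Psi> \<Longrightarrow>
    (\<integral>\<^sup>+z. ennreal (cmod (ip z w) ^ (2 * n)) \<partial>fock_measure \<Psi>) = ennreal \<kappa> * halfline_moment \<Psi> (n + (CARD('d) - 1))"
    using nn_integral_ip_power[of w n] unfolding d1 by blast
  have c: "continuous_on {0..} (\<lambda>x::real. x)" by (intro continuous_intros)
  have "(\<integral>\<^sup>+z. ennreal (cmod (ip z w) ^ (2 * n)) \<partial>gaussian) = ennreal (\<kappa> * fact (n + (CARD('d) - 1)))"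
    unfolding nn[OF c] halfline_moment_fact using \<kappa> by (simp add: ennreal_mult)
  then have "(\<integral>z. cmod (ip z w) ^ (2 * n) \<partial>gaussian) = \<kappa> * fact (n + (CARD('d) - 1))"
    using \<kappa> by (subst (asm) nn_integral_eq_integrable) auto
  then have \<kappa>e: "\<kappa> = measure (gaussian :: (complex ^ 'd) measure) UNIV * (fact n / fact (n + (CARD('d) - 1)))"
    unfolding gaussian_ip_power[OF w] by (simp add: field_simps)
  have "(\<integral>\<^sup>+z. ennreal (cmod (ip z w) ^ (2 * n)) \<partial>fock_measure \<Psi>) = ennreal (\<kappa> * s (n + (CARD('d) - 1)))"
    unfolding nn[OF \<Psi>] s(2) using \<kappa> s(1) by (simp add: ennreal_mult less_imp_le)
  then have "integrable (fock_measure \<Psi>) (\<lambda>z. cmod (ip z w) ^ (2 * n)) \<and>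
     (\<integral>z. cmod (ip z w) ^ (2 * n) \<partial>fock_measure \<Psi>) = \<kappa> * s (n + (CARD('d) - 1))"
    using \<kappa> s(1) by (subst (asm) nn_integral_eq_integrable) (auto simp: less_imp_le)
  then show "integrable (fock_measure \<Psi>) (\<lambda>z. cmod (ip z w) ^ (2 * n))"
    "(\<integral>z. cmod (ip z w) ^ (2 * n) \<partial>fock_measure \<Psi>) =
      measure (gaussian :: (complex ^ 'd) measure) UNIV * (fact n / fact (n + (CARD('d) - 1)) * s (n + (CARD('d) - 1)))"
    unfolding \<kappa>e by (simp_all add: mult.assoc)
qed

subsection \<open>The reproducing kernel\<close>

lemma unit_vector_decomposition:
  fixes w :: "complex ^ 'd"
  obtains v \<rho> where "norm v = 1" "\<rho> \<ge> 0" "w = complex_of_real \<rho> *s v"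
proof (cases "w = 0")
  case True
  then show ?thesis using that[of "axis undefined 1" 0] by simp
next
  case False
  show ?thesis
  proof (rule that[of "(1 / norm w) *\<^sub>R w" "norm w"])
    show "w = complex_of_real (norm w) *s ((1 / norm w) *\<^sub>R w)"
      using False by (simp flip: smult_scaleR)
  qed (use False in auto)
qed

text \<open>Reproducing one kernel with the other gives \<open>K2 w w' = cnj (K1 w' w)\<close>. For
  a single kernel this is Hermitian symmetry, and the two facts together identify the
  kernels.\<close>

lemma is_reproducing_kernel_unique:
  fixes K K' :: "complex ^ 'd \<Rightarrow> complex ^ 'd \<Rightarrow> complex"
  assumes K: "is_reproducing_kernel \<Psi> K" and K': "is_reproducing_kernel \<Psi> K'"
  shows "K = K'"
proof -
  have adjoint: "K2 w w' = cnj (K1 w' w)"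
    if K1: "is_reproducing_kernel \<Psi> K1" and K2: "is_reproducing_kernel \<Psi> K2" for K1 K2 :: "complex ^ 'd \<Rightarrow> complex ^ 'd \<Rightarrow> complex" and w w'
  proof -
    have mem: "(\<lambda>z. K z w) \<in> fock_space \<Psi>" if "is_reproducing_kernel \<Psi> K"
      for K :: "complex ^ 'd \<Rightarrow> complex ^ 'd \<Rightarrow> complex" and w
      using that unfolding is_reproducing_kernel_def by auto
    have rep: "f w = (\<integral>z. f z * cnj (K z w) \<partial>fock_measure \<Psi>)" if "is_reproducing_kernel \<Psi> K" "f \<in> fock_space \<Psi>"
      for K :: "complex ^ 'd \<Rightarrow> complex ^ 'd \<Rightarrow> complex" and f w
      using that unfolding is_reproducing_kernel_def by auto
    have "K2 w w' = (\<integral>z. K2 z w' * cnj (K1 z w) \<partial>fock_measure \<Psi>)"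
      by (rule rep[OF K1 mem[OF K2]])
    also have "\<dots> = (\<integral>z. cnj (K1 z w * cnj (K2 z w')) \<partial>fock_measure \<Psi>)" by (simp add: mult.commute)
    also have "\<dots> = cnj (\<integral>z. K1 z w * cnj (K2 z w') \<partial>fock_measure \<Psi>)" by (rule Bochner_Integration.integral_cnj)
    also have "(\<integral>z. K1 z w * cnj (K2 z w') \<partial>fock_measure \<Psi>) = K1 w' w"
      by (rule rep[OF K2 mem[OF K1], symmetric])
    finally show ?thesis .
  qed
  have "K' w w' = K w w'" for w w'
    using adjoint[OF K K', of w w'] adjoint[OF K K, of w w'] by simp
  then show ?thesis by (simp add: fun_eq_iff)
qed

section \<open>Construction of the kernel\<close>

locale growing_weight =
  fixes \<Psi> :: "real \<Rightarrow> real" and a \<mu> :: real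
  assumes cont: "continuous_on {0..} \<Psi>" and lower: "\<And>x. x \<ge> 0 \<Longrightarrow> \<Psi> x \<ge> a + \<mu> * x" and \<mu>: "\<mu> > 0"
begin

definition "s m = enn2real (halfline_moment \<Psi> m)"

lemma s: "s m > 0" "halfline_moment \<Psi> m = ennreal (s m)"
proof -
  show e: "halfline_moment \<Psi> m = ennreal (s m)"
    using halfline_moment_finite[OF cont lower \<mu>, of m] by (simp add: s_def)
  obtain c where "c > 0" "\<And>m. halfline_moment \<Psi> m \<ge> ennreal (c * 1 ^ m)"
    using halfline_moment_lower[OF cont, of 1] by auto
  then have "ennreal c \<le> ennreal (s m)" "c > 0" using e by (metis mult.right_neutral power_one)+
  then show "s m > 0" by (metis ennreal_le_iff2 less_le_trans not_le order.strict_trans1)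
qed

text \<open>The reciprocal of the integral of \<open>cmod (ip z w) ^ (2 * n)\<close> for a unit
  vector \<open>w\<close>, by \<open>fock_ip_power\<close>. The type argument carries the dimension,
  which \<open>n\<close> does not determine.\<close>

definition kernel_coefficient :: "'d :: finite itself \<Rightarrow> nat \<Rightarrow> real" where
  "kernel_coefficient _ n = 1 / measure (gaussian :: (complex ^ 'd) measure) UNIV *
     (fact (n + (CARD('d) - 1)) / fact n / s (n + (CARD('d) - 1)))"

lemma kernel_coefficient_pos: "kernel_coefficient TYPE('d :: finite) n > 0"
  using gaussian_mass_pos[where 'd = 'd] s(1) by (simp add: kernel_coefficient_def)

lemma kernel_coefficient_summable: "summable (\<lambda>n. kernel_coefficient TYPE('d :: finite) n * x ^ n)"
proof -
  define e where "e = CARD('d) - 1"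
  define c0 where "c0 = measure (gaussian :: (complex ^ 'd) measure) UNIV"
  have c0: "c0 > 0" unfolding c0_def by (rule gaussian_mass_pos)
  \<comment> \<open>The factorial ratio costs \<open>exp 1 ^ n\<close>; this \<open>R\<close> brings
    \<open>exp 1 * \<bar>x\<bar> / R\<close> down to at most 1/2, and the summand 1 keeps it
    positive for \<open>x = 0\<close>.\<close>
  define R where "R = 2 * exp 1 * \<bar>x\<bar> + 1"
  have R: "R > 0" by (auto simp: R_def intro: add_nonneg_pos)
  obtain c where c: "c > 0" "\<And>m. halfline_moment \<Psi> m \<ge> ennreal (c * R ^ m)"
    using halfline_moment_lower[OF cont less_imp_le[OF R]] by blast
  have sl: "s m \<ge> c * R ^ m" for m
    using c(2)[of m] s[of m] by (simp add: ennreal_le_iff)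
  define C where "C = 1 / c0 * (fact e * exp (real e + 1) / (c * R ^ e))"
  have C: "C > 0" using c0 c R by (simp add: C_def)
  show ?thesis
  proof (rule summable_comparison_test')
    show "summable (\<lambda>n. C * (1 / 2) ^ n)" by (intro summable_mult summable_geometric) auto
    fix n :: nat
    have "fact (n + e) / fact n \<le> (real n + real e + 1) ^ e" by (rule fact_ratio_bounds)
    also have "\<dots> \<le> fact e * exp (real n + real e + 1)" by (rule power_le_exp) simp
    also have "exp (real n + real e + 1) = exp (real e + 1) * exp 1 ^ n"
      by (simp add: exp_of_nat_mult[symmetric] flip: exp_add)
    finally have W: "fact (n + e) / fact n \<le> fact e * (exp (real e + 1) * exp 1 ^ n)" .
    have "fact (n + e) / fact n / s (n + e) \<le> fact e * (exp (real e + 1) * exp 1 ^ n) / (c * R ^ (n + e))"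
      using W sl c R s(1) by (intro frac_le) auto
    then have "1 / c0 * (fact (n + e) / fact n / s (n + e)) * \<bar>x\<bar> ^ n \<le> 1 / c0 * (fact e * (exp (real e + 1) * exp 1 ^ n) / (c * R ^ (n + e))) * \<bar>x\<bar> ^ n"
      using c0 by (intro mult_right_mono mult_left_mono) auto
    also have "\<dots> = C * (exp 1 * \<bar>x\<bar> / R) ^ n"
      by (simp add: C_def power_add power_mult_distrib power_divide mult_ac)
    also have "\<dots> \<le> C * (1 / 2) ^ n"
      using C R by (intro mult_left_mono power_mono) (auto simp: R_def field_simps)
    finally have "1 / c0 * (fact (n + e) / fact n / s (n + e)) * \<bar>x\<bar> ^ n \<le> C * (1 / 2) ^ n" .
    moreover have "kernel_coefficient TYPE('d) n = 1 / c0 * (fact (n + e) / fact n / s (n + e))"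
      by (simp only: kernel_coefficient_def e_def c0_def)
    moreover have "norm (kernel_coefficient TYPE('d) n * x ^ n) = kernel_coefficient TYPE('d) n * \<bar>x\<bar> ^ n"
      using kernel_coefficient_pos[of n, where 'd = 'd] by (simp add: abs_mult power_abs)
    ultimately show "norm (kernel_coefficient TYPE('d) n * x ^ n) \<le> C * (1 / 2) ^ n" by simp
  qed
qed

lemma kernel_coefficient_complex_summable:
  "summable (\<lambda>n. complex_of_real (kernel_coefficient TYPE('d :: finite) n) * \<zeta> ^ n)"
proof (rule summable_norm_cancel)
  show "summable (\<lambda>n. norm (complex_of_real (kernel_coefficient TYPE('d) n) * \<zeta> ^ n))"
    using kernel_coefficient_summable[of "cmod \<zeta>", where 'd = 'd] kernel_coefficient_pos[where 'd = 'd]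
    by (simp add: norm_mult norm_power less_imp_le)
qed

definition fock_kernel :: "complex ^ 'd \<Rightarrow> complex ^ 'd \<Rightarrow> complex" where
  "fock_kernel z w = (\<Sum>n. complex_of_real (kernel_coefficient TYPE('d) n) * ip z w ^ n)"

text \<open>With \<open>w = \<rho> *s v\<close> and \<open>v\<close> a unit vector, the kernel is a
  power series in \<open>ip z v\<close> alone. Integrated against \<open>f\<close>, the conjugate of
  its \<open>n\<close>-th term returns the Taylor coefficient of \<open>f\<close> along
  \<open>v\<close> times \<open>\<rho> ^ n\<close>, because coefficient and moment are reciprocal;
  these sum to \<open>f w\<close>. Integrability rests on Young's inequality with weights
  \<open>2 ^ n\<close>, whose loss an everywhere convergent series can afford.\<close>

lemma reproducing_kernel_at:
  fixes w :: "complex ^ 'd"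
  shows "(\<lambda>z. fock_kernel z w) \<in> fock_space \<Psi>"
    and "f \<in> fock_space \<Psi> \<Longrightarrow> f w = (\<integral>z. f z * cnj (fock_kernel z w) \<partial>fock_measure \<Psi>)"
proof -
  obtain v \<rho> where v: "norm v = 1" and \<rho>: "\<rho> \<ge> 0" and w: "w = complex_of_real \<rho> *s v"
    by (rule unit_vector_decomposition)
  let ?M = "fock_measure \<Psi> :: (complex ^ 'd) measure"
  have fin: "finite_measure ?M" by (rule finite_fock_measure[OF cont lower \<mu>])
  define b0 where "b0 = kernel_coefficient TYPE('d)"
  define N where "N n = (\<integral>z. cmod (ip z v) ^ (2 * n) \<partial>?M)" for n
  have Nint: "integrable ?M (\<lambda>z. cmod (ip z v) ^ (2 * n))" for n
    by (rule fock_ip_power(1)[OF cont v s])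
  have b0N: "b0 n * N n = 1" for n
    using gaussian_mass_pos[where 'd = 'd] s(1)[of "n + (CARD('d) - 1)"]
    unfolding N_def fock_ip_power(2)[OF cont v s] b0_def kernel_coefficient_def by simp
  have b0: "b0 n > 0" for n unfolding b0_def by (rule kernel_coefficient_pos)
  define b where "b n = b0 n * \<rho> ^ n" for n
  have bn0: "b n \<ge> 0" for n using b0[of n] \<rho> by (simp add: b_def)
  have bs: "summable (\<lambda>n. complex_of_real (b n) * \<zeta> ^ n)" for \<zeta> :: complex
    using kernel_coefficient_complex_summable[of "of_real \<rho> * \<zeta>", where 'd = 'd]
    by (simp add: b_def b0_def power_mult_distrib mult_ac)
  have Kv: "fock_kernel z w = (\<Sum>n. complex_of_real (b n) * ip z v ^ n)" for z
    by (simp add: fock_kernel_def w ip_smult_right b_def b0_def power_mult_distrib mult_ac)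
  have sq: "summable (\<lambda>n. 2 ^ n * (b n)\<^sup>2 * N n)"
  proof -
    have "2 ^ n * (b n)\<^sup>2 * N n = b0 n * (2 * \<rho>\<^sup>2) ^ n" for n
    proof -
      have "2 ^ n * (b n)\<^sup>2 * N n = (b0 n * N n) * (b0 n * (2 ^ n * (\<rho> ^ n)\<^sup>2))"
        by (simp add: b_def power2_eq_square mult_ac)
      also have "2 ^ n * (\<rho> ^ n)\<^sup>2 = (2 * \<rho>\<^sup>2) ^ n" by (simp add: power_mult_distrib power2_eq_square)
      finally show ?thesis by (simp add: b0N)
    qed
    then have eq: "(\<lambda>n. 2 ^ n * (b n)\<^sup>2 * N n) = (\<lambda>n. b0 n * (2 * \<rho>\<^sup>2) ^ n)" by (rule ext)
    show ?thesis unfolding eq b0_def by (rule kernel_coefficient_summable)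
  qed
  have ent: "entire (\<lambda>z. fock_kernel z w)"
  proof -
    have "entire (\<lambda>z. (\<lambda>\<zeta>. \<Sum>n. complex_of_real (b n) * \<zeta> ^ n) (ip z v))"
      by (rule entire_of_ip) (rule termdiffs_strong_converges_everywhere[OF bs])
    moreover have "(\<lambda>z. (\<lambda>\<zeta>. \<Sum>n. complex_of_real (b n) * \<zeta> ^ n) (ip z v)) = (\<lambda>z. fock_kernel z w)"
      by (rule ext) (rule Kv[symmetric])
    ultimately show ?thesis by (simp only:)
  qed
  have absb: "summable (\<lambda>n. b n * x ^ n)" if "x \<ge> 0" for x
    using kernel_coefficient_summable[of "\<rho> * x", where 'd = 'd]
    by (simp add: b_def b0_def power_mult_distrib mult_ac)
  \<comment> \<open>\<open>2 * H\<close> will dominate the squared kernel. The terms of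
    \<open>H\<close> integrate to \<open>b0 n * (2 * \<rho>\<^sup>2) ^ n\<close>, which is summable
    because the coefficients \<open>b0\<close> define an entire series.\<close>
  define H where "H z = (\<Sum>n. 2 ^ n * (b n)\<^sup>2 * cmod (ip z v) ^ (2 * n))" for z
  have Hs: "summable (\<lambda>n. 2 ^ n * (b n)\<^sup>2 * x ^ (2 * n))" if "x \<ge> 0" for x
  proof (rule summable_comparison_test_ev)
    have s2: "summable (\<lambda>n. b n * (2 * x\<^sup>2 + 2) ^ n)" by (rule absb) simp
    then have "(\<lambda>n. b n * (2 * x\<^sup>2 + 2) ^ n) \<longlonglongrightarrow> 0" by (rule summable_LIMSEQ_zero)
    then have "\<forall>\<^sub>F n in sequentially. b n * (2 * x\<^sup>2 + 2) ^ n < 1" by (rule order_tendstoD) simp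
    then show "\<forall>\<^sub>F n in sequentially. norm (2 ^ n * (b n)\<^sup>2 * x ^ (2 * n)) \<le> b n * (2 * x\<^sup>2 + 2) ^ n"
    proof eventually_elim
      case (elim n)
      have "b n * 1 ^ n \<le> b n * (2 * x\<^sup>2 + 2) ^ n" using bn0 by (intro mult_left_mono power_mono) auto
      then have b1: "b n \<le> 1" using elim by simp
      have nn: "0 \<le> 2 ^ n * (b n)\<^sup>2 * x ^ (2 * n)" using that by simp
      then have "norm (2 ^ n * (b n)\<^sup>2 * x ^ (2 * n)) = 2 ^ n * (b n)\<^sup>2 * x ^ (2 * n)"
        by (simp only: real_norm_def abs_of_nonneg)
      also have "\<dots> = (b n * b n) * (2 * x\<^sup>2) ^ n"
        by (simp add: power_mult power_mult_distrib power2_eq_square mult_ac)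
      also have "\<dots> \<le> (b n * 1) * (2 * x\<^sup>2 + 2) ^ n"
      proof (rule mult_mono)
        show "b n * b n \<le> b n * 1" using bn0[of n] b1 by (intro mult_left_mono) auto
        show "(2 * x\<^sup>2) ^ n \<le> (2 * x\<^sup>2 + 2) ^ n" by (rule power_mono) auto
      qed (use bn0[of n] in auto)
      also have "\<dots> = b n * (2 * x\<^sup>2 + 2) ^ n" by (simp only: mult_1_right)
      finally show ?case .
    qed
    show "summable (\<lambda>n. b n * (2 * x\<^sup>2 + 2) ^ n)" by (rule s2)
  qed
  have Hint: "integrable ?M H"
    unfolding H_def
  proof (rule integrable_suminf)
    show "integrable ?M (\<lambda>z. 2 ^ n * (b n)\<^sup>2 * cmod (ip z v) ^ (2 * n))" for n
      by (intro integrable_mult_right Nint)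
    show "AE z in ?M. summable (\<lambda>n. norm (2 ^ n * (b n)\<^sup>2 * cmod (ip z v) ^ (2 * n)))"
      using Hs by (intro AE_I2) (simp add: abs_mult)
    show "summable (\<lambda>n. \<integral>z. norm (2 ^ n * (b n)\<^sup>2 * cmod (ip z v) ^ (2 * n)) \<partial>?M)"
      using sq by (simp add: abs_mult N_def)
  qed
  have KH: "(cmod (fock_kernel z w))\<^sup>2 \<le> 2 * H z" for z
  proof -
    define X where "X = (\<Sum>n. b n * cmod (ip z v) ^ n)"
    have Xs: "summable (\<lambda>n. b n * cmod (ip z v) ^ n)" by (rule absb) simp
    have X0: "X \<ge> 0" unfolding X_def using bn0 by (intro suminf_nonneg Xs) auto
    have "cmod (fock_kernel z w) \<le> X"
      unfolding Kv X_def using bn0 Xs by (intro summable_norm[THEN order_trans] suminf_le) (auto simp: norm_mult norm_power)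
    then have KX: "(cmod (fock_kernel z w))\<^sup>2 \<le> X\<^sup>2" by (intro power_mono) auto
    have "X\<^sup>2 \<le> 2 * H z"
    proof (cases "X = 0")
      case True
      have "H z \<ge> 0" unfolding H_def by (intro suminf_nonneg Hs) auto
      then show ?thesis using True by simp
    next
      case False
      then have X: "X > 0" using X0 by simp
      \<comment> \<open>Summed over \<open>n\<close>, the first terms contribute
        \<open>X\<^sup>2 / 2\<close>, half of the left side \<open>X * X\<close>, which can be
        absorbed.\<close>
      have young: "X * (b n * cmod (ip z v) ^ n) \<le> X\<^sup>2 / 4 * (1 / 2) ^ n + 2 ^ n * (b n)\<^sup>2 * cmod (ip z v) ^ (2 * n)" for n
      proof -
        define y where "y = b n * cmod (ip z v) ^ n"
        have "0 \<le> (X / 2 - 2 ^ n * y)\<^sup>2 * (1 / 2) ^ n" by simp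
        also have "(X / 2 - 2 ^ n * y)\<^sup>2 * (1 / 2) ^ n = X\<^sup>2 / 4 * (1 / 2) ^ n - X * y * (2 ^ n * (1 / 2) ^ n) + 2 ^ n * y\<^sup>2 * (2 ^ n * (1 / 2) ^ n)"
          by (simp add: power2_eq_square algebra_simps)
        also have "(2::real) ^ n * (1 / 2) ^ n = 1" by (simp flip: power_mult_distrib)
        finally show ?thesis by (simp add: y_def power_mult_distrib power_even_eq)
      qed
      have g: "summable (\<lambda>n. X\<^sup>2 / 4 * (1 / 2) ^ n :: real)" by (intro summable_mult summable_geometric) simp
      have "X * X = (\<Sum>n. X * (b n * cmod (ip z v) ^ n))" unfolding X_def by (rule suminf_mult[OF Xs, symmetric])
      also have "\<dots> \<le> (\<Sum>n. X\<^sup>2 / 4 * (1 / 2) ^ n + 2 ^ n * (b n)\<^sup>2 * cmod (ip z v) ^ (2 * n))"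
        by (intro suminf_le young summable_mult Xs summable_add g Hs) simp
      also have "\<dots> = (\<Sum>n. X\<^sup>2 / 4 * (1 / 2) ^ n) + H z"
        unfolding H_def by (intro suminf_add[symmetric] g Hs) simp
      also have "(\<Sum>n. X\<^sup>2 / 4 * (1 / 2) ^ n) = X\<^sup>2 / 4 * (\<Sum>n. (1 / 2) ^ n)"
        by (intro suminf_mult summable_geometric) simp
      also have "(\<Sum>n. (1 / 2 :: real) ^ n) = 2" by (subst suminf_geometric) auto
      finally show ?thesis by (simp add: power2_eq_square)
    qed
    with KX show ?thesis by simp
  qed
  have Km[measurable]: "(\<lambda>z. fock_kernel z w) \<in> borel_measurable borel"
    using entire_continuous[OF ent] by (rule borel_measurable_continuous_onI)
  have "integrable ?M (\<lambda>z. (cmod (fock_kernel z w))\<^sup>2)"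
  proof (rule Bochner_Integration.integrable_bound)
    show "integrable ?M (\<lambda>z. 2 * H z)" by (intro integrable_mult_right Hint)
    show "AE z in ?M. norm ((cmod (fock_kernel z w))\<^sup>2) \<le> norm (2 * H z)"
      using KH by (intro AE_I2) (simp add: order_trans[OF _ abs_ge_self])
  qed measurable
  then show "(\<lambda>z. fock_kernel z w) \<in> fock_space \<Psi>" using ent by (simp add: fock_space_def)
  assume "f \<in> fock_space \<Psi>"
  then have ef: "entire f" and f2: "integrable ?M (\<lambda>z. (cmod (f z))\<^sup>2)" by (auto simp: fock_space_def)
  have [measurable]: "f \<in> borel_measurable borel"
    using entire_continuous[OF ef] by (rule borel_measurable_continuous_onI)
  have young: "x * y \<le> t * x\<^sup>2 + y\<^sup>2 / t" if "t > 0" for x y t :: real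
  proof -
    have "0 \<le> (t * x - y / 2)\<^sup>2" by simp
    then have "t * (x * y) \<le> t * (t * x\<^sup>2) + y\<^sup>2 / 4" by (simp add: power2_eq_square algebra_simps)
    also have "\<dots> \<le> t * (t * x\<^sup>2) + y\<^sup>2" by simp
    also have "\<dots> = t * (t * x\<^sup>2 + y\<^sup>2 / t)" using that by (simp add: field_simps)
    finally show ?thesis using that by simp
  qed
  have int: "integrable ?M (\<lambda>z. f z * cnj (ip z v) ^ n)" for n
  proof (rule Bochner_Integration.integrable_bound)
    show "integrable ?M (\<lambda>z. (cmod (f z))\<^sup>2 + cmod (ip z v) ^ (2 * n))"
      by (intro Bochner_Integration.integrable_add f2 Nint)
    show "AE z in ?M. norm (f z * cnj (ip z v) ^ n) \<le> norm ((cmod (f z))\<^sup>2 + cmod (ip z v) ^ (2 * n))"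
    proof (rule AE_I2)
      fix z
      show "norm (f z * cnj (ip z v) ^ n) \<le> norm ((cmod (f z))\<^sup>2 + cmod (ip z v) ^ (2 * n))"
        using young[of 1 "cmod (f z)" "cmod (ip z v) ^ n"]
        by (simp add: norm_mult norm_power power_even_eq)
    qed
  qed measurable
  \<comment> \<open>The same splitting as for \<open>H\<close>, now between \<open>f\<close> and the
    powers: the weights \<open>(1 / 2) ^ n\<close> and \<open>2 ^ n\<close> keep both series
    summable.\<close>
  have sm: "summable (\<lambda>n. \<bar>b n\<bar> * (\<integral>z. cmod (f z * cnj (ip z v) ^ n) \<partial>?M))"
  proof (rule summable_comparison_test')
    define E where "E = (\<integral>z. (cmod (f z))\<^sup>2 \<partial>?M)"
    show "summable (\<lambda>n. (1 / 2) ^ n * E + 2 ^ n * (b n)\<^sup>2 * N n)"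
      by (intro summable_add summable_mult2 summable_geometric sq) simp
    fix n :: nat
    have "\<bar>b n\<bar> * (\<integral>z. cmod (f z * cnj (ip z v) ^ n) \<partial>?M) = (\<integral>z. b n * cmod (f z * cnj (ip z v) ^ n) \<partial>?M)"
      using bn0 by simp
    also have "\<dots> \<le> (\<integral>z. (1 / 2) ^ n * (cmod (f z))\<^sup>2 + 2 ^ n * (b n)\<^sup>2 * cmod (ip z v) ^ (2 * n) \<partial>?M)"
    proof (rule integral_mono)
      show "integrable ?M (\<lambda>z. b n * cmod (f z * cnj (ip z v) ^ n))"
        by (intro integrable_mult_right integrable_norm int)
      show "integrable ?M (\<lambda>z. (1 / 2) ^ n * (cmod (f z))\<^sup>2 + 2 ^ n * (b n)\<^sup>2 * cmod (ip z v) ^ (2 * n))"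
        by (intro Bochner_Integration.integrable_add integrable_mult_right f2 Nint)
      fix z
      show "b n * cmod (f z * cnj (ip z v) ^ n) \<le> (1 / 2) ^ n * (cmod (f z))\<^sup>2 + 2 ^ n * (b n)\<^sup>2 * cmod (ip z v) ^ (2 * n)"
      proof -
        have "b n * cmod (f z * cnj (ip z v) ^ n) = cmod (f z) * (b n * cmod (ip z v) ^ n)"
          by (simp add: norm_mult norm_power)
        also have "\<dots> \<le> (1 / 2) ^ n * (cmod (f z))\<^sup>2 + (b n * cmod (ip z v) ^ n)\<^sup>2 / (1 / 2) ^ n"
          by (rule young) simp
        also have "(b n * cmod (ip z v) ^ n)\<^sup>2 / (1 / 2) ^ n = 2 ^ n * (b n)\<^sup>2 * cmod (ip z v) ^ (2 * n)"
          by (simp add: power_even_eq power_mult_distrib power_divide)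
        finally show ?thesis .
      qed
    qed
    also have "\<dots> = (1 / 2) ^ n * E + 2 ^ n * (b n)\<^sup>2 * N n"
      unfolding E_def N_def using f2 Nint by (subst Bochner_Integration.integral_add) auto
    finally show "norm (\<bar>b n\<bar> * (\<integral>z. cmod (f z * cnj (ip z v) ^ n) \<partial>?M)) \<le> (1 / 2) ^ n * E + 2 ^ n * (b n)\<^sup>2 * N n" by simp
  qed
  have "(\<lambda>n. b n * (taylor_coefficient f v n * complex_of_real (N n))) sums (\<integral>z. f z * (\<Sum>n. b n * cnj (ip z v) ^ n) \<partial>?M)"
    unfolding N_def by (rule integral_against_power_series[OF cont fin ef v int bs sm])
  also have "(\<lambda>n. b n * (taylor_coefficient f v n * complex_of_real (N n))) = (\<lambda>n. taylor_coefficient f v n * of_real \<rho> ^ n)"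
  proof
    fix n
    have "b n * (taylor_coefficient f v n * complex_of_real (N n)) = complex_of_real (b0 n * N n) * (taylor_coefficient f v n * of_real \<rho> ^ n)"
      by (simp add: b_def mult_ac)
    then show "b n * (taylor_coefficient f v n * complex_of_real (N n)) = taylor_coefficient f v n * of_real \<rho> ^ n"
      by (simp add: b0N)
  qed
  finally have I: "(\<lambda>n. taylor_coefficient f v n * of_real \<rho> ^ n) sums (\<integral>z. f z * (\<Sum>n. b n * cnj (ip z v) ^ n) \<partial>?M)" .
  have "(\<lambda>\<zeta>. f (\<zeta> *s v)) holomorphic_on ball 0 (\<rho> + 1)"
    using entire_line_holomorphic[OF ef, of 0 v] holomorphic_on_subset[OF _ subset_UNIV] by simp
  then have "(\<lambda>n. (deriv ^^ n) (\<lambda>\<zeta>. f (\<zeta> *s v)) 0 / fact n * (of_real \<rho> - 0) ^ n) sums f (of_real \<rho> *s v)"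
    by (rule holomorphic_power_series) (use \<rho> in simp)
  then have "(\<lambda>n. taylor_coefficient f v n * of_real \<rho> ^ n) sums f w"
    by (simp add: taylor_coefficient_def w)
  then have "f w = (\<integral>z. f z * (\<Sum>n. b n * cnj (ip z v) ^ n) \<partial>?M)" using I by (rule sums_unique2)
  moreover have "(\<Sum>n. b n * cnj (ip z v) ^ n) = cnj (fock_kernel z w)" for z
  proof -
    have "(\<lambda>n. cnj (complex_of_real (b n) * ip z v ^ n)) sums cnj (fock_kernel z w)"
      unfolding sums_cnj Kv using bs by (rule summable_sums)
    then show ?thesis by (simp add: sums_iff)
  qed
  ultimately show "f w = (\<integral>z. f z * cnj (fock_kernel z w) \<partial>?M)" by (simp only:)
qed

lemma kernel_eq: "kernel \<Psi> = fock_kernel"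
proof -
  have rk: "is_reproducing_kernel \<Psi> fock_kernel"
    unfolding is_reproducing_kernel_def by (intro allI conjI ballI reproducing_kernel_at)
  show ?thesis
    unfolding kernel_def by (rule the_equality[where P = "is_reproducing_kernel \<Psi>", OF rk]) (rule is_reproducing_kernel_unique[OF _ rk])
qed

lemma kernel_diagonal:
  fixes u :: "complex ^ 'd"
  shows "kernel \<Psi> u u = complex_of_real (\<Sum>n. kernel_coefficient TYPE('d) n * ((norm u)\<^sup>2) ^ n)"
proof -
  have "(\<lambda>n. complex_of_real (kernel_coefficient TYPE('d) n * ((norm u)\<^sup>2) ^ n)) sums
      complex_of_real (\<Sum>n. kernel_coefficient TYPE('d) n * ((norm u)\<^sup>2) ^ n)"
    unfolding sums_of_real_iff by (intro summable_sums kernel_coefficient_summable)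
  then show ?thesis
    unfolding kernel_eq fock_kernel_def ip_self by (simp add: sums_iff)
qed

end

subsection \<open>The Bloch space\<close>

text \<open>\<open>l\<close> and \<open>m\<close> are the first two derivatives of the logarithm of
  the diagonal kernel in the squared norm, so \<open>l x + x * m x\<close> is the radial
  eigenvalue.\<close>

lemma bergman_matrix_and_weight:
  assumes \<Psi>: "smooth_weight \<Psi>" and S: "Phi \<Psi> \<in> class_S"
  obtains l m :: "real \<Rightarrow> real" and k K :: real where
    "\<And>z :: complex ^ 'd. bergman_matrix \<Psi> z = (\<chi> i j. complex_of_real (m ((norm z)\<^sup>2)) * (z $ i * cnj (z $ j)) +
       (if i = j then complex_of_real (l ((norm z)\<^sup>2)) else 0))"
    and "k > 0" "K > 0"
    and "\<And>x. x \<ge> 0 \<Longrightarrow> k * hderiv (Phi \<Psi>) x \<le> l x + x * m x \<and> l x + x * m x \<le> K * hderiv (Phi \<Psi>) x"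
    and "\<And>x. x \<ge> 0 \<Longrightarrow> k * hderiv \<Psi> x \<le> l x \<and> l x \<le> K * hderiv \<Psi> x"
proof -
  interpret smooth_weight \<Psi> by fact
  interpret growing_weight \<Psi> "\<Psi> 0" "hderiv \<Psi> 0"
    by unfold_locales (use continuous_on_\<Psi> \<Psi>_lower pos1 in auto)
  define b where "b = kernel_coefficient TYPE('d)"
  define c where "c = measure (gaussian :: (complex ^ 'd) measure) UNIV"
  interpret weight_series \<Psi> b "1 / c" "CARD('d) - 1" s
  proof
    show "b n > 0" "summable (\<lambda>n. b n * x ^ n)" for n x
      unfolding b_def by (rule kernel_coefficient_pos kernel_coefficient_summable)+
    show "1 / c > 0" unfolding c_def by (simp add: gaussian_mass_pos)
    show "b n = 1 / c * (fact (n + (CARD('d) - 1)) / fact n / s (n + (CARD('d) - 1)))" for n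
      by (simp only: b_def c_def kernel_coefficient_def)
  qed (use S s in auto)
  have log_kernel: "(\<lambda>u :: complex ^ 'd. ln (kernel \<Psi> u u)) = (\<lambda>u. complex_of_real (ln (F ((norm u)\<^sup>2))))"
  proof
    fix u :: "complex ^ 'd"
    have "kernel \<Psi> u u = complex_of_real (F ((norm u)\<^sup>2))" 
      unfolding kernel_diagonal unfolding F_def unfolding b_def ..
    then show "ln (kernel \<Psi> u u) = complex_of_real (ln (F ((norm u)\<^sup>2)))"
      using F_pos[of "(norm u)\<^sup>2"] by (simp add: Ln_of_real)
  qed
  have "bergman_matrix \<Psi> z = (\<chi> i j. complex_of_real (L2 ((norm z)\<^sup>2)) * (z $ i * cnj (z $ j)) +
       (if i = j then complex_of_real (L1 ((norm z)\<^sup>2)) else 0))" for z :: "complex ^ 'd"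
    unfolding bergman_matrix_def log_kernel
    by (subst dzbar_dz_radial[where G = "\<lambda>x. ln (F x)", OF DERIV_ln_F DERIV_L1]) auto
  moreover obtain k K where "k > 0" "K > 0" and
    "\<And>x. x \<ge> 0 \<Longrightarrow> k * \<Phi>1 x \<le> g1 x \<and> g1 x \<le> K * \<Phi>1 x \<and> k * \<Psi>1 x \<le> L1 x \<and> L1 x \<le> K * \<Psi>1 x"
    using derivatives_comparable by blast
  ultimately show ?thesis by (intro that[of L2 L1 k K]) (auto simp: g1_def)
qed

lemma bloch_space_iff_bounded:
  assumes "T \<in> holomorphic_operator_functions"
  shows "T \<in> bloch_space \<Psi> \<longleftrightarrow> (\<exists>M\<ge>0. \<forall>z. norm (Q \<Psi> T z) \<le> M)"
proof
  assume "T \<in> bloch_space \<Psi>"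
  then have lt: "ereal (norm (T 0)) + (SUP z. ereal (sqrt (norm (Q \<Psi> T z)))) < \<infinity>"
    by (simp add: bloch_space_def)
  define S where "S = (SUP z. ereal (sqrt (norm (Q \<Psi> T z))))"
  have le: "ereal (sqrt (norm (Q \<Psi> T z))) \<le> S" for z unfolding S_def by (rule SUP_upper) simp
  have S0: "S \<ge> 0" using le[of 0] by (rule order_trans[rotated]) simp
  have "S \<noteq> \<infinity>" using lt by (auto simp: S_def)
  then obtain s where s: "S = ereal s" using S0 by (cases S) auto
  have "norm (Q \<Psi> T z) \<le> s\<^sup>2" for z
    using le[of z] by (simp add: s sqrt_le_D)
  then show "\<exists>M\<ge>0. \<forall>z. norm (Q \<Psi> T z) \<le> M" by (intro exI[of _ "s\<^sup>2"]) auto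
next
  assume "\<exists>M\<ge>0. \<forall>z. norm (Q \<Psi> T z) \<le> M"
  then obtain M where M: "\<And>z. norm (Q \<Psi> T z) \<le> M" by blast
  have "(SUP z. ereal (sqrt (norm (Q \<Psi> T z)))) \<le> ereal (sqrt M)"
    using M by (intro SUP_least) simp
  then have "ereal (norm (T 0)) + (SUP z. ereal (sqrt (norm (Q \<Psi> T z)))) \<le> ereal (norm (T 0)) + ereal (sqrt M)"
    by (rule add_left_mono)
  also have "\<dots> < \<infinity>" by simp
  finally show "T \<in> bloch_space \<Psi>" using assms by (simp add: bloch_space_def)
qed

theorem mainTheorem4:
  fixes \<Psi> :: "real \<Rightarrow> real"
    and T :: "complex ^ 'd \<Rightarrow> ('h :: separable_complex_hilbert_space \<Rightarrow>\<^sub>L 'h)"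
  assumes "\<forall>x\<ge>0. 0 \<le> \<Psi> x"
    and "C3_halfline \<Psi>"
    and "\<forall>x\<ge>0. hderiv \<Psi> x > 0"
    and "\<forall>x\<ge>0. hderiv (hderiv \<Psi>) x \<ge> 0"
    and "\<forall>x\<ge>0. hderiv (hderiv (hderiv \<Psi>)) x \<ge> 0"
    and "Phi \<Psi> \<in> class_S"
    and "CARD('d) > 1 \<longrightarrow> \<Psi> \<in> class_S"
    and "T \<in> holomorphic_operator_functions"
  shows "T \<in> bloch_space \<Psi> \<longleftrightarrow>
    (\<exists>c\<^sub>1>0. \<exists>c\<^sub>2>0. \<forall>z.
       norm (radial_deriv T z) \<le> c\<^sub>1 * norm z * sqrt (hderiv (Phi \<Psi>) ((norm z)\<^sup>2)) \<and>
       (\<forall>i j. norm (tangential_deriv i j T z) \<le> c\<^sub>2 * norm z * sqrt (hderiv \<Psi> ((norm z)\<^sup>2))))"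
proof -
  interpret smooth_weight \<Psi> by unfold_locales (use assms(2-5) in auto)
  note T = assms(8)
  obtain l m k K where B: "\<And>z :: complex ^ 'd. bergman_matrix \<Psi> z =
       (\<chi> i j. complex_of_real (m ((norm z)\<^sup>2)) * (z $ i * cnj (z $ j)) + (if i = j then complex_of_real (l ((norm z)\<^sup>2)) else 0))"
    and k: "k > 0" and K: "K > 0"
    and g: "\<And>x. x \<ge> 0 \<Longrightarrow> k * \<Phi>1 x \<le> l x + x * m x \<and> l x + x * m x \<le> K * \<Phi>1 x"
    and l: "\<And>x. x \<ge> 0 \<Longrightarrow> k * \<Psi>1 x \<le> l x \<and> l x \<le> K * \<Psi>1 x"
    by (rule bergman_matrix_and_weight[OF smooth_weight_axioms assms(6)]) (rule that)
  define x where "x z = (norm z)\<^sup>2" for z :: "complex ^ 'd"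
  define G where "G z = l (x z) + x z * m (x z)" for z
  have x0: "x z \<ge> 0" for z by (simp add: x_def)
  have p: "\<Phi>1 (x z) > 0" "\<Psi>1 (x z) > 0" for z using \<Phi>1_pos[OF x0] pos1[OF x0] by auto
  have l0: "l (x z) > 0" for z using l[OF x0] p(2) k by (meson less_le_trans mult_pos_pos)
  have G0: "G z > 0" for z using g[OF x0] p(1) k unfolding G_def by (meson less_le_trans mult_pos_pos)
  note Qb = Q_bounds[OF T B, folded x_def, OF l0 G_def G0]
  have sq: "(norm z * sqrt y)\<^sup>2 = x z * y" if "y > 0" for z y
    using that by (simp add: power_mult_distrib x_def)
  show ?thesis
    unfolding bloch_space_iff_bounded[OF T]
  proof
    assume "\<exists>M\<ge>0. \<forall>z. norm (Q \<Psi> T z) \<le> M"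
    then obtain M where M: "M \<ge> 0" "\<And>z. norm (Q \<Psi> T z) \<le> M" by blast
    \<comment> \<open>One constant for both inequalities: the 2 is needed for the tangential bound,
      and adding 1 keeps \<open>c\<close> positive when \<open>M = 0\<close>.\<close>
    define c where "c = sqrt (2 * K * M + 1)"
    have c: "c > 0" "c\<^sup>2 = 2 * K * M + 1" using K M by (simp_all add: c_def add_nonneg_pos)
    have xM: "x z * norm (Q \<Psi> T z) \<le> x z * M" for z using M(2) x0 by (intro mult_left_mono) auto
    have "norm (radial_deriv T z) \<le> c * norm z * sqrt (\<Phi>1 (x z))" for z
    proof (rule power2_le_imp_le)
      have "(norm (radial_deriv T z))\<^sup>2 \<le> G z * (x z * M)"
        using order_trans[OF Qb(2) xM, of z] G0[of z] by (simp add: field_simps)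
      also have "\<dots> \<le> (K * \<Phi>1 (x z)) * (x z * M)"
        using g[OF x0, of z] M x0 by (intro mult_right_mono) (auto simp: G_def)
      also have "\<dots> \<le> (2 * K * M + 1) * (x z * \<Phi>1 (x z))"
        using K M x0[of z] p(1)[of z] by (simp add: algebra_simps)
      also have "\<dots> = (c * norm z * sqrt (\<Phi>1 (x z)))\<^sup>2"
        unfolding mult.assoc power_mult_distrib[of c] sq[OF p(1)] c(2) ..
      finally show "(norm (radial_deriv T z))\<^sup>2 \<le> (c * norm z * sqrt (\<Phi>1 (x z)))\<^sup>2" .
    qed (use c p(1)[of z] in auto)
    moreover have "norm (tangential_deriv i j T z) \<le> c * norm z * sqrt (\<Psi>1 (x z))" for z i j
    proof (rule power2_le_imp_le)
      have "(norm (tangential_deriv i j T z))\<^sup>2 \<le> (2 * l (x z)) * (x z * M)"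
        using order_trans[OF Qb(3) xM, of i j z] l0[of z] by (simp add: field_simps)
      also have "\<dots> \<le> (2 * (K * \<Psi>1 (x z))) * (x z * M)"
        using l[OF x0, of z] M x0 by (intro mult_right_mono) auto
      also have "\<dots> \<le> (2 * K * M + 1) * (x z * \<Psi>1 (x z))"
        using K M x0[of z] p(2)[of z] by (simp add: algebra_simps)
      also have "\<dots> = (c * norm z * sqrt (\<Psi>1 (x z)))\<^sup>2"
        unfolding mult.assoc power_mult_distrib[of c] sq[OF p(2)] c(2) ..
      finally show "(norm (tangential_deriv i j T z))\<^sup>2 \<le> (c * norm z * sqrt (\<Psi>1 (x z)))\<^sup>2" .
    qed (use c p(2)[of z] in auto)
    ultimately show "\<exists>c\<^sub>1>0. \<exists>c\<^sub>2>0. \<forall>z.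
       norm (radial_deriv T z) \<le> c\<^sub>1 * norm z * sqrt (hderiv (Phi \<Psi>) ((norm z)\<^sup>2)) \<and>
       (\<forall>i j. norm (tangential_deriv i j T z) \<le> c\<^sub>2 * norm z * sqrt (hderiv \<Psi> ((norm z)\<^sup>2)))"
      using c(1) unfolding x_def by blast
  next
    assume "\<exists>c\<^sub>1>0. \<exists>c\<^sub>2>0. \<forall>z.
       norm (radial_deriv T z) \<le> c\<^sub>1 * norm z * sqrt (hderiv (Phi \<Psi>) ((norm z)\<^sup>2)) \<and>
       (\<forall>i j. norm (tangential_deriv i j T z) \<le> c\<^sub>2 * norm z * sqrt (hderiv \<Psi> ((norm z)\<^sup>2)))"
    then obtain c1 c2 where c: "c1 > 0" "c2 > 0"
      and R: "\<And>z. norm (radial_deriv T z) \<le> c1 * norm z * sqrt (\<Phi>1 (x z))"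
      and Tg: "\<And>z i j. norm (tangential_deriv i j T z) \<le> c2 * norm z * sqrt (\<Psi>1 (x z))"
      unfolding x_def by blast
    define d where "d = real CARD('d)"
    \<comment> \<open>After division by \<open>x z\<close> the radial term is at most
      \<open>c1\<^sup>2 / k\<close> and each of the \<open>d * d\<close> tangential terms at most
      \<open>c2\<^sup>2 / (2 * k)\<close>.\<close>
    define M where "M = c1\<^sup>2 / k + d * d * c2\<^sup>2 / (2 * k)"
    have M0: "M \<ge> 0" using k by (simp add: M_def d_def)
    have bound: "norm (Q \<Psi> T z) \<le> M" if "z \<noteq> 0" for z
    proof -
      have xz: "x z > 0" using that by (simp add: x_def)
      have "(norm (radial_deriv T z))\<^sup>2 \<le> (c1 * norm z * sqrt (\<Phi>1 (x z)))\<^sup>2" by (intro power_mono R) simp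
      then have R2: "(norm (radial_deriv T z))\<^sup>2 \<le> c1\<^sup>2 * (x z * \<Phi>1 (x z))"
        unfolding mult.assoc power_mult_distrib[of c1] sq[OF p(1)] .
      have T2: "(norm (tangential_deriv i j T z))\<^sup>2 \<le> c2\<^sup>2 * (x z * \<Psi>1 (x z))" for i j
      proof -
        have "(norm (tangential_deriv i j T z))\<^sup>2 \<le> (c2 * norm z * sqrt (\<Psi>1 (x z)))\<^sup>2" by (intro power_mono Tg) simp
        then show ?thesis unfolding mult.assoc power_mult_distrib[of c2] sq[OF p(2)] .
      qed
      have "(norm (radial_deriv T z))\<^sup>2 / G z \<le> (c1\<^sup>2 * (x z * \<Phi>1 (x z))) / (k * \<Phi>1 (x z))"
        using R2 g[OF x0, of z] k p(1)[of z] x0[of z] by (intro frac_le) (auto simp: G_def)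
      also have "\<dots> = x z * (c1\<^sup>2 / k)" using p(1)[of z] by simp
      finally have 1: "(norm (radial_deriv T z))\<^sup>2 / G z \<le> x z * (c1\<^sup>2 / k)" .
      have "(\<Sum>i\<in>UNIV. \<Sum>j\<in>UNIV. (norm (tangential_deriv i j T z))\<^sup>2) \<le> (\<Sum>i\<in>(UNIV :: 'd set). \<Sum>j\<in>(UNIV :: 'd set). c2\<^sup>2 * (x z * \<Psi>1 (x z)))"
        by (intro sum_mono T2)
      also have "\<dots> = d * d * c2\<^sup>2 * (x z * \<Psi>1 (x z))" by (simp add: d_def)
      finally have "(\<Sum>i\<in>UNIV. \<Sum>j\<in>UNIV. (norm (tangential_deriv i j T z))\<^sup>2) / (2 * l (x z)) \<le> (d * d * c2\<^sup>2 * (x z * \<Psi>1 (x z))) / (2 * (k * \<Psi>1 (x z)))"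
        using l[OF x0, of z] k p(2)[of z] xz by (intro frac_le) (auto simp: d_def)
      also have "\<dots> = x z * (d * d * c2\<^sup>2 / (2 * k))" using p(2)[of z] by simp
      finally have 2: "(\<Sum>i\<in>UNIV. \<Sum>j\<in>UNIV. (norm (tangential_deriv i j T z))\<^sup>2) / (2 * l (x z)) \<le> x z * (d * d * c2\<^sup>2 / (2 * k))" .
      have "x z * norm (Q \<Psi> T z) \<le> x z * M"
        using Qb(1)[of z] 1 2 by (simp add: M_def distrib_left)
      then show ?thesis using xz by simp
    qed
    \<comment> \<open>The decomposition carries the factor \<open>x z\<close> and says nothing at
      the origin, so the single value of \<open>Q\<close> there enters the bound.\<close>
    have "norm (Q \<Psi> T z) \<le> max M (norm (Q \<Psi> T 0))" for z
      using bound[of z] by (cases "z = 0") auto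
    then show "\<exists>M\<ge>0. \<forall>z. norm (Q \<Psi> T z) \<le> M" using M0 by (intro exI[of _ "max M (norm (Q \<Psi> T 0))"]) auto
  qed
qed

end
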